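(* Let $M$ be an oriented smooth $n$-manifold and $\sigma\colon M\times(-\varepsilon,\varepsilon)\to\mathbb H^{n+1}$ a smooth map such that each $\sigma_t=\sigma(\cdot,t)$ is an immersion with small principal curvatures, with unit normal $\nu_t$, shape operator $B_t$, principal curvatures $\lambda_{t,1},\dots,\lambda_{t,n}$ and Gauss map $G_t=G_{\sigma_t}$. If $$\frac{d}{dt}\sigma_t=\left(\frac1n\sum_{k=1}^n\operatorname{arctanh}(\lambda_{t,k})\right)\nu_t ,$$ then $G_t$ evolves in $\mathcal G(\mathbb H^{n+1})$ by mean curvature flow up to a tangential term, namely $$\frac{d}{dt}G_t=\overline{\mathrm H}_t+B_t\big(\mathbb J(\overline{\mathrm H}_t)\big),$$ where $\overline{\mathrm H}_t$ is the mean curvature vector of $G_t$ and $B_t$ acts on vectors tangent to the image of $G_t$ through the identification $dG_t\colon T_pM\to dG_t(T_pM)$ (the vector $\mathbb J(\overline{\mathrm H}_t)$ being tangent to the image of $G_t$).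
   Context: Hyperboloid model: $\mathbb R^{n+1,1}$ is $\mathbb R^{n+2}$ with $\langle x,y\rangle=\sum_{i=1}^{n+1}x_iy_i-x_{n+2}y_{n+2}$, and $\mathbb H^{n+1}=\{x:\langle x,x\rangle=-1,\ x_{n+2}>0\}$ with the induced metric and a fixed orientation; $T^1\mathbb H^{n+1}=\{(x,v):x\in\mathbb H^{n+1},\langle x,v\rangle=0,\langle v,v\rangle=1\}\subset\mathbb R^{n+1,1}\times\mathbb R^{n+1,1}$. $\mathcal G(\mathbb H^{n+1})$ is the $2n$-manifold of maximal oriented unparametrized geodesics of $\mathbb H^{n+1}$, and $\mathrm p\colon T^1\mathbb H^{n+1}\to\mathcal G(\mathbb H^{n+1})$ sends $(x,v)$ to the oriented geodesic through $x$ with velocity $v$. It is a principal $\mathbb R$-bundle for the geodesic flow $\varphi_t(x,v)=(\cosh(t)x+\sinh(t)v,\sinh(t)x+\cosh(t)v)$, whose infinitesimal generator is $\chi_{(x,v)}=(v,x)$. For $w\in T_x\mathbb H^{n+1}$ with $w\perp v$ put $w^{\mathcal H}=(w,0)$, $w^{\mathcal V}=(0,w)$. Then $T_{(x,v)}T^1\mathbb H^{n+1}=\mathrm{Span}(\chi)\oplus\{w^{\mathcal H}\}\oplus\{w^{\mathcal V}\}$. The para-Sasaki metric $g$ makes these three summands mutually orthogonal, with $g(\chi,\chi)=1$, $g(w_1^{\mathcal H},w_2^{\mathcal H})=\langle w_1,w_2\rangle$, $g(w_1^{\mathcal V},w_2^{\mathcal V})=-\langle w_1,w_2\rangle$. On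 $\chi^\perp$ let $J(w^{\mathcal H})=w^{\mathcal V}$, $J(w^{\mathcal V})=w^{\mathcal H}$. Since $g$ and $J$ are invariant under $\varphi_t$ and $d\mathrm p\colon\chi^\perp_{(x,v)}\to T_{\mathrm p(x,v)}\mathcal G(\mathbb H^{n+1})$ is an isomorphism, $g|_{\chi^\perp}$ and $J$ descend to a pseudo-Riemannian metric $\mathbb G$ of signature $(n,n)$ and a tensor $\mathbb J$ with $\mathbb J^2=\mathrm{id}$. For an immersion $\sigma$ of an oriented $n$-manifold into $\mathbb H^{n+1}$ with unit normal $\nu$ compatible with the orientations (for a fixed convention), the Gauss map is $G_\sigma(p)=\mathrm p(\sigma(p),\nu(p))$. The shape operator is defined by $d\sigma(B(W))=-D_W\nu$ and the principal curvatures are its eigenvalues; they are small if they all lie in $(-1,1)$ at every point, in which case $\overline{\mathrm I}=G_\sigma^*\mathbb G$ is a Riemannian metric. With $\mathbb D$ the Levi-Civita connection of $\mathbb G$, $\overline{\mathrm{II}}(V,W)=(\mathbb D_{(G_\sigma)_*V}(G_\sigma)_*W)^\perp$ (projection to the $\mathbb G$-normal bundle) and the mean curvature vector of $G_\sigma$ is $\overline{\mathrm H}=\frac1n\mathrm{tr}_{\overline{\mathrm I}}\overline{\mathrm{II}}$. *)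

theory Defs
  imports "HOL-Analysis.Analysis"
begin

section \<open>Smooth maps and smooth manifolds\<close>

primrec Ck_on :: "nat \<Rightarrow> 'a::euclidean_space set \<Rightarrow> ('a \<Rightarrow> 'b::real_normed_vector) \<Rightarrow> bool" where
  "Ck_on 0 S f \<longleftrightarrow> continuous_on S f"
| "Ck_on (Suc k) S f \<longleftrightarrow>
     (\<forall>x\<in>S. f differentiable (at x)) \<and> (\<forall>v. Ck_on k S (\<lambda>x. frechet_derivative f (at x) v))"

text \<open>\<open>smooth_on\<close> is meant for open sets, \<open>smooth_map_on\<close> for arbitrary ones (local smooth extensions).\<close>

definition smooth_on :: "'a::euclidean_space set \<Rightarrow> ('a \<Rightarrow> 'b::real_normed_vector) \<Rightarrow> bool" where
  "smooth_on S f \<longleftrightarrow> (\<forall>k. Ck_on k S f)"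

definition smooth_map_on :: "'a::euclidean_space set \<Rightarrow> ('a \<Rightarrow> 'b::real_normed_vector) \<Rightarrow> bool" where
  "smooth_map_on S f \<longleftrightarrow>
     (\<forall>x\<in>S. \<exists>U h. open U \<and> x \<in> U \<and> smooth_on U h \<and> (\<forall>y\<in>U \<inter> S. h y = f y))"

type_synonym ('m, 'n) chart = "'m set \<times> ('m \<Rightarrow> real ^ 'n)"

definition chart_inv :: "('m, 'n::finite) chart \<Rightarrow> real ^ 'n \<Rightarrow> 'm" where
  "chart_inv c = the_inv_into (fst c) (snd c)"

definition oriented_smooth_manifold :: "'m topology \<Rightarrow> ('m, 'n::finite) chart set \<Rightarrow> bool" where
  "oriented_smooth_manifold X A \<longleftrightarrow>
     Hausdorff_space X \<and> second_countable X \<and> topspace X = (\<Union>c\<in>A. fst c) \<and>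
     (\<forall>c\<in>A. openin X (fst c) \<and> open (snd c ` fst c) \<and>
        homeomorphic_map (subtopology X (fst c)) (top_of_set (snd c ` fst c)) (snd c)) \<and>
     (\<forall>c\<in>A. \<forall>d\<in>A.
        smooth_on (snd c ` (fst c \<inter> fst d)) (snd d \<circ> chart_inv c) \<and>
        (\<forall>y\<in>snd c ` (fst c \<inter> fst d).
           det (matrix (frechet_derivative (snd d \<circ> chart_inv c) (at y))) > 0))"

text \<open>A tangent vector at \<open>p\<close> is given by its components \<open>a\<close> in a chart \<open>c\<close> around \<open>p\<close>;
  \<open>chart_diff c f p a\<close> is the derivative at \<open>p\<close> of the vector-valued map \<open>f\<close> along it.\<close>

definition chart_diff ::
  "('m, 'n::finite) chart \<Rightarrow> ('m \<Rightarrow> 'b::real_normed_vector) \<Rightarrow> 'm \<Rightarrow> real ^ 'n \<Rightarrow> 'b" where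
  "chart_diff c f p = frechet_derivative (f \<circ> chart_inv c) (at (snd c p))"


section \<open>The hyperboloid model\<close>

text \<open>With \<open>n = CARD('n)\<close>, the coordinate \<open>None\<close> is the last (timelike) one and the coordinates
  \<open>Some i\<close>, with \<open>i\<close> of the type \<open>'n option\<close> of cardinality \<open>n + 1\<close>, are the spacelike ones.\<close>

type_synonym 'n minkowski = "real ^ ('n option option)"

definition mink :: "'n::finite minkowski \<Rightarrow> 'n minkowski \<Rightarrow> real" where
  "mink x y = (\<Sum>i\<in>UNIV. x $ Some i * y $ Some i) - x $ None * y $ None"

definition hyp_space :: "'n::finite minkowski set" where
  "hyp_space = {x. mink x x = -1 \<and> x $ None > 0}"

definition unit_tangent :: "('n::finite minkowski \<times> 'n minkowski) set" where
  "unit_tangent = {(x, v). x \<in> hyp_space \<and> mink x v = 0 \<and> mink v v = 1}"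

definition tangent_T1 ::
  "'n::finite minkowski \<times> 'n minkowski \<Rightarrow> ('n minkowski \<times> 'n minkowski) set" where
  "tangent_T1 z = {(a, b). mink (fst z) a = 0 \<and> mink (snd z) b = 0 \<and>
     mink a (snd z) + mink (fst z) b = 0}"

text \<open>The flow is linear in \<open>(x, v)\<close>, so \<open>geod_flow t\<close> is also its own differential.\<close>

definition geod_flow ::
  "real \<Rightarrow> 'n::finite minkowski \<times> 'n minkowski \<Rightarrow> 'n minkowski \<times> 'n minkowski" where
  "geod_flow t z = (cosh t *\<^sub>R fst z + sinh t *\<^sub>R snd z, sinh t *\<^sub>R fst z + cosh t *\<^sub>R snd z)"

definition chi :: "'n::finite minkowski \<times> 'n minkowski \<Rightarrow> 'n minkowski \<times> 'n minkowski" where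
  "chi z = (snd z, fst z)"

text \<open>For \<open>u\<close> tangent to the unit tangent bundle at \<open>z\<close>, these are \<open>c\<close>, \<open>w\<^sub>1\<close>, \<open>w\<^sub>2\<close> in
  the decomposition of \<open>u\<close> as \<open>c\<close> times \<open>chi z\<close>, plus the horizontal lift \<open>(w\<^sub>1, 0)\<close>, plus
  the vertical lift \<open>(0, w\<^sub>2)\<close>; see the lemma \<open>T1_decomposition\<close>.\<close>

definition chi_part :: "'n::finite minkowski \<times> 'n minkowski \<Rightarrow> 'n minkowski \<times> 'n minkowski \<Rightarrow> real" where
  "chi_part z u = mink (fst u) (snd z)"

definition hor_part ::
  "'n::finite minkowski \<times> 'n minkowski \<Rightarrow> 'n minkowski \<times> 'n minkowski \<Rightarrow> 'n minkowski" where
  "hor_part z u = fst u - chi_part z u *\<^sub>R snd z"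

definition ver_part ::
  "'n::finite minkowski \<times> 'n minkowski \<Rightarrow> 'n minkowski \<times> 'n minkowski \<Rightarrow> 'n minkowski" where
  "ver_part z u = snd u - chi_part z u *\<^sub>R fst z"

definition para_sasaki ::
  "'n::finite minkowski \<times> 'n minkowski \<Rightarrow> 'n minkowski \<times> 'n minkowski \<Rightarrow>
   'n minkowski \<times> 'n minkowski \<Rightarrow> real" where
  "para_sasaki z u u' = chi_part z u * chi_part z u' +
     mink (hor_part z u) (hor_part z u') - mink (ver_part z u) (ver_part z u')"

text \<open>The projection to the orthogonal complement of \<open>chi z\<close>, and the tensor \<open>J\<close> there: on
  \<open>(w\<^sub>1, w\<^sub>2)\<close>, a horizontal plus a vertical lift, it exchanges the entries.\<close>

definition chi_perp ::
  "'n::finite minkowski \<times> 'n minkowski \<Rightarrow> 'n minkowski \<times> 'n minkowski \<Rightarrow> 'n minkowski \<times> 'n minkowski" where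
  "chi_perp z u = u - para_sasaki z u (chi z) *\<^sub>R chi z"

definition para_J :: "'n::finite minkowski \<times> 'n minkowski \<Rightarrow> 'n minkowski \<times> 'n minkowski" where
  "para_J u = (snd u, fst u)"


section \<open>The space of oriented geodesics\<close>

text \<open>An oriented unparametrized geodesic is the orbit of the geodesic flow made of its unit
  velocity vectors.\<close>

definition geod :: "'n::finite minkowski \<times> 'n minkowski \<Rightarrow> ('n minkowski \<times> 'n minkowski) set" where
  "geod z = range (\<lambda>t. geod_flow t z)"

text \<open>A tangent vector of the space of geodesics at \<open>l\<close> is the family of its lifts: a field
  along the orbit \<open>l\<close>, with values in the orthogonal complement of \<open>chi\<close>, invariant under the flow
  (and set to 0 outside \<open>l\<close>).  Then \<open>geod_dp z u\<close> is the image of \<open>u\<close> under the differential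
  of \<open>geod\<close> at \<open>z\<close>.\<close>

type_synonym 'n geod_vec = "'n minkowski \<times> 'n minkowski \<Rightarrow> 'n minkowski \<times> 'n minkowski"

definition geod_dp ::
  "'n::finite minkowski \<times> 'n minkowski \<Rightarrow> 'n minkowski \<times> 'n minkowski \<Rightarrow> 'n geod_vec" where
  "geod_dp z u = (\<lambda>z'. if z' \<in> geod z
     then geod_flow (THE t. geod_flow t z = z') (chi_perp z u) else 0)"

definition geod_metric ::
  "('n::finite minkowski \<times> 'n minkowski) set \<Rightarrow> 'n geod_vec \<Rightarrow> 'n geod_vec \<Rightarrow> real" where
  "geod_metric l \<xi> \<eta> = (let z = (SOME z. z \<in> l) in para_sasaki z (\<xi> z) (\<eta> z))"

definition geod_J :: "'n::finite geod_vec \<Rightarrow> 'n geod_vec" where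
  "geod_J \<xi> = (\<lambda>z. para_J (\<xi> z))"

text \<open>The charts of the space of geodesics are given by parametrizations \<open>\<lambda>u. geod (s u)\<close> that
  are diffeomorphisms from an open \<open>Om\<close> in \<open>\<real>\<^sup>2\<^sup>n\<close> onto an open set, for the structure
  which makes \<open>geod\<close> a principal bundle: the parametrization lifts to a smooth \<open>s\<close>, and the
  composition of its inverse with \<open>geod\<close> is smooth.  Such a lift always exists, since principal
  \<open>\<real>\<close>-bundles are trivial.\<close>

type_synonym 'n geod_coords = "(real ^ 'n) \<times> (real ^ 'n)"

definition geod_coord ::
  "'n::finite geod_coords set \<Rightarrow> ('n geod_coords \<Rightarrow> 'n minkowski \<times> 'n minkowski) \<Rightarrow>
   ('n minkowski \<times> 'n minkowski) set \<Rightarrow> 'n geod_coords" where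
  "geod_coord Om s = the_inv_into Om (\<lambda>u. geod (s u))"

definition geod_chart ::
  "'n::finite geod_coords set \<Rightarrow> ('n geod_coords \<Rightarrow> 'n minkowski \<times> 'n minkowski) \<Rightarrow> bool" where
  "geod_chart Om s \<longleftrightarrow> open Om \<and> smooth_on Om s \<and> s ` Om \<subseteq> unit_tangent \<and>
     inj_on (\<lambda>u. geod (s u)) Om \<and>
     (let W = {z \<in> unit_tangent. geod z \<in> (\<lambda>u. geod (s u)) ` Om} in
        openin (top_of_set unit_tangent) W \<and> smooth_map_on W (\<lambda>z. geod_coord Om s (geod z)))"

definition geod_chart_vec ::
  "('n geod_coords \<Rightarrow> 'n::finite minkowski \<times> 'n minkowski) \<Rightarrow>
   'n geod_coords \<Rightarrow> 'n geod_coords \<Rightarrow> 'n geod_vec" where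
  "geod_chart_vec s u a = geod_dp (s u) (frechet_derivative s (at u) a)"

definition geod_chart_metric ::
  "('n geod_coords \<Rightarrow> 'n::finite minkowski \<times> 'n minkowski) \<Rightarrow>
   'n geod_coords \<Rightarrow> 'n geod_coords \<Rightarrow> 'n geod_coords \<Rightarrow> real" where
  "geod_chart_metric s u a b =
     geod_metric (geod (s u)) (geod_chart_vec s u a) (geod_chart_vec s u b)"

definition has_geod_velocity ::
  "'n::finite geod_coords set \<Rightarrow> ('n geod_coords \<Rightarrow> 'n minkowski \<times> 'n minkowski) \<Rightarrow>
   (real \<Rightarrow> ('n minkowski \<times> 'n minkowski) set) \<Rightarrow> 'n geod_vec \<Rightarrow> real \<Rightarrow> bool" where
  "has_geod_velocity Om s \<gamma> \<xi> t \<longleftrightarrow>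
     (\<exists>a. ((\<lambda>r. geod_coord Om s (\<gamma> r)) has_vector_derivative a) (at t) \<and>
          \<xi> = geod_chart_vec s (geod_coord Om s (\<gamma> t)) a)"


section \<open>Submanifolds of a pseudo-Riemannian manifold, in coordinates\<close>

text \<open>A metric on an open set of \<open>'e\<close> is \<open>g u a b\<close>, with base point \<open>u\<close>.  The Levi-Civita
  connection is \<open>DY(X) + \<Gamma>(X, Y)\<close>, where \<open>\<Gamma>\<close> is symmetric (no torsion) and
  compatible with \<open>g\<close>.\<close>

definition levi_civita ::
  "('e::euclidean_space \<Rightarrow> 'e \<Rightarrow> 'e \<Rightarrow> real) \<Rightarrow> 'e \<Rightarrow> 'e \<Rightarrow> 'e \<Rightarrow> 'e" where
  "levi_civita g u = (THE \<Gamma>. bilinear \<Gamma> \<and> (\<forall>a b. \<Gamma> a b = \<Gamma> b a) \<and>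
     (\<forall>a b c. frechet_derivative (\<lambda>w. g w b c) (at u) a = g u (\<Gamma> a b) c + g u b (\<Gamma> a c)))"

text \<open>The derivative at \<open>y\<close>, in the direction \<open>a\<close>, of a vector field \<open>Y\<close> along \<open>F\<close>.\<close>

definition cov_deriv ::
  "('e::euclidean_space \<Rightarrow> 'e \<Rightarrow> 'e \<Rightarrow> real) \<Rightarrow> (real ^ 'n::finite \<Rightarrow> 'e) \<Rightarrow>
   (real ^ 'n \<Rightarrow> 'e) \<Rightarrow> real ^ 'n \<Rightarrow> real ^ 'n \<Rightarrow> 'e" where
  "cov_deriv g F Y y a = frechet_derivative Y (at y) a +
     levi_civita g (F y) (frechet_derivative F (at y) a) (Y y)"

definition normal_part ::
  "('e::euclidean_space \<Rightarrow> 'e \<Rightarrow> 'e \<Rightarrow> real) \<Rightarrow> (real ^ 'n::finite \<Rightarrow> 'e) \<Rightarrow> real ^ 'n \<Rightarrow> 'e \<Rightarrow> 'e" where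
  "normal_part g F y v = (THE w. (\<forall>a. g (F y) w (frechet_derivative F (at y) a) = 0) \<and>
     v - w \<in> range (frechet_derivative F (at y)))"

definition second_fund ::
  "('e::euclidean_space \<Rightarrow> 'e \<Rightarrow> 'e \<Rightarrow> real) \<Rightarrow> (real ^ 'n::finite \<Rightarrow> 'e) \<Rightarrow>
   (real ^ 'n \<Rightarrow> real ^ 'n) \<Rightarrow> (real ^ 'n \<Rightarrow> real ^ 'n) \<Rightarrow> real ^ 'n \<Rightarrow> 'e" where
  "second_fund g F V W y = normal_part g F y
     (cov_deriv g F (\<lambda>y'. frechet_derivative F (at y') (W y')) y (V y))"

definition first_fund ::
  "('e::euclidean_space \<Rightarrow> 'e \<Rightarrow> 'e \<Rightarrow> real) \<Rightarrow> (real ^ 'n::finite \<Rightarrow> 'e) \<Rightarrow> real ^ 'n \<Rightarrow> real ^ 'n ^ 'n" where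
  "first_fund g F y = (\<chi> i j. g (F y) (frechet_derivative F (at y) (axis i 1))
     (frechet_derivative F (at y) (axis j 1)))"

definition mean_curvature ::
  "('e::euclidean_space \<Rightarrow> 'e \<Rightarrow> 'e \<Rightarrow> real) \<Rightarrow> (real ^ 'n::finite \<Rightarrow> 'e) \<Rightarrow> real ^ 'n \<Rightarrow> 'e" where
  "mean_curvature g F y = (1 / real CARD('n)) *\<^sub>R
     (\<Sum>i\<in>UNIV. \<Sum>j\<in>UNIV. (matrix_inv (first_fund g F y) $ i $ j) *\<^sub>R
        second_fund g F (\<lambda>_. axis i 1) (\<lambda>_. axis j 1) y)"

text \<open>For a map \<open>G\<close> from a manifold with a chart \<open>c\<close> to the space of geodesics with a chart
  given by \<open>Om\<close> and \<open>s\<close>: the coordinate expression, the differential and the mean curvature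
  vector at \<open>p\<close>.\<close>

definition geod_map_coord ::
  "('m, 'n::finite) chart \<Rightarrow> 'n geod_coords set \<Rightarrow>
   ('n geod_coords \<Rightarrow> 'n minkowski \<times> 'n minkowski) \<Rightarrow>
   ('m \<Rightarrow> ('n minkowski \<times> 'n minkowski) set) \<Rightarrow> real ^ 'n \<Rightarrow> 'n geod_coords" where
  "geod_map_coord c Om s G y = geod_coord Om s (G (chart_inv c y))"

definition geod_map_diff ::
  "('m, 'n::finite) chart \<Rightarrow> 'n geod_coords set \<Rightarrow>
   ('n geod_coords \<Rightarrow> 'n minkowski \<times> 'n minkowski) \<Rightarrow>
   ('m \<Rightarrow> ('n minkowski \<times> 'n minkowski) set) \<Rightarrow> 'm \<Rightarrow> real ^ 'n \<Rightarrow> 'n geod_vec" where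
  "geod_map_diff c Om s G p a = geod_chart_vec s (geod_coord Om s (G p))
     (frechet_derivative (geod_map_coord c Om s G) (at (snd c p)) a)"

definition geod_mean_curvature ::
  "('m, 'n::finite) chart \<Rightarrow> 'n geod_coords set \<Rightarrow>
   ('n geod_coords \<Rightarrow> 'n minkowski \<times> 'n minkowski) \<Rightarrow>
   ('m \<Rightarrow> ('n minkowski \<times> 'n minkowski) set) \<Rightarrow> 'm \<Rightarrow> 'n geod_vec" where
  "geod_mean_curvature c Om s G p = geod_chart_vec s (geod_coord Om s (G p))
     (mean_curvature (geod_chart_metric s) (geod_map_coord c Om s G) (snd c p))"


section \<open>Immersed hypersurfaces of hyperbolic space\<close>

definition smooth_family ::
  "('m, 'n::finite) chart set \<Rightarrow> real set \<Rightarrow> (real \<Rightarrow> 'm \<Rightarrow> 'n minkowski) \<Rightarrow> bool" where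
  "smooth_family A I \<sigma> \<longleftrightarrow>
     (\<forall>c\<in>A. smooth_on ((snd c ` fst c) \<times> I) (\<lambda>(y, t). \<sigma> t (chart_inv c y)))"

definition hyp_immersion ::
  "('m, 'n::finite) chart set \<Rightarrow> ('m \<Rightarrow> 'n minkowski) \<Rightarrow> bool" where
  "hyp_immersion A f \<longleftrightarrow>
     (\<forall>c\<in>A. \<forall>p\<in>fst c. f p \<in> hyp_space \<and> inj (chart_diff c f p))"

text \<open>A basis of the tangent space of the hyperboloid at \<open>x\<close>, followed by \<open>x\<close>, is a basis of
  the ambient space, so the two orientations of the hyperboloid are given by the sign of a
  determinant.  The sign \<open>\<omega>\<close> accounts for the choice of the orientation and for the
  convention relating it to the one of the hypersurface.\<close>

definition unit_normal ::
  "real \<Rightarrow> ('m, 'n::finite) chart set \<Rightarrow> ('m \<Rightarrow> 'n minkowski) \<Rightarrow> ('m \<Rightarrow> 'n minkowski) \<Rightarrow> bool" where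
  "unit_normal \<omega> A f \<nu> \<longleftrightarrow> (\<forall>c\<in>A. \<forall>p\<in>fst c.
     mink (f p) (\<nu> p) = 0 \<and> mink (\<nu> p) (\<nu> p) = 1 \<and>
     (\<forall>a. mink (chart_diff c f p a) (\<nu> p) = 0) \<and>
     \<omega> * det (\<chi> i j. case j of
                Some (Some k) \<Rightarrow> chart_diff c f p (axis k 1) $ i
              | Some None \<Rightarrow> \<nu> p $ i
              | None \<Rightarrow> f p $ i) > 0)"

text \<open>The Levi-Civita connection of the hyperboloid is the projection to its tangent space, along
  \<open>x\<close>, of the flat one.\<close>

definition hyp_cov_deriv ::
  "('m, 'n::finite) chart \<Rightarrow> ('m \<Rightarrow> 'n minkowski) \<Rightarrow> ('m \<Rightarrow> 'n minkowski) \<Rightarrow> 'm \<Rightarrow> real ^ 'n \<Rightarrow> 'n minkowski" where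
  "hyp_cov_deriv c f Y p a =
     chart_diff c Y p a + mink (chart_diff c Y p a) (f p) *\<^sub>R f p"

definition shape_operator ::
  "('m, 'n::finite) chart \<Rightarrow> ('m \<Rightarrow> 'n minkowski) \<Rightarrow> ('m \<Rightarrow> 'n minkowski) \<Rightarrow> 'm \<Rightarrow> real ^ 'n \<Rightarrow> real ^ 'n" where
  "shape_operator c f \<nu> p a = (THE b. chart_diff c f p b = - hyp_cov_deriv c f \<nu> p a)"

text \<open>\<open>lam k\<close>, for \<open>k\<close> in \<open>'n\<close>, are the eigenvalues of \<open>B\<close> with multiplicities.\<close>

definition eigenvalues_of :: "(real ^ 'n::finite \<Rightarrow> real ^ 'n) \<Rightarrow> ('n \<Rightarrow> real) \<Rightarrow> bool" where
  "eigenvalues_of B lam \<longleftrightarrow> (\<forall>x. det (x *\<^sub>R mat 1 - matrix B) = (\<Prod>k\<in>UNIV. x - lam k))"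

definition gauss_map :: "('m \<Rightarrow> 'n::finite minkowski) \<Rightarrow> ('m \<Rightarrow> 'n minkowski) \<Rightarrow>
   'm \<Rightarrow> ('n minkowski \<times> 'n minkowski) set" where
  "gauss_map f \<nu> p = geod (f p, \<nu> p)"


section \<open>Consistency of the definitions\<close>

lemma mink_simps:
  "mink (x + y) z = mink x z + mink y z" "mink z (x + y) = mink z x + mink z y"
  "mink (x - y) z = mink x z - mink y z" "mink z (x - y) = mink z x - mink z y"
  "mink (r *\<^sub>R x) z = r * mink x z" "mink z (r *\<^sub>R x) = r * mink z x"
  by (simp_all add: mink_def algebra_simps sum.distrib sum_subtractf sum_distrib_left)

lemma mink_sym: "mink x y = mink y x"
  by (simp add: mink_def mult.commute)

lemma T1_decomposition:
  assumes z: "z \<in> unit_tangent" and u: "u \<in> tangent_T1 z"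
  shows "u = chi_part z u *\<^sub>R chi z + (hor_part z u, 0) + (0, ver_part z u)"
    and "mink (fst z) (hor_part z u) = 0" "mink (snd z) (hor_part z u) = 0"
    and "mink (fst z) (ver_part z u) = 0" "mink (snd z) (ver_part z u) = 0"
  using assms
  by (auto simp: unit_tangent_def hyp_space_def tangent_T1_def chi_def chi_part_def hor_part_def
      ver_part_def mink_simps mink_sym prod_eq_iff)

lemma geod_flow_add: "geod_flow t (geod_flow r z) = geod_flow (t + r) z"
  by (simp add: geod_flow_def cosh_add sinh_add algebra_simps)

lemma geod_flow_inj:
  assumes z: "z \<in> unit_tangent" and e: "geod_flow t z = geod_flow r z"
  shows "t = r"
proof -
  have "mink (fst (geod_flow q z)) (snd z) = sinh q" for q
    using z by (auto simp: unit_tangent_def geod_flow_def mink_simps)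
  then have "sinh t = sinh r" using e by metis
  then show ?thesis by simp
qed

lemma chi_geod_flow: "chi (geod_flow t z) = geod_flow t (chi z)"
  by (simp add: geod_flow_def chi_def algebra_simps)

text \<open>The metric, the splitting and \<open>J\<close> are invariant under the flow, so that they descend.\<close>

lemma parts_geod_flow:
  assumes z: "z \<in> unit_tangent" and u: "u \<in> tangent_T1 z"
  shows "chi_part (geod_flow t z) (geod_flow t u) = chi_part z u"
    and "hor_part (geod_flow t z) (geod_flow t u) = cosh t *\<^sub>R hor_part z u + sinh t *\<^sub>R ver_part z u"
    and "ver_part (geod_flow t z) (geod_flow t u) = sinh t *\<^sub>R hor_part z u + cosh t *\<^sub>R ver_part z u"
proof -
  have h: "mink (fst u) (fst z) = 0" "mink (snd u) (snd z) = 0"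
    "mink (snd u) (fst z) = - mink (fst u) (snd z)"
    using u by (auto simp: tangent_T1_def mink_sym)
  have "chi_part (geod_flow t z) (geod_flow t u) =
      ((cosh t)\<^sup>2 - (sinh t)\<^sup>2) * mink (fst u) (snd z)"
    by (simp add: chi_part_def geod_flow_def mink_simps h power2_eq_square algebra_simps)
  then show c: "chi_part (geod_flow t z) (geod_flow t u) = chi_part z u"
    by (simp add: chi_part_def cosh_square_eq)
  show "hor_part (geod_flow t z) (geod_flow t u) = cosh t *\<^sub>R hor_part z u + sinh t *\<^sub>R ver_part z u"
    and "ver_part (geod_flow t z) (geod_flow t u) = sinh t *\<^sub>R hor_part z u + cosh t *\<^sub>R ver_part z u"
    unfolding hor_part_def ver_part_def c by (simp_all add: geod_flow_def algebra_simps)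
qed

lemma para_sasaki_geod_flow:
  assumes z: "z \<in> unit_tangent" and u: "u \<in> tangent_T1 z" "u' \<in> tangent_T1 z"
  shows "para_sasaki (geod_flow t z) (geod_flow t u) (geod_flow t u') = para_sasaki z u u'"
proof -
  have "mink (cosh t *\<^sub>R a + sinh t *\<^sub>R b) (cosh t *\<^sub>R a' + sinh t *\<^sub>R b') -
      mink (sinh t *\<^sub>R a + cosh t *\<^sub>R b) (sinh t *\<^sub>R a' + cosh t *\<^sub>R b') =
      ((cosh t)\<^sup>2 - (sinh t)\<^sup>2) * (mink a a' - mink b b')" for a b a' b' :: "'a minkowski"
    by (simp add: mink_simps power2_eq_square algebra_simps)
  then show ?thesis
    by (simp add: para_sasaki_def parts_geod_flow[OF z u(1)] parts_geod_flow[OF z u(2)] cosh_square_eq)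
qed

lemma para_J_geod_flow: "para_J (geod_flow t u) = geod_flow t (para_J u)"
  by (simp add: para_J_def geod_flow_def algebra_simps)

end

theory Submission
  imports Defs
begin

text \<open>
  The Gauss map \<open>G\<close> lifts to the map \<open>(\<sigma>, \<nu>)\<close> into the unit tangent bundle, whose differential is
  orthogonal to \<open>chi\<close>. On the orthogonal complement of \<open>chi\<close> the para-Sasaki metric is the
  restriction of a flat one, and \<open>geod\<close> is a Riemannian submersion, so that the Levi-Civita connection lifts to the
  projection of the flat derivative. As \<open>d\<nu> = - d\<sigma> \<circ> B\<close> with \<open>B\<close> self-adjoint, \<open>G\<close> is
  Lagrangian: \<open>J\<close> exchanges its tangent and normal spaces, and its second fundamental form is a
  totally symmetric cubic form, the covariant derivative of the second fundamental form of \<open>\<sigma>\<close>. Its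
  trace is, by the formula for the logarithmic derivative of a determinant, the differential of
  \<open>ln (det (1 + B) / det (1 - B)) / 2\<close>, the sum of the \<open>artanh (\<lambda>\<^sub>k)\<close>. Hence the mean curvature
  vector is \<open>J (dG w)\<close>, where \<open>-w\<close> is the gradient of the speed \<open>\<phi>\<close> of the flow for the metric
  induced by \<open>G\<close>. On the other hand \<open>(\<sigma>, \<nu>)\<close> moves by \<open>\<phi> chi\<close> plus the vertical lift of minus the
  gradient of \<open>\<phi>\<close> for the metric induced by \<open>\<sigma>\<close>, that is, of \<open>d\<sigma> (w - B (B w))\<close>, and this vertical
  lift equals \<open>J (dG w) + dG (B w)\<close>.
\<close>

section \<open>Calculus of smooth maps\<close>

text \<open>Three obstacles shape the proof. Charts of the space of geodesics come from arbitrary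
  smooth lifts \<open>s\<close>, which may drift along the flow, so that in a chart the Christoffel
  symbols are not just projected second derivatives of \<open>s\<close>. The drift adds terms in
  \<open>para_J\<close>, because the flow is generated by \<open>para_J\<close>; they cancel against
  the derivative of the flow time between \<open>s\<close> and the lift (\<sigma>, \<nu>). Next,
  neither the normal nor the eigenvalue functions come with any regularity: the normal is recovered
  as a normalised cross product, and the eigenvalues enter only through the characteristic
  polynomial at 1 and -1, which makes the speed differentiable. Finally, small curvatures act
  through the positive determinants of 1 + B and 1 - B: the metric induced by the Gauss map is the
  first fundamental form composed with 1 - B^2, hence nondegenerate, and the tangent space and its
  image by J are complementary.\<close>

lemma has_derivative_eq_frechet: "(f has_derivative f') (at x) \<Longrightarrow> frechet_derivative f (at x) = f'"
  by (rule frechet_derivative_at[symmetric])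

section \<open>Closure properties of C^k and smooth maps\<close>

lemma Ck_on_cong:
  assumes "open S" "\<And>x. x \<in> S \<Longrightarrow> f x = g x" "Ck_on k S f"
  shows "Ck_on k S g"
  using assms(2,3)
proof (induction k arbitrary: f g)
  case 0
  then show ?case by (simp cong: continuous_on_cong)
next
  case (Suc k)
  have d: "(g has_derivative frechet_derivative f (at x)) (at x)" if "x \<in> S" for x
  proof (rule has_derivative_transform_within_open[OF _ assms(1) that])
    show "(f has_derivative frechet_derivative f (at x)) (at x)"
      using Suc.prems(2) that frechet_derivative_works by auto
  qed (use Suc.prems(1) in auto)
  then have "frechet_derivative g (at x) = frechet_derivative f (at x)" if "x \<in> S" for x
    using that by (metis frechet_derivative_at)
  then have "Ck_on k S (\<lambda>x. frechet_derivative g (at x) v)" for v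
    using Suc.IH[of "\<lambda>x. frechet_derivative f (at x) v"] Suc.prems(2) by auto
  then show ?case using d by (auto simp: differentiable_def)
qed

text \<open>Lets an explicit derivative stand in for the chosen \<open>frechet_derivative\<close>,
  as the inductions on k below do.\<close>

lemma Ck_on_SucI:
  assumes "open S" "\<And>x. x \<in> S \<Longrightarrow> (f has_derivative f' x) (at x)" "\<And>v. Ck_on k S (\<lambda>x. f' x v)"
  shows "Ck_on (Suc k) S f"
proof -
  have "frechet_derivative f (at x) = f' x" if "x \<in> S" for x
    using assms(2)[OF that] by (metis frechet_derivative_at)
  then have "Ck_on k S (\<lambda>x. frechet_derivative f (at x) v)" for v
    using Ck_on_cong[OF assms(1) _ assms(3)[of v]] by auto
  then show ?thesis using assms(2) by (auto simp: differentiable_def)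
qed

lemma Ck_on_Suc_has_derivative:
  "Ck_on (Suc k) S f \<Longrightarrow> x \<in> S \<Longrightarrow> (f has_derivative frechet_derivative f (at x)) (at x)"
  using frechet_derivative_works by auto

lemma Ck_on_SucD: "Ck_on (Suc k) S f \<Longrightarrow> Ck_on k S f"
proof (induction k arbitrary: f)
  case 0
  then show ?case
    by (auto intro!: continuous_at_imp_continuous_on differentiable_imp_continuous_within)
next
  case (Suc k)
  then show ?case by (metis Ck_on.simps(2))
qed

lemma Ck_on_subset: "Ck_on k S f \<Longrightarrow> T \<subseteq> S \<Longrightarrow> Ck_on k T f"
  by (induction k arbitrary: f) (auto intro: continuous_on_subset)

lemma Ck_on_local:
  assumes "open S" "\<And>x. x \<in> S \<Longrightarrow> \<exists>T. open T \<and> x \<in> T \<and> Ck_on k T f"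
  shows "Ck_on k S f"
  using assms(2)
proof (induction k arbitrary: f)
  case 0
  then show ?case
    by (metis Ck_on.simps(1) assms(1) continuous_on_eq_continuous_at)
next
  case (Suc k)
  have "f differentiable (at x)" if "x \<in> S" for x
    using Suc.prems[OF that] by auto
  moreover have "Ck_on k S (\<lambda>x. frechet_derivative f (at x) v)" for v
    using Suc.prems by (intro Suc.IH) (metis Ck_on.simps(2))
  ultimately show ?case by simp
qed

lemma Ck_on_const: "open S \<Longrightarrow> Ck_on k S (\<lambda>x. c)"
  by (induction k arbitrary: c) (auto intro: Ck_on_SucI)

lemma Ck_on_add:
  assumes "open S" "Ck_on k S f" "Ck_on k S g"
  shows "Ck_on k S (\<lambda>x. f x + g x)"
  using assms(2,3)
proof (induction k arbitrary: f g)
  case 0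
  then show ?case by (auto intro: continuous_on_add)
next
  case (Suc k)
  show ?case
    by (rule Ck_on_SucI[OF assms(1) has_derivative_add[OF
            Ck_on_Suc_has_derivative[OF Suc.prems(1)] Ck_on_Suc_has_derivative[OF Suc.prems(2)]]])
      (use Suc in auto)
qed

lemma Ck_on_bounded_linear_compose:
  assumes "open S" "bounded_linear h" "Ck_on k S f"
  shows "Ck_on k S (\<lambda>x. h (f x))"
  using assms(3)
proof (induction k arbitrary: f)
  case 0
  then show ?case using assms(2) by (auto intro: bounded_linear.continuous_on)
next
  case (Suc k)
  show ?case
    by (rule Ck_on_SucI[OF assms(1) bounded_linear.has_derivative[OF assms(2)
            Ck_on_Suc_has_derivative[OF Suc.prems]]]) (use Suc in auto)
qed

lemma Ck_on_bounded_bilinear: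
  assumes "open S" "bounded_bilinear h" "Ck_on k S f" "Ck_on k S g"
  shows "Ck_on k S (\<lambda>x. h (f x) (g x))"
  using assms(3,4)
proof (induction k arbitrary: f g)
  case 0
  then show ?case using assms(2) by (auto intro: bounded_bilinear.continuous_on)
next
  case (Suc k)
  show ?case
    by (rule Ck_on_SucI[OF assms(1) bounded_bilinear.FDERIV[OF assms(2)
            Ck_on_Suc_has_derivative[OF Suc.prems(1)] Ck_on_Suc_has_derivative[OF Suc.prems(2)]]])
      (use Suc Suc.prems[THEN Ck_on_SucD] in \<open>auto intro!: Ck_on_add assms(1)\<close>)
qed

lemma Ck_on_sum:
  "open S \<Longrightarrow> (\<And>i. i \<in> I \<Longrightarrow> Ck_on k S (f i)) \<Longrightarrow> Ck_on k S (\<lambda>x. \<Sum>i\<in>I. f i x)"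
  by (induction I rule: infinite_finite_induct) (auto intro: Ck_on_add Ck_on_const)

text \<open>In the chain rule a moving linear map acts on a moving vector. Expanding the vector in
  the basis turns this into a finite sum of products of scalar functions and directional derivatives
  of g composed with f, to which the induction hypothesis applies; hence the induction over
  arbitrary g.\<close>

lemma Ck_on_compose:
  fixes f :: "'a::euclidean_space \<Rightarrow> 'b::euclidean_space"
  assumes "open S" "open T" "f ` S \<subseteq> T" "Ck_on k S f" "Ck_on k T g"
  shows "Ck_on k S (\<lambda>x. g (f x))"
  using assms(4,5)
proof (induction k arbitrary: g)
  case 0
  then show ?case using assms(3) by (auto intro: continuous_on_compose2)
next
  case (Suc k)
  have d: "((\<lambda>x. g (f x)) has_derivative
      (\<lambda>v. frechet_derivative g (at (f x)) (frechet_derivative f (at x) v))) (at x)"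
    if "x \<in> S" for x
    using has_derivative_compose[OF Ck_on_Suc_has_derivative[OF Suc.prems(1) that]
        Ck_on_Suc_has_derivative[OF Suc.prems(2)]] assms(3) that by auto
  have "frechet_derivative g (at (f x)) (frechet_derivative f (at x) v) =
    (\<Sum>b\<in>Basis. (frechet_derivative f (at x) v \<bullet> b) *\<^sub>R frechet_derivative g (at (f x)) b)"
    if "x \<in> S" for x v
  proof -
    have "linear (frechet_derivative g (at (f x)))"
      using Suc.prems(2) assms(3) that by (auto intro: linear_frechet_derivative)
    then show ?thesis
      by (subst (1) euclidean_representation[symmetric]) (simp only: linear_sum linear_scale)
  qed
  then have d': "((\<lambda>x. g (f x)) has_derivative (\<lambda>v. \<Sum>b\<in>Basis. (frechet_derivative f (at x) v \<bullet> b) *\<^sub>R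
      frechet_derivative g (at (f x)) b)) (at x)" if "x \<in> S" for x
    using d[OF that] that by simp
  have "Ck_on k S (\<lambda>x. frechet_derivative g (at (f x)) b)" for b
    using Suc.prems(2) by (intro Suc.IH[OF Ck_on_SucD[OF Suc.prems(1)]]) auto
  then show ?case
    by (intro Ck_on_SucI[OF assms(1) d'])
      (use Suc.prems in \<open>auto intro!: Ck_on_sum assms(1)
        Ck_on_bounded_bilinear[OF _ bounded_bilinear_scaleR]
        Ck_on_bounded_linear_compose[OF _ bounded_linear_inner_left]\<close>)
qed

lemma smooth_on_cong:
  "open S \<Longrightarrow> (\<And>x. x \<in> S \<Longrightarrow> f x = g x) \<Longrightarrow> smooth_on S f \<Longrightarrow> smooth_on S g"
  unfolding smooth_on_def using Ck_on_cong by metis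

lemma smooth_on_subset: "smooth_on S f \<Longrightarrow> T \<subseteq> S \<Longrightarrow> smooth_on T f"
  unfolding smooth_on_def using Ck_on_subset by metis

lemma smooth_on_local:
  "open S \<Longrightarrow> (\<And>x. x \<in> S \<Longrightarrow> \<exists>T. open T \<and> x \<in> T \<and> smooth_on T f) \<Longrightarrow> smooth_on S f"
  unfolding smooth_on_def using Ck_on_local by metis

lemma smooth_on_has_derivative:
  "smooth_on S f \<Longrightarrow> x \<in> S \<Longrightarrow> (f has_derivative frechet_derivative f (at x)) (at x)"
  unfolding smooth_on_def using Ck_on_Suc_has_derivative by blast

lemma smooth_on_frechet_derivative:
  "smooth_on S f \<Longrightarrow> smooth_on S (\<lambda>x. frechet_derivative f (at x) v)"
  unfolding smooth_on_def using Ck_on.simps(2) by blast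

lemma smooth_on_imp_continuous_on: "smooth_on S f \<Longrightarrow> continuous_on S f"
  unfolding smooth_on_def using Ck_on.simps(1) by blast

lemma smooth_on_const: "open S \<Longrightarrow> smooth_on S (\<lambda>x. c)"
  by (simp add: smooth_on_def Ck_on_const)

lemma smooth_on_add:
  "open S \<Longrightarrow> smooth_on S f \<Longrightarrow> smooth_on S g \<Longrightarrow> smooth_on S (\<lambda>x. f x + g x)"
  by (simp add: smooth_on_def Ck_on_add)

lemma smooth_on_sum:
  "open S \<Longrightarrow> (\<And>i. i \<in> I \<Longrightarrow> smooth_on S (f i)) \<Longrightarrow> smooth_on S (\<lambda>x. \<Sum>i\<in>I. f i x)"
  by (simp add: smooth_on_def Ck_on_sum)

lemma smooth_on_bounded_linear_compose:
  "open S \<Longrightarrow> bounded_linear h \<Longrightarrow> smooth_on S f \<Longrightarrow> smooth_on S (\<lambda>x. h (f x))"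
  by (simp add: smooth_on_def Ck_on_bounded_linear_compose)

lemma smooth_on_bounded_bilinear:
  "open S \<Longrightarrow> bounded_bilinear h \<Longrightarrow> smooth_on S f \<Longrightarrow> smooth_on S g \<Longrightarrow>
    smooth_on S (\<lambda>x. h (f x) (g x))"
  by (simp add: smooth_on_def Ck_on_bounded_bilinear)

lemma smooth_on_compose:
  fixes f :: "'a::euclidean_space \<Rightarrow> 'b::euclidean_space"
  shows "open S \<Longrightarrow> open T \<Longrightarrow> f ` S \<subseteq> T \<Longrightarrow> smooth_on S f \<Longrightarrow> smooth_on T g \<Longrightarrow>
    smooth_on S (\<lambda>x. g (f x))"
  by (simp add: smooth_on_def Ck_on_compose)

lemma smooth_on_ident: "open S \<Longrightarrow> smooth_on S (\<lambda>x. x)"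
  unfolding smooth_on_def
proof
  fix k assume S: "open S"
  show "Ck_on k S (\<lambda>x. x)"
  proof (cases k)
    case (Suc l)
    show ?thesis unfolding Suc
      by (rule Ck_on_SucI[OF S has_derivative_ident]) (rule Ck_on_const[OF S])
  qed (simp add: continuous_on_id)
qed

lemma smooth_on_prod:
  fixes f :: "'i \<Rightarrow> 'a::euclidean_space \<Rightarrow> real"
  shows "open S \<Longrightarrow> (\<And>i. i \<in> I \<Longrightarrow> smooth_on S (f i)) \<Longrightarrow> smooth_on S (\<lambda>x. \<Prod>i\<in>I. f i x)"
  by (induction I rule: infinite_finite_induct)
    (auto intro: smooth_on_const smooth_on_bounded_bilinear[OF _ bounded_bilinear_mult])

lemma smooth_on_Pair:
  assumes "open S" "smooth_on S f" "smooth_on S g"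
  shows "smooth_on S (\<lambda>x. (f x, g x))"
proof -
  have "bounded_linear (\<lambda>a. (a, 0))" "bounded_linear (\<lambda>b. (0, b))"
    by (auto intro: bounded_linear_Pair bounded_linear_ident bounded_linear_zero)
  then have "smooth_on S (\<lambda>x. (f x, 0) + (0, g x))"
    using smooth_on_bounded_linear_compose[OF assms(1) _ assms(2)]
      smooth_on_bounded_linear_compose[OF assms(1) _ assms(3)]
    by (intro smooth_on_add[OF assms(1)]) blast+
  then show ?thesis by simp
qed

lemma smooth_on_vec:
  fixes f :: "'a::euclidean_space \<Rightarrow> real ^ 'i::finite"
  assumes "open S" "\<And>i. smooth_on S (\<lambda>x. f x $ i)"
  shows "smooth_on S f"
proof -
  have "smooth_on S (\<lambda>x. \<Sum>i\<in>UNIV. f x $ i *\<^sub>R (axis i 1 :: real ^ 'i))"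
    by (intro smooth_on_sum assms smooth_on_bounded_linear_compose[OF _ bounded_linear_scaleR_left])
  moreover have "(\<Sum>i\<in>UNIV. f x $ i *\<^sub>R axis i 1) = f x" for x
    by (simp add: vec_eq_iff axis_def if_distrib[where f = "\<lambda>t. _ * t"] cong: if_cong)
  ultimately show ?thesis by (simp only:)
qed

lemma smooth_on_det:
  fixes f :: "'a::euclidean_space \<Rightarrow> real ^ 'i::finite ^ 'i"
  assumes "open S" "\<And>i j. smooth_on S (\<lambda>x. f x $ i $ j)"
  shows "smooth_on S (\<lambda>x. det (f x))"
  unfolding det_def
  by (intro smooth_on_sum smooth_on_prod smooth_on_const assms
      smooth_on_bounded_bilinear[OF _ bounded_bilinear_mult])

text \<open>Powers are closed under differentiation up to constants, so the induction runs over all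
  exponents at once. The exponent -1/2 later normalises the normal vector.\<close>

lemma smooth_on_powr: "smooth_on {0<..} (\<lambda>x::real. x powr a)"
  unfolding smooth_on_def
proof
  show "Ck_on k {0<..} (\<lambda>x::real. x powr a)" for k
  proof (induction k arbitrary: a)
    case 0
    then show ?case by (auto intro!: continuous_intros)
  next
    case (Suc k)
    show ?case
    proof (rule Ck_on_SucI)
      show "((\<lambda>x. x powr a) has_derivative (\<lambda>v. (a * x powr (a - 1)) * v)) (at x)"
        if "x \<in> {0<..}" for x :: real
        using that has_real_derivative_powr[of x a] by (simp add: has_field_derivative_def)
      show "Ck_on k {0<..} (\<lambda>x::real. (a * x powr (a - 1)) * v)" for v
        by (intro Ck_on_bounded_linear_compose[OF _ bounded_linear_mult_left]
          Ck_on_bounded_linear_compose[OF _ bounded_linear_mult_right] Suc) auto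
    qed auto
  qed
qed

text \<open>The mean value theorem, applied to \<open>\<lambda>r. f (x + ra + sb) - f (x + ra)\<close> and then to its
  derivative, expresses the mixed second difference by \<open>D\<^sub>bD\<^sub>af\<close> near \<open>x\<close>.\<close>

lemma second_difference:
  fixes f :: "'a::euclidean_space \<Rightarrow> real"
  assumes f: "smooth_on (ball x e) f" and h: "h > 0" "h * (norm a + norm b) < e"
  shows "\<exists>y. dist x y \<le> h * (norm a + norm b) \<and>
    f (x + h *\<^sub>R a + h *\<^sub>R b) - f (x + h *\<^sub>R a) - (f (x + h *\<^sub>R b) - f x) =
    h * h * frechet_derivative (\<lambda>z. frechet_derivative f (at z) a) (at y) b"
proof -
  have bd: "norm (r *\<^sub>R a + q *\<^sub>R b) \<le> h * (norm a + norm b)"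
    if "0 \<le> r" "r \<le> h" "0 \<le> q" "q \<le> h" for r q
  proof -
    have "norm (r *\<^sub>R a + q *\<^sub>R b) \<le> r * norm a + q * norm b"
      using norm_triangle_ineq[of "r *\<^sub>R a" "q *\<^sub>R b"] that by simp
    also have "\<dots> \<le> h * norm a + h * norm b"
      using that by (intro add_mono mult_right_mono) auto
    finally show ?thesis by (simp add: distrib_left)
  qed
  have dist: "dist x (x + r *\<^sub>R a + q *\<^sub>R b) \<le> h * (norm a + norm b)"
    if "0 \<le> r" "r \<le> h" "0 \<le> q" "q \<le> h" for r q
    using bd[OF that] by (metis dist_add_cancel dist_0_norm add.assoc add.right_neutral)
  have inb: "x + r *\<^sub>R a + q *\<^sub>R b \<in> ball x e" if "0 \<le> r" "r \<le> h" "0 \<le> q" "q \<le> h" for r q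
    using dist[OF that] h by simp
  have der: "((\<lambda>r. k (x + r *\<^sub>R a + q *\<^sub>R b)) has_field_derivative
      frechet_derivative k (at (x + r *\<^sub>R a + q *\<^sub>R b)) a) (at r)"
    "((\<lambda>q. k (x + r *\<^sub>R a + q *\<^sub>R b)) has_field_derivative
      frechet_derivative k (at (x + r *\<^sub>R a + q *\<^sub>R b)) b) (at q)"
    if "smooth_on (ball x e) k" "0 \<le> r" "r \<le> h" "0 \<le> q" "q \<le> h" for k :: "'a \<Rightarrow> real" and r q
  proof -
    note k = smooth_on_has_derivative[OF that(1) inb[OF that(2-)]]
    have s: "frechet_derivative k (at (x + r *\<^sub>R a + q *\<^sub>R b)) (s *\<^sub>R c) =
        frechet_derivative k (at (x + r *\<^sub>R a + q *\<^sub>R b)) c * s" for s c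
      using linear_scale[OF has_derivative_linear[OF k]] by simp
    have "((\<lambda>r. x + r *\<^sub>R a + q *\<^sub>R b) has_derivative (\<lambda>s. s *\<^sub>R a)) (at r)"
      "((\<lambda>q. x + r *\<^sub>R a + q *\<^sub>R b) has_derivative (\<lambda>s. s *\<^sub>R b)) (at q)"
      by (auto intro!: derivative_eq_intros)
    from this[THEN has_derivative_compose, OF k]
    show "((\<lambda>r. k (x + r *\<^sub>R a + q *\<^sub>R b)) has_field_derivative
        frechet_derivative k (at (x + r *\<^sub>R a + q *\<^sub>R b)) a) (at r)"
      "((\<lambda>q. k (x + r *\<^sub>R a + q *\<^sub>R b)) has_field_derivative
        frechet_derivative k (at (x + r *\<^sub>R a + q *\<^sub>R b)) b) (at q)"
      by (simp_all add: has_field_derivative_def s)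
  qed
  define d where "d q r = frechet_derivative f (at (x + r *\<^sub>R a + q *\<^sub>R b)) a" for q r
  have "\<exists>r>0. r < h \<and> f (x + h *\<^sub>R a + h *\<^sub>R b) - f (x + h *\<^sub>R a + 0 *\<^sub>R b)
      - (f (x + 0 *\<^sub>R a + h *\<^sub>R b) - f (x + 0 *\<^sub>R a + 0 *\<^sub>R b)) = (h - 0) * (d h r - d 0 r)"
    unfolding d_def using h der(1)[OF f] der(1)[OF f, of _ 0]
    by (intro MVT2[where f = "\<lambda>r. f (x + r *\<^sub>R a + h *\<^sub>R b) - f (x + r *\<^sub>R a + 0 *\<^sub>R b)"]
        DERIV_diff) auto
  then obtain r where r: "0 < r" "r < h"
    "f (x + h *\<^sub>R a + h *\<^sub>R b) - f (x + h *\<^sub>R a) - (f (x + h *\<^sub>R b) - f x) = h * (d h r - d 0 r)"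
    by auto
  have "\<exists>q>0. q < h \<and> d h r - d 0 r = (h - 0) *
      frechet_derivative (\<lambda>z. frechet_derivative f (at z) a) (at (x + r *\<^sub>R a + q *\<^sub>R b)) b"
    unfolding d_def using h r der(2)[OF smooth_on_frechet_derivative[OF f]]
    by (intro MVT2[where f = "\<lambda>q. frechet_derivative f (at (x + r *\<^sub>R a + q *\<^sub>R b)) a"]) auto
  then obtain q where "0 < q" "q < h" "d h r - d 0 r = h *
      frechet_derivative (\<lambda>z. frechet_derivative f (at z) a) (at (x + r *\<^sub>R a + q *\<^sub>R b)) b"
    by auto
  then show ?thesis
    using r dist[of r q] by (intro exI[of _ "x + r *\<^sub>R a + q *\<^sub>R b"]) auto
qed

text \<open>The mixed second difference does not change when a and b are exchanged, so by
  \<open>second_difference\<close> both mixed derivatives, taken at two nearby points, agree for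
  every small step; continuity gives equality in the limit.\<close>

lemma second_derivative_symmetric_real:
  fixes f :: "'a::euclidean_space \<Rightarrow> real"
  assumes f: "smooth_on S f" and S: "open S" "x \<in> S"
  shows "frechet_derivative (\<lambda>z. frechet_derivative f (at z) a) (at x) b =
    frechet_derivative (\<lambda>z. frechet_derivative f (at z) b) (at x) a"
proof -
  obtain e where e: "e > 0" "ball x e \<subseteq> S" using S by (meson openE)
  note fe = smooth_on_subset[OF f e(2)]
  define D where "D a b y = frechet_derivative (\<lambda>z. frechet_derivative f (at z) a) (at y) b" for a b y
  \<comment> \<open>The summand 1 keeps C positive when a and b both vanish.\<close>
  define C where "C = norm a + norm b + 1"
  have C: "C > 0" by (simp add: C_def add_nonneg_pos)
  have cont: "isCont (D a b) x" for a b
    using smooth_on_imp_continuous_on[OF smooth_on_frechet_derivative[OF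
          smooth_on_frechet_derivative[OF f]]] S unfolding D_def
    by (simp add: continuous_on_eq_continuous_at)
  \<comment> \<open>The factor 2 makes the bound by e strict, so that the points stay inside the
    ball.\<close>
  define h where "h n = e / (2 * C * real (Suc n))" for n
  have h: "h n > 0" "h n * (norm a + norm b) < e" "h n * (norm a + norm b) \<le> e / real (Suc n)" for n
  proof -
    show "h n > 0" using e C by (simp add: h_def)
    then have "h n * (norm a + norm b) \<le> h n * C" by (intro mult_left_mono) (auto simp: C_def)
    also have "h n * C = e / real (Suc n) / 2" using C by (simp add: h_def)
    finally have *: "h n * (norm a + norm b) \<le> e / real (Suc n) / 2" .
    have "e / real (Suc n) \<le> e" "e / real (Suc n) > 0" using e by (simp_all add: field_simps)
    then have "e / real (Suc n) / 2 < e / real (Suc n)" using half_gt_zero[of "e / real (Suc n)"] field_sum_of_halves[of "e / real (Suc n)"] by (metis less_add_same_cancel1)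
    then show "h n * (norm a + norm b) < e" "h n * (norm a + norm b) \<le> e / real (Suc n)"
      using * \<open>e / real (Suc n) \<le> e\<close> by (meson le_less_trans less_le_trans less_imp_le)+
  qed
  have "\<forall>n. \<exists>y. dist x y \<le> h n * (norm a + norm b) \<and>
    f (x + h n *\<^sub>R a + h n *\<^sub>R b) - f (x + h n *\<^sub>R a) - (f (x + h n *\<^sub>R b) - f x) = h n * h n * D a b y"
    using second_difference[OF fe h(1) h(2)] unfolding D_def by blast
  then obtain y where y: "\<And>n. dist x (y n) \<le> h n * (norm a + norm b)"
    "\<And>n. f (x + h n *\<^sub>R a + h n *\<^sub>R b) - f (x + h n *\<^sub>R a) - (f (x + h n *\<^sub>R b) - f x) =
      h n * h n * D a b (y n)" by metis
  have "\<forall>n. \<exists>y. dist x y \<le> h n * (norm b + norm a) \<and>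
    f (x + h n *\<^sub>R b + h n *\<^sub>R a) - f (x + h n *\<^sub>R b) - (f (x + h n *\<^sub>R a) - f x) = h n * h n * D b a y"
    using second_difference[OF fe h(1), of _ b a] h(2) unfolding D_def by (simp add: add.commute)
  then obtain w where w: "\<And>n. dist x (w n) \<le> h n * (norm b + norm a)"
    "\<And>n. f (x + h n *\<^sub>R b + h n *\<^sub>R a) - f (x + h n *\<^sub>R b) - (f (x + h n *\<^sub>R a) - f x) =
      h n * h n * D b a (w n)" by metis
  have eq: "D a b (y n) = D b a (w n)" for n
  proof -
    have xba: "x + h n *\<^sub>R b + h n *\<^sub>R a = x + h n *\<^sub>R a + h n *\<^sub>R b" by simp
    have "h n * h n * D a b (y n) = h n * h n * D b a (w n)"
      using y(2)[of n] w(2)[of n] unfolding xba by linarith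
    then show ?thesis using h(1)[of n] by simp
  qed
  have lim: "(\<lambda>n. e / real (Suc n)) \<longlonglongrightarrow> 0"
    using LIMSEQ_Suc[OF lim_const_over_n[of e]] by simp
  have "u \<longlonglongrightarrow> x" if u: "\<And>n. dist x (u n) \<le> h n * (norm a + norm b)" for u
  proof -
    have "dist (u n) x \<le> e / real (Suc n)" for n
      using u[of n] h(3)[of n] by (simp add: dist_commute)
    then have "(\<lambda>n. dist (u n) x) \<longlonglongrightarrow> 0"
      by (intro tendsto_sandwich[OF _ _ tendsto_const lim] always_eventually) auto
    then show ?thesis by (simp add: tendsto_dist_iff[of u])
  qed
  then have "y \<longlonglongrightarrow> x" "w \<longlonglongrightarrow> x" using y(1) w(1) by (auto simp: add.commute)
  then have "(\<lambda>n. D a b (y n)) \<longlonglongrightarrow> D a b x" "(\<lambda>n. D b a (w n)) \<longlonglongrightarrow> D b a x"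
    using cont by (auto intro: isCont_tendsto_compose)
  then have "D a b x = D b a x" unfolding eq by (rule LIMSEQ_unique)
  then show ?thesis by (simp only: D_def)
qed

lemma frechet_derivative_bounded_linear:
  assumes "bounded_linear h" "smooth_on S f" "x \<in> S"
  shows "frechet_derivative (\<lambda>z. h (f z)) (at x) a = h (frechet_derivative f (at x) a)"
  using bounded_linear.has_derivative[OF assms(1) smooth_on_has_derivative[OF assms(2,3)]]
  by (metis frechet_derivative_at)

lemma frechet_derivative_cong_open:
  assumes "open S" "x \<in> S" "\<And>y. y \<in> S \<Longrightarrow> f y = g y"
  shows "frechet_derivative f (at x) = frechet_derivative g (at x)"
proof -
  have "(f has_derivative D) (at x) \<longleftrightarrow> (g has_derivative D) (at x)" for D
    using has_derivative_transform_within_open[OF _ assms(1,2)] assms(3) by metis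
  then show ?thesis by (simp add: frechet_derivative_def)
qed

lemma second_derivative_symmetric:
  fixes f :: "'a::euclidean_space \<Rightarrow> 'b::euclidean_space"
  assumes f: "smooth_on S f" and S: "open S" "x \<in> S"
  shows "frechet_derivative (\<lambda>z. frechet_derivative f (at z) a) (at x) b =
    frechet_derivative (\<lambda>z. frechet_derivative f (at z) b) (at x) a"
proof (rule euclidean_eqI)
  fix i :: 'b
  have "frechet_derivative (\<lambda>z. frechet_derivative f (at z) a) (at x) b \<bullet> i =
    frechet_derivative (\<lambda>z. frechet_derivative (\<lambda>z. f z \<bullet> i) (at z) a) (at x) b" for a b
  proof -
    have "frechet_derivative (\<lambda>z. frechet_derivative f (at z) a) (at x) b \<bullet> i =
      frechet_derivative (\<lambda>z. frechet_derivative f (at z) a \<bullet> i) (at x) b"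
      using frechet_derivative_bounded_linear[OF bounded_linear_inner_left
          smooth_on_frechet_derivative[OF f] S(2)] by simp
    also have "\<dots> = frechet_derivative (\<lambda>z. frechet_derivative (\<lambda>z. f z \<bullet> i) (at z) a) (at x) b"
      using frechet_derivative_cong_open[OF S,
        of "\<lambda>z. frechet_derivative f (at z) a \<bullet> i" "\<lambda>z. frechet_derivative (\<lambda>z. f z \<bullet> i) (at z) a"]
        frechet_derivative_bounded_linear[OF bounded_linear_inner_left f] by simp
    finally show ?thesis .
  qed
  then show "frechet_derivative (\<lambda>z. frechet_derivative f (at z) a) (at x) b \<bullet> i =
    frechet_derivative (\<lambda>z. frechet_derivative f (at z) b) (at x) a \<bullet> i"
    using second_derivative_symmetric_real[OF smooth_on_bounded_linear_compose[OF S(1)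
          bounded_linear_inner_left f] S] by simp
qed

text \<open>At the identity, a product in the Leibniz formula loses all its factors but one in the
  derivative, so that only the identity permutation contributes.\<close>

lemma has_derivative_det_at_identity:
  fixes M :: "'a::real_normed_vector \<Rightarrow> real ^ 'i::finite ^ 'i"
  assumes d: "\<And>i j. ((\<lambda>x. M x $ i $ j) has_derivative (\<lambda>v. M' v $ i $ j)) (at x)"
    and M: "M x = mat 1"
  shows "((\<lambda>x. det (M x)) has_derivative (\<lambda>v. trace (M' v))) (at x)"
proof -
  let ?P = "{p. p permutes (UNIV :: 'i set)}"
  have "((\<lambda>x. det (M x)) has_derivative (\<lambda>v. \<Sum>p\<in>?P. of_int (sign p) *
      (\<Sum>i\<in>UNIV. M' v $ i $ p i * (\<Prod>j\<in>UNIV - {i}. M x $ j $ p j)))) (at x)"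
    unfolding det_def
    by (intro has_derivative_sum has_derivative_mult_right has_derivative_prod d)
  moreover have "(\<Sum>p\<in>?P. of_int (sign p) *
      (\<Sum>i\<in>UNIV. M' v $ i $ p i * (\<Prod>j\<in>UNIV - {i}. M x $ j $ p j))) = trace (M' v)" for v
  proof -
    have "(\<Prod>j\<in>UNIV - {i}. M x $ j $ p j) = 0" if p: "p permutes UNIV" "p \<noteq> id" for p and i :: 'i
    proof -
      \<comment> \<open>A permutation other than the identity moves at least two points, j and p j,
        so one of them differs from i and leaves an off-diagonal zero in the remaining
        product.\<close>
      obtain j where j: "p j \<noteq> j" using p(2) by fastforce
      then obtain l where "l \<noteq> i" "l \<noteq> p l"
        using permutes_inj[OF p(1)] by (metis injD)
      then have "l \<in> UNIV - {i}" "M x $ l $ p l = 0" by (simp_all add: M mat_def)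
      then show ?thesis by (meson finite prod_zero)
    qed
    then have "(\<Sum>p\<in>?P. of_int (sign p) *
        (\<Sum>i\<in>UNIV. M' v $ i $ p i * (\<Prod>j\<in>UNIV - {i}. M x $ j $ p j))) =
      (\<Sum>p\<in>{id}. of_int (sign p) *
        (\<Sum>i\<in>UNIV. M' v $ i $ p i * (\<Prod>j\<in>UNIV - {i}. M x $ j $ p j)))"
      by (intro sum.mono_neutral_right ballI) (simp_all add: permutes_id del: prod_zero_iff)
    also have "\<dots> = trace (M' v)" by (simp add: M mat_def trace_def sign_id)
    finally show ?thesis .
  qed
  ultimately show ?thesis by simp
qed

text \<open>Jacobi's formula: multiplying by the constant inverse R of M x moves the base point to
  the identity, and multiplying by det (M x) undoes this.\<close>

lemma has_derivative_det:
  fixes M :: "'a::real_normed_vector \<Rightarrow> real ^ 'i::finite ^ 'i"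
  assumes d: "\<And>i j. ((\<lambda>x. M x $ i $ j) has_derivative (\<lambda>v. M' v $ i $ j)) (at x)"
    and R: "R ** M x = mat 1"
  shows "((\<lambda>x. det (M x)) has_derivative (\<lambda>v. det (M x) * trace (R ** M' v))) (at x)"
proof -
  have RM: "det R * det (M x) = 1" by (metis R det_I det_mul)
  have "((\<lambda>x. det (R ** M x)) has_derivative (\<lambda>v. trace (R ** M' v))) (at x)"
    using R by (intro has_derivative_det_at_identity)
      (auto simp: matrix_matrix_mult_def intro!: derivative_intros d)
  then have "((\<lambda>y. det (M x) * det (R ** M y)) has_derivative
      (\<lambda>v. det (M x) * trace (R ** M' v))) (at x)"
    by (rule has_derivative_mult_right)
  moreover have "det (M x) * det (R ** M y) = det (M y)" for y
    using RM by (simp add: det_mul) (metis mult.assoc mult.commute mult_1)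
  ultimately show ?thesis by (simp only:)
qed

lemma frechet_derivative_sum_Basis:
  fixes f :: "'a::euclidean_space \<Rightarrow> 'b::real_normed_vector"
  assumes "smooth_on S f" "x \<in> S"
  shows "frechet_derivative f (at x) v = (\<Sum>e\<in>Basis. (v \<bullet> e) *\<^sub>R frechet_derivative f (at x) e)"
  using has_derivative_linear[OF smooth_on_has_derivative[OF assms]]
  by (subst (1) euclidean_representation[symmetric]) (simp only: linear_sum linear_scale)

lemma linear_second_derivative:
  fixes f :: "'a::euclidean_space \<Rightarrow> 'b::real_normed_vector"
  assumes "smooth_on S f" "open S" "x \<in> S"
  shows "linear (\<lambda>v. frechet_derivative (\<lambda>z. frechet_derivative f (at z) v) (at x) w)"
proof
  fix u v r
  note lin = has_derivative_linear[OF smooth_on_has_derivative[OF assms(1)]]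
  note d = smooth_on_has_derivative[OF smooth_on_frechet_derivative[OF assms(1)] assms(3)]
  have "((\<lambda>z. frechet_derivative f (at z) (u + v)) has_derivative
      (\<lambda>w. frechet_derivative (\<lambda>z. frechet_derivative f (at z) u) (at x) w +
           frechet_derivative (\<lambda>z. frechet_derivative f (at z) v) (at x) w)) (at x)"
    by (rule has_derivative_transform_within_open[OF has_derivative_add[OF d d] assms(2,3)])
      (simp add: linear_add[OF lin])
  then show "frechet_derivative (\<lambda>z. frechet_derivative f (at z) (u + v)) (at x) w =
      frechet_derivative (\<lambda>z. frechet_derivative f (at z) u) (at x) w +
      frechet_derivative (\<lambda>z. frechet_derivative f (at z) v) (at x) w"
    by (simp only: has_derivative_eq_frechet)
  have "((\<lambda>z. frechet_derivative f (at z) (r *\<^sub>R v)) has_derivative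
      (\<lambda>w. r *\<^sub>R frechet_derivative (\<lambda>z. frechet_derivative f (at z) v) (at x) w)) (at x)"
    by (rule has_derivative_transform_within_open[OF has_derivative_scaleR_right[OF d] assms(2,3)])
      (simp add: linear_scale[OF lin])
  then show "frechet_derivative (\<lambda>z. frechet_derivative f (at z) (r *\<^sub>R v)) (at x) w =
      r *\<^sub>R frechet_derivative (\<lambda>z. frechet_derivative f (at z) v) (at x) w"
    by (simp only: has_derivative_eq_frechet)
qed

text \<open>Relates the second derivatives of \<open>s\<close> composed with a coordinate map to
  those of \<open>s\<close> and of the map. The product rule is applied to the basis expansion of
  the inner derivative; in the sum where its coefficients are frozen at x, linearity in the
  direction recombines the basis.\<close>

lemma second_derivative_compose:
  fixes f :: "'a::euclidean_space \<Rightarrow> 'b::euclidean_space" and g :: "'b \<Rightarrow> 'c::real_normed_vector"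
  assumes "open S" "open T" "f ` S \<subseteq> T" "smooth_on S f" "smooth_on T g" "x \<in> S"
  shows "frechet_derivative (\<lambda>y. frechet_derivative (\<lambda>z. g (f z)) (at y) b) (at x) a =
    frechet_derivative (\<lambda>u. frechet_derivative g (at u) (frechet_derivative f (at x) b)) (at (f x))
      (frechet_derivative f (at x) a) +
    frechet_derivative g (at (f x)) (frechet_derivative (\<lambda>y. frechet_derivative f (at y) b) (at x) a)"
proof -
  note fd = smooth_on_has_derivative[OF assms(4)] and gd = smooth_on_has_derivative[OF assms(5)]
  have fT: "f y \<in> T" if "y \<in> S" for y using assms(3) that by auto
  define g1 where "g1 e u = frechet_derivative g (at u) e" for e u
  define f1 where "f1 y = frechet_derivative f (at y) b" for y
  have g1: "(g1 e has_derivative frechet_derivative (g1 e) (at (f x))) (at (f x))" for e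
    using smooth_on_has_derivative[OF smooth_on_frechet_derivative[OF assms(5)] fT[OF assms(6)]]
    unfolding g1_def .
  have f1: "(f1 has_derivative frechet_derivative f1 (at x)) (at x)"
    using smooth_on_has_derivative[OF smooth_on_frechet_derivative[OF assms(4)] assms(6)]
    unfolding f1_def .
  have "((\<lambda>y. \<Sum>e\<in>Basis. (f1 y \<bullet> e) *\<^sub>R g1 e (f y)) has_derivative
      (\<lambda>a. \<Sum>e\<in>Basis. (f1 x \<bullet> e) *\<^sub>R frechet_derivative (g1 e) (at (f x)) (frechet_derivative f (at x) a) +
        (frechet_derivative f1 (at x) a \<bullet> e) *\<^sub>R g1 e (f x))) (at x)"
    by (intro has_derivative_sum has_derivative_scaleR has_derivative_inner_left f1
        has_derivative_compose[OF fd[OF assms(6)] g1])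
  then have "((\<lambda>y. frechet_derivative (\<lambda>z. g (f z)) (at y) b) has_derivative
      (\<lambda>a. \<Sum>e\<in>Basis. (f1 x \<bullet> e) *\<^sub>R frechet_derivative (g1 e) (at (f x)) (frechet_derivative f (at x) a) +
        (frechet_derivative f1 (at x) a \<bullet> e) *\<^sub>R g1 e (f x))) (at x)"
  proof (rule has_derivative_transform_within_open[OF _ assms(1,6)])
    fix y assume y: "y \<in> S"
    have "frechet_derivative (\<lambda>z. g (f z)) (at y) b = frechet_derivative g (at (f y)) (f1 y)"
      unfolding f1_def has_derivative_eq_frechet[OF has_derivative_compose[OF fd gd, OF y fT, OF y]] ..
    then show "(\<Sum>e\<in>Basis. (f1 y \<bullet> e) *\<^sub>R g1 e (f y)) = frechet_derivative (\<lambda>z. g (f z)) (at y) b"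
      unfolding g1_def by (simp only: frechet_derivative_sum_Basis[OF assms(5) fT[OF y], of "f1 y"])
  qed
  then have "frechet_derivative (\<lambda>y. frechet_derivative (\<lambda>z. g (f z)) (at y) b) (at x) a =
      (\<Sum>e\<in>Basis. (f1 x \<bullet> e) *\<^sub>R frechet_derivative (g1 e) (at (f x)) (frechet_derivative f (at x) a)) +
      (\<Sum>e\<in>Basis. (frechet_derivative f1 (at x) a \<bullet> e) *\<^sub>R g1 e (f x))"
    by (simp only: has_derivative_eq_frechet sum.distrib)
  also have "(\<Sum>e\<in>Basis. (frechet_derivative f1 (at x) a \<bullet> e) *\<^sub>R g1 e (f x)) =
      frechet_derivative g (at (f x)) (frechet_derivative f1 (at x) a)"
    unfolding g1_def by (rule frechet_derivative_sum_Basis[OF assms(5) fT[OF assms(6)], symmetric])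
  also have "(\<Sum>e\<in>Basis. (f1 x \<bullet> e) *\<^sub>R frechet_derivative (g1 e) (at (f x)) (frechet_derivative f (at x) a)) =
      frechet_derivative (g1 (\<Sum>e\<in>Basis. (f1 x \<bullet> e) *\<^sub>R e)) (at (f x)) (frechet_derivative f (at x) a)"
    unfolding g1_def
      linear_sum[OF linear_second_derivative[OF assms(5,2) fT[OF assms(6)]]]
      linear_scale[OF linear_second_derivative[OF assms(5,2) fT[OF assms(6)]]] ..
  finally show ?thesis unfolding euclidean_representation f1_def g1_def .
qed

abbreviation deriv_at :: "('a::real_normed_vector \<Rightarrow> 'b::real_normed_vector) \<Rightarrow> 'a \<Rightarrow> 'a \<Rightarrow> 'b" ("\<partial>")
  where "\<partial> f x \<equiv> frechet_derivative f (at x)"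

section \<open>The Minkowski product and the geodesic flow\<close>

lemma mink_zero [simp]: "mink 0 x = 0" "mink x 0 = 0"
  by (simp_all add: mink_def)

lemma mink_minus [simp]: "mink (- x) y = - mink x y" "mink x (- y) = - mink x y"
  using mink_simps(5)[of "-1" x y] mink_simps(6)[of x "-1" y] by simp_all

lemma bounded_bilinear_mink: "bounded_bilinear (mink :: 'n::finite minkowski \<Rightarrow> _)"
proof -
  have "bilinear (mink :: 'n minkowski \<Rightarrow> _)"
    unfolding bilinear_def by (auto intro!: linearI simp: mink_simps)
  then show ?thesis by (simp add: bilinear_conv_bounded_bilinear)
qed

lemma mink_nondegenerate:
  assumes "\<And>w. mink x w = 0"
  shows "x = 0"
proof -
  have "x $ Some i = 0" for i
  proof -
    have "mink x (axis (Some i) 1) = x $ Some i"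
      by (simp add: mink_def axis_def if_distrib[where f = "\<lambda>t. _ * t"] cong: if_cong)
    then show ?thesis using assms by simp
  qed
  moreover have "mink x (axis None 1) = - x $ None" by (simp add: mink_def axis_def)
  then have "x $ None = 0" using assms by simp
  ultimately show ?thesis by (metis (no_types) vec_eq_iff not_Some_eq zero_index)
qed

lemma unit_tangentD:
  assumes "z \<in> unit_tangent"
  shows "mink (fst z) (fst z) = -1" "mink (fst z) (snd z) = 0" "mink (snd z) (fst z) = 0"
    "mink (snd z) (snd z) = 1" "fst z $ None > 0"
  using assms by (auto simp: unit_tangent_def hyp_space_def mink_sym)

lemma unit_tangent_iff: "z \<in> unit_tangent \<longleftrightarrow> mink (fst z) (fst z) = -1 \<and>
    mink (fst z) (snd z) = 0 \<and> mink (snd z) (snd z) = 1 \<and> fst z $ None > 0"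
  by (auto simp: unit_tangent_def hyp_space_def)

text \<open>On the orthogonal complement of \<open>chi\<close>, \<open>pmink\<close> is the para-Sasaki metric, although
  \<open>chi\<close> itself has square length 2 for it.\<close>

definition pmink :: "'n::finite minkowski \<times> 'n minkowski \<Rightarrow> 'n minkowski \<times> 'n minkowski \<Rightarrow> real" where
  "pmink u w = mink (fst u) (fst w) - mink (snd u) (snd w)"

text \<open>The orthogonal complement of \<open>chi\<close> in the tangent space, that is, the
  contact distribution of the unit tangent bundle: two copies of the complement of x and v in the
  ambient space.\<close>

definition contact :: "'n::finite minkowski \<times> 'n minkowski \<Rightarrow> ('n minkowski \<times> 'n minkowski) set" where
  "contact z = {u. mink (fst z) (fst u) = 0 \<and> mink (snd z) (fst u) = 0 \<and>
     mink (fst z) (snd u) = 0 \<and> mink (snd z) (snd u) = 0}"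

text \<open>Unlike \<open>chi_perp\<close>, this projects the whole ambient space, which is needed
  for second derivatives, as these are not tangent to the unit tangent bundle. The opposite signs
  reflect that x is timelike and v spacelike.\<close>

definition contact_proj ::
  "'n::finite minkowski \<times> 'n minkowski \<Rightarrow> 'n minkowski \<times> 'n minkowski \<Rightarrow> 'n minkowski \<times> 'n minkowski" where
  "contact_proj z u =
     (fst u + mink (fst u) (fst z) *\<^sub>R fst z - mink (fst u) (snd z) *\<^sub>R snd z,
      snd u + mink (snd u) (fst z) *\<^sub>R fst z - mink (snd u) (snd z) *\<^sub>R snd z)"

lemma pmink_simps:
  "pmink (x + y) z = pmink x z + pmink y z" "pmink z (x + y) = pmink z x + pmink z y"
  "pmink (x - y) z = pmink x z - pmink y z" "pmink z (x - y) = pmink z x - pmink z y"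
  "pmink (r *\<^sub>R x) z = r * pmink x z" "pmink z (r *\<^sub>R x) = r * pmink z x"
  by (simp_all add: pmink_def mink_simps algebra_simps)

lemma pmink_sym: "pmink x y = pmink y x"
  by (simp add: pmink_def mink_sym)

lemma bilinear_pmink: "bilinear (pmink :: 'n::finite minkowski \<times> 'n minkowski \<Rightarrow> _)"
  unfolding bilinear_def by (intro conjI allI linearI) (simp_all add: pmink_simps)

lemma pmink_para_J: "pmink (para_J u) (para_J w) = - pmink u w"
  "pmink (para_J u) w = - pmink u (para_J w)"
  by (simp_all add: pmink_def para_J_def)

lemma para_J_para_J [simp]: "para_J (para_J u) = u"
  by (simp add: para_J_def)

lemma linear_para_J: "linear para_J"
  by (rule linearI) (simp_all add: para_J_def)

lemma linear_contact_proj: "linear (contact_proj z)"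
  by (rule linearI) (simp_all add: contact_proj_def mink_simps algebra_simps)

lemma linear_geod_flow: "linear (geod_flow t)"
  by (rule linearI) (simp_all add: geod_flow_def algebra_simps)

lemma linear_chi_part: "linear (chi_part z)"
  by (rule linearI) (simp_all add: chi_part_def mink_simps)

lemma linear_chi_perp: "linear (chi_perp z)"
  by (rule linearI) (simp_all add: chi_perp_def para_sasaki_def chi_part_def hor_part_def
      ver_part_def mink_simps algebra_simps)

lemma geod_flow_0 [simp]: "geod_flow 0 z = z"
  by (simp add: geod_flow_def)

lemma geod_flow_minus [simp]: "geod_flow (- t) (geod_flow t z) = z" "geod_flow t (geod_flow (- t) z) = z"
  by (simp_all add: geod_flow_add)

lemma pmink_geod_flow: "pmink (geod_flow t u) (geod_flow t w) = pmink u w"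
proof -
  have "pmink (geod_flow t u) (geod_flow t w) = ((cosh t)\<^sup>2 - (sinh t)\<^sup>2) * pmink u w"
    by (simp add: pmink_def geod_flow_def mink_simps power2_eq_square algebra_simps)
  then show ?thesis by (simp add: cosh_square_eq)
qed

text \<open>Only the sign of the timelike coordinate is not algebra: if it failed to stay positive,
  it would vanish at some time by continuity, where the vector would have nonnegative square instead
  of -1.\<close>

lemma geod_flow_unit_tangent:
  assumes z: "z \<in> unit_tangent"
  shows "geod_flow t z \<in> unit_tangent"
proof -
  define w where "w r = fst (geod_flow r z)" for r
  note z' = unit_tangentD[OF z]
  have ch: "(cosh r)\<^sup>2 - (sinh r)\<^sup>2 = 1" for r :: real by (simp add: cosh_square_eq)
  have w: "mink (w r) (w r) = -1" for r
    using ch[of r] by (simp add: w_def geod_flow_def mink_simps z' power2_eq_square)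
  have pos: "w t $ None > 0"
  proof (rule ccontr)
    assume neg: "\<not> w t $ None > 0"
    have w0: "w 0 $ None > 0" by (simp add: w_def z')
    have "continuous_on UNIV (\<lambda>r. w r $ None)"
      by (auto simp: w_def geod_flow_def intro!: continuous_intros)
    then have "connected (range (\<lambda>r. w r $ None))" by (rule connected_continuous_image) simp
    then have "0 \<in> range (\<lambda>r. w r $ None)"
      by (rule connectedD_interval[OF _ rangeI[of _ t] rangeI[of _ 0]]) (use neg w0 in auto)
    then obtain r where r: "w r $ None = 0" by auto
    have "mink (w r) (w r) \<ge> 0" by (simp add: mink_def r sum_nonneg)
    then show False using w[of r] by simp
  qed
  show ?thesis
    using ch[of t] w[of t] pos
    by (simp add: unit_tangent_iff w_def geod_flow_def mink_simps z' power2_eq_square mult.commute)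
qed

lemma geod_geod_flow: "geod (geod_flow t z) = geod z"
proof
  show "geod (geod_flow t z) \<subseteq> geod z" by (auto simp: geod_def geod_flow_add)
  have "geod_flow r z = geod_flow (r - t) (geod_flow t z)" for r by (simp add: geod_flow_add)
  then show "geod z \<subseteq> geod (geod_flow t z)" unfolding geod_def by blast
qed

lemma mem_geod: "z \<in> geod z"
  unfolding geod_def by (rule image_eqI[of _ _ 0]) auto

lemma contact_subset_tangent: "z \<in> unit_tangent \<Longrightarrow> contact z \<subseteq> tangent_T1 z"
  by (auto simp: contact_def tangent_T1_def mink_sym)

lemma para_J_contact: "u \<in> contact z \<Longrightarrow> para_J u \<in> contact z"
  by (simp add: contact_def para_J_def)

lemma contact_proj_in_contact: "z \<in> unit_tangent \<Longrightarrow> contact_proj z u \<in> contact z"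
  by (simp add: contact_def contact_proj_def mink_simps unit_tangentD mink_sym)

lemma contact_proj_contact: "u \<in> contact z \<Longrightarrow> contact_proj z u = u"
  by (simp add: contact_def contact_proj_def mink_sym)

lemma contact_proj_para_J: "contact_proj z (para_J u) = para_J (contact_proj z u)"
  by (simp add: contact_proj_def para_J_def)

lemma contact_proj_base:
  "z \<in> unit_tangent \<Longrightarrow> contact_proj z z = 0" "z \<in> unit_tangent \<Longrightarrow> contact_proj z (para_J z) = 0"
  by (simp_all add: contact_proj_def para_J_def unit_tangentD prod_eq_iff)

lemma pmink_contact_proj: "w \<in> contact z \<Longrightarrow> pmink (contact_proj z u) w = pmink u w"
  by (simp add: contact_def contact_proj_def pmink_def mink_simps)

lemma chi_perp_eq:
  assumes "z \<in> unit_tangent"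
  shows "chi_perp z u = u - chi_part z u *\<^sub>R para_J z"
  using assms by (simp add: chi_perp_def para_sasaki_def chi_part_def hor_part_def ver_part_def
      chi_def para_J_def unit_tangentD)

text \<open>The linearised constraints leave a single coefficient: the product of the first entry
  with v is minus that of the second entry with x, and the other two products vanish.\<close>

lemma chi_perp_eq_contact_proj:
  assumes z: "z \<in> unit_tangent" and u: "u \<in> tangent_T1 z"
  shows "chi_perp z u = contact_proj z u"
  using u by (auto simp: chi_perp_eq[OF z] contact_proj_def tangent_T1_def chi_part_def para_J_def
      mink_sym prod_eq_iff eq_neg_iff_add_eq_0[symmetric])

lemma para_sasaki_contact:
  assumes "z \<in> unit_tangent" "u \<in> contact z" "w \<in> contact z"
  shows "para_sasaki z u w = pmink u w"
  using assms by (auto simp: para_sasaki_def chi_part_def hor_part_def ver_part_def pmink_def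
      contact_def mink_sym)

lemma chi_perp_contact:
  assumes "z \<in> unit_tangent" "u \<in> tangent_T1 z"
  shows "chi_perp z u \<in> contact z"
  using chi_perp_eq_contact_proj[OF assms] contact_proj_in_contact[OF assms(1)] by simp

lemma contact_geod_flow:
  assumes "u \<in> contact z"
  shows "geod_flow t u \<in> contact (geod_flow t z)" "u \<in> contact (geod_flow t z)"
  using assms by (auto simp: contact_def geod_flow_def mink_simps)

text \<open>The flow is a Lorentz boost of the plane spanned by x and v, so this plane and its
  complement are the same at both points; on u it mixes the two entries with scalar coefficients,
  which commutes with an entrywise projection.\<close>

lemma contact_proj_geod_flow:
  assumes "z \<in> unit_tangent"
  shows "contact_proj (geod_flow t z) (geod_flow t u) = geod_flow t (contact_proj z u)"
proof -
  have c: "cosh t * cosh t = 1 + sinh t * sinh t"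
    using cosh_square_eq[of t] by (simp add: power2_eq_square)
  have p: "w + mink w (fst (geod_flow t z)) *\<^sub>R fst (geod_flow t z)
      - mink w (snd (geod_flow t z)) *\<^sub>R snd (geod_flow t z) =
    w + (cosh t * cosh t - sinh t * sinh t) *\<^sub>R (mink w (fst z) *\<^sub>R fst z - mink w (snd z) *\<^sub>R snd z)" for w
    by (simp add: geod_flow_def mink_simps algebra_simps)
  have "contact_proj (geod_flow t z) v = contact_proj z v" for v
    unfolding contact_proj_def p using c by (simp add: algebra_simps)
  moreover have "contact_proj z (geod_flow t u) = geod_flow t (contact_proj z u)"
    by (simp add: contact_proj_def geod_flow_def mink_simps algebra_simps)
  ultimately show ?thesis by simp
qed

lemma tangent_T1_geod_flow:
  assumes z: "z \<in> unit_tangent" and u: "u \<in> tangent_T1 z"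
  shows "geod_flow t u \<in> tangent_T1 (geod_flow t z)"
proof -
  have h: "mink (fst z) (fst u) = 0" "mink (snd z) (snd u) = 0" "mink (fst z) (snd u) = - mink (snd z) (fst u)"
    using u by (auto simp: tangent_T1_def mink_sym)
  show ?thesis
    using h by (simp add: tangent_T1_def geod_flow_def mink_simps mink_sym algebra_simps)
qed

lemma chi_perp_geod_flow:
  assumes z: "z \<in> unit_tangent" and u: "u \<in> tangent_T1 z"
  shows "chi_perp (geod_flow t z) (geod_flow t u) = geod_flow t (chi_perp z u)"
  using chi_perp_eq_contact_proj[OF z u] contact_proj_geod_flow[OF z]
    chi_perp_eq_contact_proj[OF geod_flow_unit_tangent[OF z] tangent_T1_geod_flow[OF z u]] by simp

lemma geod_dp_geod_flow:
  assumes "z \<in> unit_tangent"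
  shows "geod_dp z u (geod_flow t z) = geod_flow t (chi_perp z u)"
proof -
  have "(THE r. geod_flow r z = geod_flow t z) = t"
    using geod_flow_inj[OF assms] by blast
  then show ?thesis by (auto simp: geod_dp_def geod_def)
qed

text \<open>The metric is evaluated at an arbitrarily chosen point of the orbit; flow invariance
  moves it back to z.\<close>

lemma geod_metric_geod_dp:
  assumes z: "z \<in> unit_tangent" and u: "u \<in> tangent_T1 z" "w \<in> tangent_T1 z"
  shows "geod_metric (geod z) (geod_dp z u) (geod_dp z w) = pmink (chi_perp z u) (chi_perp z w)"
proof -
  have "(SOME z'. z' \<in> geod z) \<in> geod z" using mem_geod by (rule someI)
  then obtain t where t: "(SOME z'. z' \<in> geod z) = geod_flow t z" by (auto simp: geod_def)
  note c = chi_perp_contact[OF z u(1)] chi_perp_contact[OF z u(2)]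
  show ?thesis
    unfolding geod_metric_def t Let_def geod_dp_geod_flow[OF z]
    using para_sasaki_geod_flow[OF z, of "chi_perp z u" "chi_perp z w" t] c
      contact_subset_tangent[OF z] para_sasaki_contact[OF z c] by auto
qed

lemma geod_dp_add: "geod_dp z (u + w) z' = geod_dp z u z' + geod_dp z w z'"
  by (simp add: geod_dp_def linear_add[OF linear_chi_perp] linear_add[OF linear_geod_flow])

lemma geod_J_geod_dp:
  assumes "chi_perp z w = para_J (chi_perp z u)"
  shows "geod_J (geod_dp z u) = geod_dp z w"
  using assms by (auto simp: geod_J_def geod_dp_def fun_eq_iff para_J_geod_flow)
    (simp add: para_J_def zero_prod_def)

lemma sum_UNIV_option: "(\<Sum>i\<in>UNIV. f i) = f None + (\<Sum>j\<in>UNIV. f (Some j))"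
  for f :: "'a::finite option \<Rightarrow> 'b::comm_monoid_add"
  by (subst (1) UNIV_option_conv) (simp add: sum.reindex)

text \<open>Together with the injectivity of \<open>hor_lift\<close>, this bound forces the
  horizontal lifts to fill the contact space.\<close>

lemma dim_contact_le:
  fixes z :: "'n::finite minkowski \<times> 'n minkowski"
  assumes z: "z \<in> unit_tangent"
  shows "dim (contact z) \<le> 2 * CARD('n)"
proof -
  \<comment> \<open>Changing the sign of the timelike coordinate turns \<open>mink\<close> into the
    inner product, for which the dimension formula for orthogonal complements is available.\<close>
  define R :: "'n minkowski \<Rightarrow> 'n minkowski" where "R x = (\<chi> i. case i of None \<Rightarrow> - x $ None | Some j \<Rightarrow> x $ Some j)" for x
  have R: "mink x y = R x \<bullet> y" for x y
    by (simp add: R_def inner_vec_def mink_def sum_UNIV_option[of "\<lambda>i. _ i * _ i"])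
  define P where "P = {w. mink (fst z) w = 0 \<and> mink (snd z) w = 0}"
  have P: "subspace P" by (auto simp: P_def subspace_def mink_simps)
  have "contact z = P \<times> P" by (auto simp: contact_def P_def)
  then have "dim (contact z) = dim P + dim P" using P dim_Times by metis
  moreover have "dim P + 2 \<le> DIM('n minkowski)"
  proof -
    have "independent {R (fst z), R (snd z)}"
    proof -
      have "R (fst z) \<noteq> a *\<^sub>R R (snd z)" for a
      proof
        assume "R (fst z) = a *\<^sub>R R (snd z)"
        then have "mink (fst z) (fst z) = a * mink (snd z) (fst z)" by (simp add: R)
        then show False using unit_tangentD[OF z] by simp
      qed
      moreover have "R (snd z) \<noteq> 0"
      proof
        assume "R (snd z) = 0"
        then have "mink (snd z) (snd z) = 0" by (simp add: R)
        then show False using unit_tangentD[OF z] by simp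
      qed
      ultimately show ?thesis by (simp add: independent_insert span_singleton) auto
    qed
    moreover have "R (fst z) \<noteq> R (snd z)"
      using unit_tangentD[OF z] R by (metis zero_neq_one)
    ultimately have "dim (span {R (fst z), R (snd z)}) = 2"
      by (simp add: dim_span dim_eq_card_independent)
    moreover have "{y \<in> UNIV. \<forall>x\<in>span {R (fst z), R (snd z)}. orthogonal x y} = P"
      (is "?O = P")
    proof (intro equalityI subsetI)
      fix y assume "y \<in> ?O"
      then have "orthogonal (R (fst z)) y" "orthogonal (R (snd z)) y" by (auto intro: span_base)
      then show "y \<in> P" by (simp add: P_def R orthogonal_def)
    next
      fix y assume "y \<in> P"
      then have "orthogonal y x" if "x \<in> {R (fst z), R (snd z)}" for x
        using that by (auto simp: P_def R orthogonal_def inner_commute)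
      then show "y \<in> ?O" using orthogonal_to_span orthogonal_commute by blast
    qed
    ultimately show ?thesis
      using dim_subspace_orthogonal_to_vectors[OF subspace_span subspace_UNIV subset_UNIV, of "{R (fst z), R (snd z)}"]
      by simp
  qed
  moreover have "DIM('n minkowski) = CARD('n) + 2" by simp
  ultimately show ?thesis by linarith
qed

text \<open>Differentiates the three equations defining unit tangent vectors. The domain is general,
  to cover both patches of the hypersurface and curves in time.\<close>

lemma tangent_T1_derivative:
  assumes V: "open V" "x \<in> V" "\<gamma> ` V \<subseteq> unit_tangent" and d: "(\<gamma> has_derivative \<gamma>') (at x)"
  shows "\<gamma>' a \<in> tangent_T1 (\<gamma> x)"
proof -
  note d1 = has_derivative_fst[OF d] and d2 = has_derivative_snd[OF d]
  have const: "(\<lambda>a. mink (g x) (h' a) + mink (g' a) (h x)) = (\<lambda>a. 0)"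
    if "(g has_derivative g') (at x)" "(h has_derivative h') (at x)" "\<And>y. y \<in> V \<Longrightarrow> mink (g y) (h y) = c"
    for g h g' h' c
  proof -
    have "((\<lambda>y. c) has_derivative (\<lambda>a. mink (g x) (h' a) + mink (g' a) (h x))) (at x)"
      by (rule has_derivative_transform_within_open[OF
            bounded_bilinear.FDERIV[OF bounded_bilinear_mink that(1,2)] V(1,2)]) (simp add: that(3))
    then show ?thesis by (rule has_derivative_unique[OF _ has_derivative_const])
  qed
  have ut: "\<gamma> y \<in> unit_tangent" if "y \<in> V" for y using V(3) that by auto
  have "mink (fst (\<gamma> x)) (fst (\<gamma>' a)) + mink (fst (\<gamma>' a)) (fst (\<gamma> x)) = 0"
    using const[OF d1 d1] unit_tangentD[OF ut] by (auto dest: fun_cong)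
  moreover have "mink (snd (\<gamma> x)) (snd (\<gamma>' a)) + mink (snd (\<gamma>' a)) (snd (\<gamma> x)) = 0"
    using const[OF d2 d2] unit_tangentD[OF ut] by (auto dest: fun_cong)
  moreover have "mink (fst (\<gamma> x)) (snd (\<gamma>' a)) + mink (fst (\<gamma>' a)) (snd (\<gamma> x)) = 0"
    using const[OF d1 d2] unit_tangentD[OF ut] by (auto dest: fun_cong)
  ultimately show ?thesis by (simp add: tangent_T1_def mink_sym case_prod_beta)
qed

lemma contact_nondegenerate:
  assumes z: "z \<in> unit_tangent" and u: "u \<in> contact z" and 0: "\<And>w. w \<in> contact z \<Longrightarrow> pmink u w = 0"
  shows "u = 0"
proof -
  have *: "pmink u w = 0" for w
    using 0[OF contact_proj_in_contact[OF z]] pmink_contact_proj[OF u] pmink_sym by metis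
  have "mink (fst u) w = 0" "mink (snd u) w = 0" for w
    using *[of "(w, 0)"] *[of "(0, w)"] by (simp_all add: pmink_def)
  then show ?thesis using mink_nondegenerate by (metis prod.collapse zero_prod_def)
qed

section \<open>The Levi-Civita connection of the space of geodesics\<close>

text \<open>Since \<open>levi_civita\<close> is a definite description, uniqueness must accompany
  any candidate. The difference of two candidates, lowered to a trilinear form, is symmetric in its
  first two slots by freeness of torsion and antisymmetric in its last two by compatibility.\<close>

lemma levi_civita_eqI:
  fixes g :: "'e::euclidean_space \<Rightarrow> 'e \<Rightarrow> 'e \<Rightarrow> real"
  assumes lin: "\<And>a. linear (g u a)" and sym: "\<And>a b. g u a b = g u b a"
    and nondeg: "\<And>a. (\<And>b. g u a b = 0) \<Longrightarrow> a = 0"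
    and G: "bilinear G" "\<And>a b. G a b = G b a"
      "\<And>a b c. frechet_derivative (\<lambda>w. g w b c) (at u) a = g u (G a b) c + g u b (G a c)"
  shows "levi_civita g u = G"
  unfolding levi_civita_def
proof (rule the_equality)
  fix K assume K: "bilinear K \<and> (\<forall>a b. K a b = K b a) \<and> (\<forall>a b c.
    frechet_derivative (\<lambda>w. g w b c) (at u) a = g u (K a b) c + g u b (K a c))"
  have diff: "g u (a - b) c = g u a c - g u b c" for a b c
    using linear_diff[OF lin] sym by metis
  define T where "T a b c = g u (K a b - G a b) c" for a b c
  have anti: "T a b c = - T a c b" for a b c
    using K G(3)[of b c a] sym[of b] unfolding T_def diff by force
  have symT: "T a b c = T b a c" for a b c using K G(2)[of a b] by (simp add: T_def)
  \<comment> \<open>Alternating the two symmetries six times returns to the same arguments with the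
    opposite sign.\<close>
  have "T a b c = 0" for a b c
    using anti[of a b c] symT[of a c b] anti[of c a b] symT[of c b a] anti[of b c a] symT[of b a c]
    by linarith
  then have "K a b - G a b = 0" for a b unfolding T_def by (intro nondeg)
  then show "K = G" by (simp add: fun_eq_iff)
qed (use G in auto)

text \<open>The extra term arises because the time derivative of the linear flow is
  \<open>para_J\<close> applied to it.\<close>

lemma has_derivative_geod_flow:
  assumes \<tau>: "(\<tau> has_derivative \<tau>') (at x)" and \<gamma>: "(\<gamma> has_derivative \<gamma>') (at x)"
  shows "((\<lambda>y. geod_flow (\<tau> y) (\<gamma> y)) has_derivative
    (\<lambda>a. geod_flow (\<tau> x) (\<gamma>' a) + \<tau>' a *\<^sub>R para_J (geod_flow (\<tau> x) (\<gamma> x)))) (at x)"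
proof -
  note d = has_derivative_fst[OF \<gamma>] has_derivative_snd[OF \<gamma>]
    DERIV_compose_FDERIV[OF has_field_derivative_cosh[OF DERIV_ident] \<tau>]
    DERIV_compose_FDERIV[OF has_field_derivative_sinh[OF DERIV_ident] \<tau>]
  show ?thesis
    unfolding geod_flow_def
    by (rule has_derivative_eq_rhs, (rule has_derivative_Pair has_derivative_add
          has_derivative_scaleR d)+) (simp add: para_J_def fun_eq_iff algebra_simps)
qed

text \<open>Coordinate components a become the representative, at the point s u of the orbit, of the
  tangent vector of the space of geodesics. All computations in a chart are carried out on these
  representatives.\<close>

definition hor_lift ::
  "('n geod_coords \<Rightarrow> 'n::finite minkowski \<times> 'n minkowski) \<Rightarrow>
   'n geod_coords \<Rightarrow> 'n geod_coords \<Rightarrow> 'n minkowski \<times> 'n minkowski" where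
  "hor_lift s u a = chi_perp (s u) (\<partial> s u a)"

locale geod_param =
  fixes Om :: "'n::finite geod_coords set" and s :: "'n geod_coords \<Rightarrow> 'n minkowski \<times> 'n minkowski"
  assumes chart: "geod_chart Om s"
begin

lemma open_Om: "open Om" and smooth_s: "smooth_on Om s"
  and inj_Om: "inj_on (\<lambda>u. geod (s u)) Om" and s_unit: "u \<in> Om \<Longrightarrow> s u \<in> unit_tangent"
  using chart by (auto simp: geod_chart_def)

abbreviation "covered \<equiv> (\<lambda>u. geod (s u)) ` Om"
abbreviation "coord \<equiv> geod_coord Om s"

lemma coord_geod: "u \<in> Om \<Longrightarrow> coord (geod (s u)) = u"
  unfolding geod_coord_def by (rule the_inv_into_f_f[OF inj_Om])

lemma coord_in: "l \<in> covered \<Longrightarrow> coord l \<in> Om"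
  unfolding geod_coord_def by (rule the_inv_into_into[OF inj_Om]) auto

lemma geod_coord_covered: "l \<in> covered \<Longrightarrow> geod (s (coord l)) = l"
  unfolding geod_coord_def by (rule f_the_inv_into_f[OF inj_Om])

text \<open>Replaces the coordinates, defined only on orbits of unit tangent vectors, by a smooth
  map on an open set of the ambient space, where Frechet derivatives and the chain rule
  apply.\<close>

lemma local_coord:
  assumes "z \<in> unit_tangent" "geod z \<in> covered"
  obtains T h where "open T" "z \<in> T" "smooth_on T h"
    "\<And>w. w \<in> T \<Longrightarrow> w \<in> unit_tangent \<Longrightarrow> geod w \<in> covered \<and> h w = coord (geod w)"
proof -
  let ?W = "{z \<in> unit_tangent. geod z \<in> covered}"
  have W: "openin (top_of_set unit_tangent) ?W" "smooth_map_on ?W (\<lambda>z. coord (geod z))"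
    using chart by (simp_all add: geod_chart_def Let_def)
  obtain T1 where T1: "open T1" "?W = unit_tangent \<inter> T1" using W(1) by (auto simp: openin_open)
  obtain T2 h where T2: "open T2" "z \<in> T2" "smooth_on T2 h" "\<forall>y\<in>T2 \<inter> ?W. h y = coord (geod y)"
    using W(2) assms unfolding smooth_map_on_def by blast
  show ?thesis
  proof (rule that[of "T1 \<inter> T2" h])
    show "z \<in> T1 \<inter> T2" using T1 T2 assms by auto
    show "smooth_on (T1 \<inter> T2) h" using T2(3) by (rule smooth_on_subset) auto
    fix w assume "w \<in> T1 \<inter> T2" "w \<in> unit_tangent"
    then have "w \<in> T2 \<inter> ?W" using T1(2) by blast
    then show "geod w \<in> covered \<and> h w = coord (geod w)" using T2(4) by blast
  qed (use T1 T2 in auto)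
qed

lemma s_deriv: "u \<in> Om \<Longrightarrow> (s has_derivative \<partial> s u) (at u)"
  by (rule smooth_on_has_derivative[OF smooth_s])

lemma s_tangent: "u \<in> Om \<Longrightarrow> \<partial> s u a \<in> tangent_T1 (s u)"
  using s_unit by (intro tangent_T1_derivative[OF open_Om _ _ s_deriv]) auto

lemma linear_hor_lift: "u \<in> Om \<Longrightarrow> linear (hor_lift s u)"
  using linear_compose[OF has_derivative_linear[OF s_deriv] linear_chi_perp]
  by (simp add: hor_lift_def[abs_def] o_def)

lemma hor_lift_contact: "u \<in> Om \<Longrightarrow> hor_lift s u a \<in> contact (s u)"
  unfolding hor_lift_def by (intro chi_perp_contact s_unit s_tangent)

lemma hor_lift_eq: "u \<in> Om \<Longrightarrow> hor_lift s u a = \<partial> s u a - chi_part (s u) (\<partial> s u a) *\<^sub>R para_J (s u)"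
  unfolding hor_lift_def by (intro chi_perp_eq s_unit)

text \<open>The coordinates are constant along the flow, so their differential vanishes on \<open>chi\<close>.\<close>

lemma inj_hor_lift:
  assumes u: "u \<in> Om"
  shows "inj (hor_lift s u)"
proof -
  have "geod (s u) \<in> covered" using u by blast
  then obtain T h where T: "open T" "s u \<in> T" "smooth_on T h"
    "\<And>w. w \<in> T \<Longrightarrow> w \<in> unit_tangent \<Longrightarrow> geod w \<in> covered \<and> h w = coord (geod w)"
    using local_coord[OF s_unit[OF u]] by metis
  note h = smooth_on_has_derivative[OF T(3,2)]
  have cont_s: "continuous_on Om s" by (rule smooth_on_imp_continuous_on[OF smooth_s])
  have "open (s -` T \<inter> Om)" using cont_s open_Om T(1) continuous_on_open_vimage by blast
  then have "((\<lambda>v. v) has_derivative (\<lambda>a. \<partial> h (s u) (\<partial> s u a))) (at u)"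
  proof (rule has_derivative_transform_within_open[OF has_derivative_compose[OF s_deriv[OF u] h]])
    show "u \<in> s -` T \<inter> Om" using u T(2) by simp
    show "h (s v) = v" if "v \<in> s -` T \<inter> Om" for v
      using T(4)[of "s v"] s_unit[of v] coord_geod[of v] that by auto
  qed
  then have inv: "\<partial> h (s u) (\<partial> s u a) = a" for a
    using has_derivative_unique[OF has_derivative_ident] by metis
  have fl: "((\<lambda>t. geod_flow t (s u)) has_derivative (\<lambda>t. t *\<^sub>R para_J (s u))) (at 0)"
    using has_derivative_geod_flow[OF has_derivative_ident[where F = "at (0::real)"] has_derivative_const[of "s u"]]
    by (simp add: linear_0[OF linear_geod_flow])
  have "continuous_on UNIV (\<lambda>t. geod_flow t (s u))"
    unfolding geod_flow_def by (intro continuous_intros)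
  then have "open ((\<lambda>t. geod_flow t (s u)) -` T)" using T(1) by (simp add: open_vimage)
  then have "((\<lambda>t::real. u) has_derivative (\<lambda>t. \<partial> h (s u) (t *\<^sub>R para_J (s u)))) (at 0)"
  proof (rule has_derivative_transform_within_open[rotated])
    show "((\<lambda>t. h (geod_flow t (s u))) has_derivative (\<lambda>t. \<partial> h (s u) (t *\<^sub>R para_J (s u)))) (at 0)"
      using has_derivative_compose[OF fl, of h "\<partial> h (s u)"] h by simp
    show "h (geod_flow t (s u)) = u" if "t \<in> (\<lambda>t. geod_flow t (s u)) -` T" for t
      using T(4)[of "geod_flow t (s u)"] that geod_flow_unit_tangent[OF s_unit[OF u]] coord_geod[OF u]
      by (simp add: geod_geod_flow)
  qed (use T(2) in simp)
  then have "(\<lambda>t. \<partial> h (s u) (t *\<^sub>R para_J (s u))) = (\<lambda>t. 0)"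
    using has_derivative_unique[OF has_derivative_const] by metis
  then have chi0: "\<partial> h (s u) (t *\<^sub>R para_J (s u)) = 0" for t by metis
  have "a = 0" if "hor_lift s u a = 0" for a
  proof -
    have "\<partial> s u a = chi_part (s u) (\<partial> s u a) *\<^sub>R para_J (s u)" using that hor_lift_eq[OF u] by simp
    then show ?thesis using inv[of a] chi0 by metis
  qed
  then show ?thesis using linear_injective_0[OF linear_hor_lift[OF u]] by blast
qed

lemma range_hor_lift:
  assumes u: "u \<in> Om"
  shows "range (hor_lift s u) = contact (s u)"
proof (rule subspace_dim_equal)
  show "subspace (range (hor_lift s u))"
    using linear_subspace_image[OF linear_hor_lift[OF u] subspace_UNIV] .
  show "subspace (contact (s u))" by (auto simp: subspace_def contact_def mink_simps)
  show "range (hor_lift s u) \<subseteq> contact (s u)" using hor_lift_contact[OF u] by auto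
  have "dim (range (hor_lift s u)) = DIM('n geod_coords)"
    using dim_image_eq[OF linear_hor_lift[OF u], of UNIV] inj_hor_lift[OF u] by simp
  then show "dim (contact (s u)) \<le> dim (range (hor_lift s u))"
    using dim_contact_le[OF s_unit[OF u]] by simp
qed

lemma geod_chart_metric_eq:
  "u \<in> Om \<Longrightarrow> geod_chart_metric s u a b = pmink (hor_lift s u a) (hor_lift s u b)"
  unfolding geod_chart_metric_def geod_chart_vec_def hor_lift_def
  by (intro geod_metric_geod_dp s_unit s_tangent)

text \<open>The first term is the projected flat derivative expected of a submersion. The other two
  compensate the \<open>chi\<close> component of the derivative of \<open>s\<close>: moving along
  the flow changes the representatives at the rate \<open>para_J\<close>. The formula is checked
  through symmetry and metric compatibility, not derived.\<close>

lemma levi_civita_chart: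
  assumes u: "u \<in> Om"
  shows "hor_lift s u (levi_civita (geod_chart_metric s) u a b) =
    contact_proj (s u) (\<partial> (\<lambda>w. \<partial> s w b) u a) -
    chi_part (s u) (\<partial> s u a) *\<^sub>R para_J (hor_lift s u b) -
    chi_part (s u) (\<partial> s u b) *\<^sub>R para_J (hor_lift s u a)"
proof -
  let ?E = "hor_lift s u" and ?g = "geod_chart_metric s"
  define \<theta> where "\<theta> a = chi_part (s u) (\<partial> s u a)" for a
  define q where "q a b = \<partial> (\<lambda>w. \<partial> s w b) u a" for a b
  define R where "R a b = contact_proj (s u) (q a b) - \<theta> a *\<^sub>R para_J (?E b) - \<theta> b *\<^sub>R para_J (?E a)" for a b
  \<comment> \<open>\<open>R\<close> is the proposed lift of the Christoffel symbol; it lies in the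
    contact space, which is the range of \<open>hor_lift\<close>, so the inverse is taken inside
    that range.\<close>
  define G where "G a b = inv ?E (R a b)" for a b
  note linE = linear_hor_lift[OF u] and z = s_unit[OF u]
  have contact: "x \<in> contact (s u) \<Longrightarrow> y \<in> contact (s u) \<Longrightarrow> x - y \<in> contact (s u)"
    "x \<in> contact (s u) \<Longrightarrow> r *\<^sub>R x \<in> contact (s u)" for x y r
    by (auto simp: contact_def mink_simps)
  have "R a b \<in> contact (s u)" for a b
    unfolding R_def by (intro contact contact_proj_in_contact z para_J_contact hor_lift_contact u)
  then have EG: "?E (G a b) = R a b" for a b
    unfolding G_def using range_hor_lift[OF u] by (intro f_inv_into_f) auto
  have E_eqD: "?E x = ?E y \<Longrightarrow> x = y" for x y by (rule injD[OF inj_hor_lift[OF u]])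
  have sd: "((\<lambda>w. \<partial> s w b) has_derivative (\<lambda>a. q a b)) (at u)" for b
    unfolding q_def by (rule smooth_on_has_derivative[OF smooth_on_frechet_derivative[OF smooth_s] u])
  have q_sym: "q a b = q b a" for a b
    unfolding q_def by (rule second_derivative_symmetric[OF smooth_s open_Om u])
  have lin_q: "linear (\<lambda>a. q a b)" for b by (rule has_derivative_linear[OF sd])
  have lin_\<theta>: "linear \<theta>"
    using linear_compose[OF has_derivative_linear[OF s_deriv[OF u]] linear_chi_part]
    by (simp add: \<theta>_def[abs_def] o_def)
  have lin_G: "linear (\<lambda>a. G a b)" for b
  proof
    fix a a' r
    show "G (a + a') b = G a b + G a' b"
      by (rule E_eqD) (simp add: EG R_def linear_add[OF linE] linear_add[OF lin_q]
          linear_add[OF linear_contact_proj] linear_add[OF linear_para_J] linear_add[OF lin_\<theta>] algebra_simps)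
    show "G (r *\<^sub>R a) b = r *\<^sub>R G a b"
      by (rule E_eqD) (simp add: EG R_def linear_scale[OF linE] linear_scale[OF lin_q]
          linear_scale[OF linear_contact_proj] linear_scale[OF linear_para_J] linear_scale[OF lin_\<theta>] algebra_simps)
  qed
  have "R a b = R b a" for a b by (simp add: R_def q_sym[of a b] algebra_simps)
  then have G_sym: "G a b = G b a" for a b unfolding G_def by metis
  have "G a = (\<lambda>b. G b a)" for a by (rule ext) (rule G_sym)
  from this[symmetric] lin_G have "bilinear G" by (simp add: bilinear_def)
  have tang: "mink (fst (s u)) (fst (\<partial> s u a)) = 0" "mink (snd (s u)) (snd (\<partial> s u a)) = 0"
    "mink (fst (s u)) (snd (\<partial> s u a)) = - \<theta> a" "mink (fst (\<partial> s u a)) (snd (s u)) = \<theta> a" for a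
    using s_tangent[OF u, of a] by (auto simp: tangent_T1_def \<theta>_def chi_part_def)
  have tang': "mink (fst (\<partial> s u a)) (fst (s u)) = 0" "mink (snd (\<partial> s u a)) (snd (s u)) = 0"
    "mink (snd (\<partial> s u a)) (fst (s u)) = - \<theta> a" "mink (snd (s u)) (fst (\<partial> s u a)) = \<theta> a" for a
    using tang[of a] by (simp_all add: mink_sym)
  have d1: "((\<lambda>w. fst (s w)) has_derivative (\<lambda>a. fst (\<partial> s u a))) (at u)"
    and d2: "((\<lambda>w. snd (s w)) has_derivative (\<lambda>a. snd (\<partial> s u a))) (at u)"
    and e1: "((\<lambda>w. fst (\<partial> s w b)) has_derivative (\<lambda>a. fst (q a b))) (at u)"
    and e2: "((\<lambda>w. snd (\<partial> s w b)) has_derivative (\<lambda>a. snd (q a b))) (at u)" for b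
    by (rule has_derivative_fst has_derivative_snd s_deriv[OF u] sd)+
  note mink_deriv = bounded_bilinear.FDERIV[OF bounded_bilinear_mink]
  define \<theta>' where "\<theta>' a b = mink (fst (\<partial> s u b)) (snd (\<partial> s u a)) + mink (fst (q a b)) (snd (s u))" for a b
  have \<theta>'d: "((\<lambda>w. chi_part (s w) (\<partial> s w b)) has_derivative (\<lambda>a. \<theta>' a b)) (at u)" for b
    using mink_deriv[OF e1 d2] by (simp add: \<theta>'_def chi_part_def)
  \<comment> \<open>Derivative of the identity that couples the two entries of a tangent
    vector.\<close>
  have constr: "\<theta>' a b + mink (fst (s u)) (snd (q a b)) + mink (fst (\<partial> s u a)) (snd (\<partial> s u b)) = 0" for a b
  proof -
    have "((\<lambda>w. 0) has_derivative (\<lambda>a. \<theta>' a b + (mink (fst (s u)) (snd (q a b)) + mink (fst (\<partial> s u a)) (snd (\<partial> s u b))))) (at u)"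
    proof (rule has_derivative_transform_within_open[OF has_derivative_add[OF \<theta>'d mink_deriv[OF d1 e2]] open_Om u])
      show "chi_part (s w) (\<partial> s w b) + mink (fst (s w)) (snd (\<partial> s w b)) = 0" if "w \<in> Om" for w
        using s_tangent[OF that, of b] by (auto simp: tangent_T1_def chi_part_def)
    qed
    from fun_cong[OF has_derivative_unique[OF this has_derivative_const], of a]
    show ?thesis by simp
  qed
  \<comment> \<open>As \<open>q\<close> is symmetric and \<open>para_J\<close> is skew for
    \<open>pmink\<close>, the antisymmetric part of this identity says that the exterior derivative
    of the connection form \<open>\<theta>\<close> is the pairing with \<open>para_J\<close>. This
    curvature is what produces the two correction terms in \<open>R\<close>.\<close>
  have claim: "pmink (q a b) (para_J (s u)) + pmink (para_J (?E a)) (?E b) = 2 * \<theta>' a b" for a b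
  proof -
    have "pmink (para_J (?E a)) (?E b) =
        mink (snd (\<partial> s u a)) (fst (\<partial> s u b)) - mink (fst (\<partial> s u a)) (snd (\<partial> s u b))"
      using tang tang'
      by (simp add: hor_lift_eq[OF u] pmink_def para_J_def mink_simps \<theta>_def[symmetric] unit_tangentD[OF z])
    then show ?thesis using constr[of a b]
      by (simp add: pmink_def para_J_def \<theta>'_def mink_sym)
  qed
  have "\<partial> (\<lambda>w. ?g w b c) u a = ?g u (G a b) c + ?g u b (G a c)" for a b c
  proof -
    have V: "pmink (R a b) (?E c) = pmink (q a b) (\<partial> s u c) - \<theta> c * pmink (q a b) (para_J (s u))
        - \<theta> a * pmink (para_J (?E b)) (?E c) - \<theta> b * pmink (para_J (?E a)) (?E c)" for b c
    proof -
      have "pmink (R a b) (?E c) = pmink (q a b) (?E c)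
          - \<theta> a * pmink (para_J (?E b)) (?E c) - \<theta> b * pmink (para_J (?E a)) (?E c)"
        by (simp add: R_def pmink_simps pmink_contact_proj[OF hor_lift_contact[OF u]])
      also have "pmink (q a b) (?E c) = pmink (q a b) (\<partial> s u c) - \<theta> c * pmink (q a b) (para_J (s u))"
        by (simp add: hor_lift_eq[OF u] pmink_simps \<theta>_def)
      finally show ?thesis .
    qed
    have JJ: "pmink (para_J (s w)) (para_J (s w)) = 2"
      "pmink (\<partial> s w a) (para_J (s w)) = 2 * chi_part (s w) (\<partial> s w a)"
      "pmink (para_J (s w)) (\<partial> s w a) = 2 * chi_part (s w) (\<partial> s w a)" if "w \<in> Om" for w a
      using s_tangent[OF that, of a] unit_tangentD[OF s_unit[OF that]]
      by (auto simp: pmink_def para_J_def tangent_T1_def chi_part_def mink_sym)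
    \<comment> \<open>The coefficient 2 is the square length of \<open>chi\<close> for
      \<open>pmink\<close>: the two cross terms contribute -2 each and the square +2.\<close>
    have g: "?g w b c = mink (fst (\<partial> s w b)) (fst (\<partial> s w c)) - mink (snd (\<partial> s w b)) (snd (\<partial> s w c))
        - 2 * (chi_part (s w) (\<partial> s w b) * chi_part (s w) (\<partial> s w c))" if "w \<in> Om" for w
      by (simp add: geod_chart_metric_eq[OF that] hor_lift_eq[OF that] pmink_simps JJ[OF that] algebra_simps)
        (simp add: pmink_def)
    have "((\<lambda>w. ?g w b c) has_derivative (\<lambda>a. pmink (\<partial> s u b) (q a c) + pmink (q a b) (\<partial> s u c)
        - 2 * (\<theta> b * \<theta>' a c + \<theta>' a b * \<theta> c))) (at u)"
    proof (rule has_derivative_transform_within_open[OF _ open_Om u])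
      show "((\<lambda>w. mink (fst (\<partial> s w b)) (fst (\<partial> s w c)) - mink (snd (\<partial> s w b)) (snd (\<partial> s w c))
        - 2 * (chi_part (s w) (\<partial> s w b) * chi_part (s w) (\<partial> s w c))) has_derivative
        (\<lambda>a. pmink (\<partial> s u b) (q a c) + pmink (q a b) (\<partial> s u c)
        - 2 * (\<theta> b * \<theta>' a c + \<theta>' a b * \<theta> c))) (at u)"
        by (rule has_derivative_eq_rhs, rule has_derivative_diff[OF
            has_derivative_diff[OF mink_deriv[OF e1 e1] mink_deriv[OF e2 e2]]
            has_derivative_mult_right[OF has_derivative_mult[OF \<theta>'d \<theta>'d]]])
          (simp add: fun_eq_iff pmink_def \<theta>_def)
    qed (simp add: g)
    then have "\<partial> (\<lambda>w. ?g w b c) u a = pmink (\<partial> s u b) (q a c) + pmink (q a b) (\<partial> s u c)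
        - 2 * (\<theta> b * \<theta>' a c + \<theta>' a b * \<theta> c)"
      by (simp only: has_derivative_eq_frechet)
    moreover have "pmink (para_J (?E c)) (?E b) = - pmink (para_J (?E b)) (?E c)"
      using pmink_para_J(2) pmink_sym by metis
    moreover have "pmink (\<partial> s u b) (q a c) = pmink (q a c) (\<partial> s u b)" by (rule pmink_sym)
    moreover have "?g u (G a b) c + ?g u b (G a c) = pmink (R a b) (?E c) + pmink (R a c) (?E b)"
      by (simp add: geod_chart_metric_eq[OF u] EG pmink_sym)
    moreover have "\<theta> c * (2 * \<theta>' a b) = \<theta> c * pmink (q a b) (para_J (s u)) + \<theta> c * pmink (para_J (?E a)) (?E b)"
      "\<theta> b * (2 * \<theta>' a c) = \<theta> b * pmink (q a c) (para_J (s u)) + \<theta> b * pmink (para_J (?E a)) (?E c)"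
      unfolding claim[symmetric] by (simp_all add: distrib_left)
    ultimately show ?thesis using V[of b c] V[of c b] by (simp add: algebra_simps)
  qed
  moreover have "linear (?g u a)" for a
    by (rule linearI) (simp_all add: geod_chart_metric_eq[OF u] linear_add[OF linE] linear_scale[OF linE] pmink_simps)
  moreover have "a = 0" if "\<And>b. ?g u a b = 0" for a
  proof -
    have "pmink (?E a) w = 0" if "w \<in> contact (s u)" for w
      using that \<open>\<And>b. ?g u a b = 0\<close> geod_chart_metric_eq[OF u] range_hor_lift[OF u] by (metis imageE)
    then have "?E a = ?E 0"
      using contact_nondegenerate[OF z hor_lift_contact[OF u]] linear_0[OF linE] by simp
    then show ?thesis by (rule E_eqD)
  qed
  ultimately have "levi_civita ?g u = G"
    using \<open>bilinear G\<close> G_sym by (intro levi_civita_eqI) (auto simp: geod_chart_metric_eq[OF u] pmink_sym)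
  then show ?thesis by (simp add: EG R_def q_def \<theta>_def)
qed

end

section \<open>Lifts to the unit tangent bundle\<close>

text \<open>The domain is any Euclidean space, since two lifts are compared later: the Gauss lift of
  the hypersurface at a fixed time, and the curve traced in time at a fixed point.\<close>

locale geod_lift = geod_param Om s
  for Om :: "'n::finite geod_coords set" and s :: "'n geod_coords \<Rightarrow> 'n minkowski \<times> 'n minkowski" +
  fixes V :: "'a::euclidean_space set" and \<gamma> :: "'a \<Rightarrow> 'n minkowski \<times> 'n minkowski"
  assumes open_V: "open V" and smooth_\<gamma>: "smooth_on V \<gamma>"
    and \<gamma>_unit: "y \<in> V \<Longrightarrow> \<gamma> y \<in> unit_tangent" and \<gamma>_covered: "y \<in> V \<Longrightarrow> geod (\<gamma> y) \<in> covered"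
begin

definition F :: "'a \<Rightarrow> 'n geod_coords" where "F y = coord (geod (\<gamma> y))"

text \<open>The flow time from \<open>\<gamma> y\<close> to the point of the same orbit chosen by
  \<open>s\<close>. For a unit tangent vector z the product of the first entry of
  \<open>geod_flow t z\<close> with the second entry of z is sinh t, so this explicit formula makes
  the time visibly differentiable.\<close>

definition shift :: "'a \<Rightarrow> real" where "shift y = arsinh (mink (fst (s (F y))) (snd (\<gamma> y)))"

lemma F_in: "y \<in> V \<Longrightarrow> F y \<in> Om" and geod_F: "y \<in> V \<Longrightarrow> geod (s (F y)) = geod (\<gamma> y)"
  using \<gamma>_covered by (simp_all add: F_def coord_in geod_coord_covered)

lemma smooth_F: "smooth_on V F"
proof (rule smooth_on_local[OF open_V])
  fix x assume x: "x \<in> V"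
  obtain T h where T: "open T" "\<gamma> x \<in> T" "smooth_on T h"
    "\<And>w. w \<in> T \<Longrightarrow> w \<in> unit_tangent \<Longrightarrow> geod w \<in> covered \<and> h w = coord (geod w)"
    using local_coord[OF \<gamma>_unit[OF x] \<gamma>_covered[OF x]] by metis
  let ?U = "\<gamma> -` T \<inter> V"
  have U: "open ?U"
    using smooth_on_imp_continuous_on[OF smooth_\<gamma>] open_V T(1) continuous_on_open_vimage by blast
  have "smooth_on ?U (\<lambda>y. h (\<gamma> y))"
    by (rule smooth_on_compose[OF U T(1) _ smooth_on_subset[OF smooth_\<gamma>] T(3)]) auto
  then have "smooth_on ?U F"
    by (rule smooth_on_cong[OF U, rotated]) (use T(4) \<gamma>_unit in \<open>auto simp: F_def\<close>)
  then show "\<exists>U. open U \<and> x \<in> U \<and> smooth_on U F" using U x T(2) by blast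
qed

lemma s_F: "y \<in> V \<Longrightarrow> s (F y) = geod_flow (shift y) (\<gamma> y)"
proof -
  assume y: "y \<in> V"
  then obtain t where t: "s (F y) = geod_flow t (\<gamma> y)"
    using mem_geod[of "s (F y)"] geod_F[OF y] by (auto simp: geod_def)
  have "mink (fst (s (F y))) (snd (\<gamma> y)) = sinh t"
    by (simp add: t geod_flow_def mink_simps unit_tangentD[OF \<gamma>_unit[OF y]])
  then show ?thesis using t by (simp add: shift_def arsinh_sinh_real)
qed

lemma smooth_s_F: "smooth_on V (\<lambda>y. s (F y))"
  by (rule smooth_on_compose[OF open_V open_Om _ smooth_F smooth_s]) (use F_in in auto)

lemma F_deriv: "y \<in> V \<Longrightarrow> (F has_derivative \<partial> F y) (at y)"
  and \<gamma>_deriv: "y \<in> V \<Longrightarrow> (\<gamma> has_derivative \<partial> \<gamma> y) (at y)"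
  and s_F_deriv: "y \<in> V \<Longrightarrow> ((\<lambda>y. s (F y)) has_derivative \<partial> (\<lambda>y. s (F y)) y) (at y)"
  by (rule smooth_on_has_derivative[OF smooth_F] smooth_on_has_derivative[OF smooth_\<gamma>]
      smooth_on_has_derivative[OF smooth_s_F], assumption)+

lemma deriv_s_F: "y \<in> V \<Longrightarrow> \<partial> (\<lambda>y. s (F y)) y a = \<partial> s (F y) (\<partial> F y a)"
  by (simp add: has_derivative_eq_frechet[OF has_derivative_compose[OF F_deriv s_deriv[OF F_in]]])

lemma \<gamma>_tangent: "y \<in> V \<Longrightarrow> \<partial> \<gamma> y a \<in> tangent_T1 (\<gamma> y)"
  using \<gamma>_unit by (intro tangent_T1_derivative[OF open_V _ _ \<gamma>_deriv]) auto

lemma deriv_s_F_eq: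
  assumes y: "y \<in> V"
  obtains \<tau>' where "(shift has_derivative \<tau>') (at y)"
    "\<And>a. \<partial> (\<lambda>y. s (F y)) y a = geod_flow (shift y) (\<partial> \<gamma> y a) + \<tau>' a *\<^sub>R para_J (s (F y))"
proof -
  obtain D where "((\<lambda>y. mink (fst (s (F y))) (snd (\<gamma> y))) has_derivative D) (at y)"
    using bounded_bilinear.FDERIV[OF bounded_bilinear_mink has_derivative_fst[OF s_F_deriv[OF y]]
        has_derivative_snd[OF \<gamma>_deriv[OF y]]] by blast
  from DERIV_compose_FDERIV[OF arsinh_real_has_field_derivative this]
  obtain \<tau>' where \<tau>: "(shift has_derivative \<tau>') (at y)" unfolding shift_def[abs_def] by blast
  have "((\<lambda>y. s (F y)) has_derivative
      (\<lambda>a. geod_flow (shift y) (\<partial> \<gamma> y a) + \<tau>' a *\<^sub>R para_J (geod_flow (shift y) (\<gamma> y)))) (at y)"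
    by (rule has_derivative_transform_within_open[OF has_derivative_geod_flow[OF \<tau> \<gamma>_deriv[OF y]] open_V y])
      (simp add: s_F)
  then show ?thesis using that[OF \<tau>] s_F[OF y] by (simp add: has_derivative_eq_frechet)
qed

text \<open>The derivative of the flow time only adds a multiple of \<open>chi\<close>, which
  \<open>chi_perp\<close> removes; so tangent vectors of the space of geodesics can be read off from
  any lift.\<close>

lemma hor_lift_F:
  assumes y: "y \<in> V"
  shows "hor_lift s (F y) (\<partial> F y a) = geod_flow (shift y) (chi_perp (\<gamma> y) (\<partial> \<gamma> y a))"
proof -
  obtain \<tau>' where \<tau>: "\<And>a. \<partial> (\<lambda>y. s (F y)) y a = geod_flow (shift y) (\<partial> \<gamma> y a) + \<tau>' a *\<^sub>R para_J (s (F y))"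
    using deriv_s_F_eq[OF y] by metis
  have "chi_perp (s (F y)) (para_J (s (F y))) = 0"
    using unit_tangentD[OF s_unit[OF F_in[OF y]]]
    by (simp add: chi_perp_eq[OF s_unit[OF F_in[OF y]]] chi_part_def para_J_def)
  moreover have "chi_perp (s (F y)) (geod_flow (shift y) (\<partial> \<gamma> y a)) =
      geod_flow (shift y) (chi_perp (\<gamma> y) (\<partial> \<gamma> y a))"
    unfolding s_F[OF y] by (rule chi_perp_geod_flow[OF \<gamma>_unit[OF y] \<gamma>_tangent[OF y]])
  ultimately show ?thesis
    by (simp add: hor_lift_def deriv_s_F[OF y, symmetric] \<tau> linear_add[OF linear_chi_perp]
        linear_scale[OF linear_chi_perp])
qed

text \<open>This hypothesis holds for the Gauss lift at a fixed time, but the curve in time has a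
  \<open>chi\<close> component equal to its speed; hence \<open>hor_lift_F\<close> stays
  outside.\<close>

context
  assumes horizontal: "\<And>y a. y \<in> V \<Longrightarrow> chi_part (\<gamma> y) (\<partial> \<gamma> y a) = 0"
begin

lemma \<gamma>_contact: "y \<in> V \<Longrightarrow> \<partial> \<gamma> y a \<in> contact (\<gamma> y)"
  using chi_perp_contact[OF \<gamma>_unit \<gamma>_tangent] chi_perp_eq[OF \<gamma>_unit] horizontal by simp

lemma hor_lift_F_horizontal: "y \<in> V \<Longrightarrow> hor_lift s (F y) (\<partial> F y a) = geod_flow (shift y) (\<partial> \<gamma> y a)"
  using hor_lift_F chi_perp_eq[OF \<gamma>_unit] horizontal by simp

text \<open>This is the derivative of \<open>shift\<close>, as \<open>deriv_s_F_vert\<close> shows;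
  expressed through s composed with \<open>F\<close>, it is itself clearly differentiable.\<close>

definition vert :: "'a \<Rightarrow> 'a \<Rightarrow> real" where "vert y a = chi_part (s (F y)) (\<partial> (\<lambda>y. s (F y)) y a)"

lemma deriv_s_F_vert:
  assumes y: "y \<in> V"
  shows "(shift has_derivative vert y) (at y)"
    "\<partial> (\<lambda>y. s (F y)) y a = geod_flow (shift y) (\<partial> \<gamma> y a) + vert y a *\<^sub>R para_J (s (F y))"
proof -
  obtain \<tau>' where \<tau>: "(shift has_derivative \<tau>') (at y)"
    "\<And>a. \<partial> (\<lambda>y. s (F y)) y a = geod_flow (shift y) (\<partial> \<gamma> y a) + \<tau>' a *\<^sub>R para_J (s (F y))"
    using deriv_s_F_eq[OF y] by metis
  have "chi_part (s (F y)) (geod_flow (shift y) (\<partial> \<gamma> y a)) = 0" for a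
    unfolding s_F[OF y] using parts_geod_flow(1)[OF \<gamma>_unit[OF y] \<gamma>_tangent[OF y]] horizontal[OF y] by simp
  moreover have "chi_part (s (F y)) (para_J (s (F y))) = 1"
    using unit_tangentD[OF s_unit[OF F_in[OF y]]] by (simp add: chi_part_def para_J_def)
  ultimately have "vert y = \<tau>'"
    by (simp add: fun_eq_iff vert_def \<tau>(2) linear_add[OF linear_chi_part] linear_scale[OF linear_chi_part])
  then show "(shift has_derivative vert y) (at y)"
    "\<partial> (\<lambda>y. s (F y)) y a = geod_flow (shift y) (\<partial> \<gamma> y a) + vert y a *\<^sub>R para_J (s (F y))"
    using \<tau> by simp_all
qed

text \<open>Differentiating the flow in its time parameter gives one \<open>para_J\<close> term, and
  differentiating the base point in the \<open>chi\<close> component gives the other; what remains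
  along the base point and \<open>chi\<close> is projected away. The two terms are the opposites of
  the corrections in \<open>levi_civita_chart\<close>.\<close>

lemma contact_proj_second_deriv_s_F:
  assumes x: "x \<in> V"
  shows "contact_proj (s (F x)) (\<partial> (\<lambda>y. \<partial> (\<lambda>y. s (F y)) y b) x a) =
    geod_flow (shift x) (contact_proj (\<gamma> x) (\<partial> (\<lambda>y. \<partial> \<gamma> y b) x a)) +
    vert x a *\<^sub>R para_J (geod_flow (shift x) (\<partial> \<gamma> x b)) + vert x b *\<^sub>R para_J (geod_flow (shift x) (\<partial> \<gamma> x a))"
proof -
  let ?S = "\<lambda>y. s (F y)" and ?fl = "geod_flow (shift x)"
  have S: "?S x \<in> unit_tangent" by (rule s_unit[OF F_in[OF x]])
  have d\<gamma>: "((\<lambda>y. \<partial> \<gamma> y b) has_derivative \<partial> (\<lambda>y. \<partial> \<gamma> y b) x) (at x)"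
    by (rule smooth_on_has_derivative[OF smooth_on_frechet_derivative[OF smooth_\<gamma>] x])
  have dS: "((\<lambda>y. \<partial> ?S y b) has_derivative \<partial> (\<lambda>y. \<partial> ?S y b) x) (at x)"
    by (rule smooth_on_has_derivative[OF smooth_on_frechet_derivative[OF smooth_s_F] x])
  \<comment> \<open>D enters only as a coefficient of \<open>para_J (?S x)\<close>, which the
    projection kills, so no formula for it is derived.\<close>
  obtain D where D: "((\<lambda>y. vert y b) has_derivative D) (at x)"
    unfolding vert_def chi_part_def
    using bounded_bilinear.FDERIV[OF bounded_bilinear_mink has_derivative_fst[OF dS]
        has_derivative_snd[OF s_F_deriv[OF x]]] by blast
  have dJ: "((\<lambda>y. para_J (?S y)) has_derivative (\<lambda>a. para_J (\<partial> ?S x a))) (at x)"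
    using linear_conv_bounded_linear linear_para_J bounded_linear.has_derivative[OF _ s_F_deriv[OF x]] by blast
  have "((\<lambda>y. \<partial> ?S y b) has_derivative (\<lambda>a. (?fl (\<partial> (\<lambda>y. \<partial> \<gamma> y b) x a) +
      vert x a *\<^sub>R para_J (?fl (\<partial> \<gamma> x b))) + (vert x b *\<^sub>R para_J (\<partial> ?S x a) + D a *\<^sub>R para_J (?S x)))) (at x)"
    by (rule has_derivative_transform_within_open[OF has_derivative_add[OF
          has_derivative_geod_flow[OF deriv_s_F_vert(1)[OF x] d\<gamma>] has_derivative_scaleR[OF D dJ]] open_V x])
      (simp add: deriv_s_F_vert(2))
  then have "\<partial> (\<lambda>y. \<partial> ?S y b) x a = (?fl (\<partial> (\<lambda>y. \<partial> \<gamma> y b) x a) +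
      vert x a *\<^sub>R para_J (?fl (\<partial> \<gamma> x b))) + (vert x b *\<^sub>R para_J (\<partial> ?S x a) + D a *\<^sub>R para_J (?S x))"
    by (simp only: has_derivative_eq_frechet)
  moreover have "contact_proj (?S x) (?fl w) = ?fl (contact_proj (\<gamma> x) w)" for w
    unfolding s_F[OF x] by (rule contact_proj_geod_flow[OF \<gamma>_unit[OF x]])
  moreover have "contact_proj (\<gamma> x) (\<partial> \<gamma> x c) = \<partial> \<gamma> x c" for c
    by (rule contact_proj_contact[OF \<gamma>_contact[OF x]])
  ultimately show ?thesis
    by (simp add: deriv_s_F_vert(2)[OF x] linear_add[OF linear_contact_proj] linear_scale[OF linear_contact_proj]
        contact_proj_para_J contact_proj_base[OF S] linear_add[OF linear_para_J] linear_scale[OF linear_para_J]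
        linear_0[OF linear_para_J] algebra_simps)
qed

text \<open>In the submersion onto the space of geodesics, a horizontal lift differs from the lift \<open>s \<circ> F\<close>
  by a shift along the flow; the derivatives of the shift cancel against the vertical terms of the
  Christoffel symbols.\<close>

lemma hor_lift_connection:
  assumes x: "x \<in> V"
  shows "hor_lift s (F x) (\<partial> (\<lambda>y. \<partial> F y b) x a +
      levi_civita (geod_chart_metric s) (F x) (\<partial> F x a) (\<partial> F x b)) =
    geod_flow (shift x) (contact_proj (\<gamma> x) (\<partial> (\<lambda>y. \<partial> \<gamma> y b) x a))"
proof -
  note u = F_in[OF x]
  have "hor_lift s (F x) c = contact_proj (s (F x)) (\<partial> s (F x) c)" for c
    unfolding hor_lift_def by (rule chi_perp_eq_contact_proj[OF s_unit[OF u] s_tangent[OF u]])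
  then have "hor_lift s (F x) (\<partial> (\<lambda>y. \<partial> F y b) x a) +
      contact_proj (s (F x)) (\<partial> (\<lambda>w. \<partial> s w (\<partial> F x b)) (F x) (\<partial> F x a)) =
    contact_proj (s (F x)) (\<partial> (\<lambda>y. \<partial> (\<lambda>y. s (F y)) y b) x a)"
    using second_derivative_compose[OF open_V open_Om image_subsetI[OF F_in] smooth_F smooth_s x, of b a]
    by (simp only: linear_add[OF linear_contact_proj] add.commute)
  moreover have "vert x c = chi_part (s (F x)) (\<partial> s (F x) (\<partial> F x c))" for c
    by (simp add: vert_def deriv_s_F[OF x])
  ultimately show ?thesis
    using contact_proj_second_deriv_s_F[OF x, of b a]
    by (simp add: linear_add[OF linear_hor_lift[OF u]] levi_civita_chart[OF u] hor_lift_F_horizontal[OF x]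
        algebra_simps)
qed

end

end

section \<open>Matrices\<close>

lemma matrix_mult_add_diff:
  fixes A B :: "real ^ 'n::finite ^ 'm::finite" and C :: "real ^ 'k::finite ^ 'n"
  shows "(A + B) ** C = A ** C + B ** C" "(A - B) ** C = A ** C - B ** C"
  by (simp_all add: matrix_matrix_mult_def vec_eq_iff distrib_right left_diff_distrib sum.distrib sum_subtractf)

lemma matrix_mult_diff_right:
  fixes A :: "real ^ 'n::finite ^ 'm::finite" and B C :: "real ^ 'k::finite ^ 'n"
  shows "A ** (B - C) = A ** B - A ** C"
  by (simp add: matrix_matrix_mult_def vec_eq_iff right_diff_distrib sum_subtractf)

lemma matrix_inv_eqI:
  fixes A P :: "real ^ 'n::finite ^ 'n"
  assumes "P ** A = mat 1"
  shows "matrix_inv A = P"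
proof -
  have AP: "A ** P = mat 1" using assms by (simp add: matrix_left_right_inverse)
  have "A ** matrix_inv A = mat 1 \<and> matrix_inv A ** A = mat 1"
    unfolding matrix_inv_def
    by (rule someI[of "\<lambda>A'. A ** A' = mat 1 \<and> A' ** A = mat 1" P]) (simp add: assms AP)
  then have "P ** (A ** matrix_inv A) = P" by simp
  then show ?thesis by (simp add: matrix_mul_assoc assms)
qed

text \<open>For \<open>G\<close> and \<open>H = G B\<close> with derivatives \<open>K + K\<^sup>T\<close> and \<open>H'\<close>, the left-hand side is the derivative of
  \<open>ln (det (G + H) / det (G - H))\<close>; on the right is the covariant derivative of the bilinear form \<open>H\<close>.\<close>

lemma trace_log_det_ratio:
  fixes G B K H' :: "real ^ 'n::finite ^ 'n"
  assumes P: "P ** (mat 1 + B) = mat 1" and Q: "Q ** (mat 1 - B) = mat 1" and R: "R ** G = mat 1"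
    and sym: "transpose B ** G = G ** B"
  shows "trace ((P ** R) ** (K + transpose K + H')) - trace ((Q ** R) ** (K + transpose K - H')) =
    2 * trace ((P ** Q ** R) ** (H' - K ** B - transpose B ** transpose K))"
proof -
  note mm = matrix_mult_add_diff matrix_mult_diff_right matrix_add_ldistrib matrix_mul_assoc
  have PB: "B ** P = P ** B"
  proof -
    have "(mat 1 + B) ** P = mat 1" using P matrix_left_right_inverse by blast
    then have "P + B ** P = P + P ** B" using P by (simp add: mm)
    then show ?thesis by simp
  qed
  have QB: "B ** Q = Q ** B"
  proof -
    have "(mat 1 - B) ** Q = mat 1" using Q matrix_left_right_inverse by blast
    then have "Q - B ** Q = Q - Q ** B" using Q by (simp add: mm)
    then show ?thesis by simp
  qed
  \<comment> \<open>The inverse of 1 - B^2. Writing P as D - BD and Q as D + BD leaves twice the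
    trace of D R H' minus twice the trace of B D R (K + K^T); cyclicity and R B^T = B R then move B
    next to K.\<close>
  let ?D = "P ** Q"
  have DB: "?D ** B = B ** ?D" unfolding matrix_mul_assoc PB by (simp add: QB flip: matrix_mul_assoc)
  have "P = P ** (Q ** (mat 1 - B))" by (simp add: Q)
  then have P': "P = ?D - B ** ?D" by (simp add: mm DB)
  have "Q = P ** (mat 1 + B) ** Q" by (simp add: P)
  then have Q': "Q = ?D + B ** ?D" by (simp add: mm PB[symmetric])
  have RB: "R ** transpose B = B ** R"
  proof -
    have GR: "G ** R = mat 1" using R matrix_left_right_inverse by blast
    have "R ** (transpose B ** G) ** R = R ** (G ** B) ** R" by (simp only: sym)
    moreover have "R ** (transpose B ** G) ** R = R ** transpose B ** (G ** R)"
      by (simp add: matrix_mul_assoc)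
    moreover have "R ** (G ** B) ** R = (R ** G) ** B ** R" by (simp add: matrix_mul_assoc)
    ultimately show ?thesis by (simp add: R GR)
  qed
  have 1: "trace (?D ** R ** K ** B) = trace (B ** ?D ** R ** K)"
    using trace_mul_sym[of "?D ** R ** K" B] by (simp add: matrix_mul_assoc)
  have 2: "?D ** R ** transpose B = B ** ?D ** R"
    using RB by (simp add: DB[symmetric] matrix_mul_assoc[symmetric])
  have "trace ((P ** R) ** (K + transpose K + H')) = trace (((?D - B ** ?D) ** R) ** (K + transpose K + H'))"
    using P' by simp
  moreover have "trace ((Q ** R) ** (K + transpose K - H')) = trace (((?D + B ** ?D) ** R) ** (K + transpose K - H'))"
    using Q' by simp
  ultimately show ?thesis using 1 by (simp add: mm trace_add trace_sub 2)
qed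

section \<open>Hypersurfaces with small principal curvatures\<close>

text \<open>A hypersurface read in one chart. The flat derivative of N suffices in
  \<open>shape\<close>, because it is orthogonal to f, which makes the hyperbolic correction vanish.
  B and \<open>lam\<close> are pointwise data without regularity in y.\<close>

locale hypersurface =
  fixes V :: "(real ^ 'n::finite) set" and f N :: "real ^ 'n \<Rightarrow> 'n minkowski"
    and B :: "real ^ 'n \<Rightarrow> real ^ 'n \<Rightarrow> real ^ 'n" and lam :: "real ^ 'n \<Rightarrow> 'n \<Rightarrow> real"
  assumes open_V: "open V" and smooth_f: "smooth_on V f" and smooth_N: "smooth_on V N"
    and unit: "y \<in> V \<Longrightarrow> (f y, N y) \<in> unit_tangent"
    and normal: "y \<in> V \<Longrightarrow> mink (\<partial> f y a) (N y) = 0"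
    and spanning: "y \<in> V \<Longrightarrow> mink w (f y) = 0 \<Longrightarrow> mink w (N y) = 0 \<Longrightarrow> w \<in> range (\<partial> f y)"
    and inj_df: "y \<in> V \<Longrightarrow> inj (\<partial> f y)"
    and shape: "y \<in> V \<Longrightarrow> \<partial> N y a = - \<partial> f y (B y a)"
    and eigen: "y \<in> V \<Longrightarrow> eigenvalues_of (B y) (lam y)"
    and small: "y \<in> V \<Longrightarrow> lam y k \<in> {-1<..<1}"
begin

lemma f_deriv: "y \<in> V \<Longrightarrow> (f has_derivative \<partial> f y) (at y)"
  and N_deriv: "y \<in> V \<Longrightarrow> (N has_derivative \<partial> N y) (at y)"
  by (rule smooth_on_has_derivative[OF smooth_f] smooth_on_has_derivative[OF smooth_N], assumption)+

lemma df_deriv: "y \<in> V \<Longrightarrow> ((\<lambda>y. \<partial> f y a) has_derivative \<partial> (\<lambda>y. \<partial> f y a) y) (at y)"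
  and dN_deriv: "y \<in> V \<Longrightarrow> ((\<lambda>y. \<partial> N y a) has_derivative \<partial> (\<lambda>y. \<partial> N y a) y) (at y)"
  by (rule smooth_on_has_derivative[OF smooth_on_frechet_derivative[OF smooth_f]]
      smooth_on_has_derivative[OF smooth_on_frechet_derivative[OF smooth_N]], assumption)+

lemma linear_df: "y \<in> V \<Longrightarrow> linear (\<partial> f y)"
  by (rule has_derivative_linear[OF f_deriv])

lemma linear_B:
  assumes y: "y \<in> V"
  shows "linear (B y)"
proof
  note df = linear_df[OF y] and dN = has_derivative_linear[OF N_deriv[OF y]]
  show "B y (a + b) = B y a + B y b" for a b
  proof (rule injD[OF inj_df[OF y]])
    show "\<partial> f y (B y (a + b)) = \<partial> f y (B y a + B y b)"
    proof -
      have "- \<partial> f y (B y (a + b)) = - (\<partial> f y (B y a) + \<partial> f y (B y b))"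
        using linear_add[OF dN, of a b] by (simp add: shape[OF y])
      then show ?thesis by (simp only: neg_equal_iff_equal linear_add[OF df])
    qed
  qed
  show "B y (r *\<^sub>R a) = r *\<^sub>R B y a" for r a
  proof (rule injD[OF inj_df[OF y]])
    show "\<partial> f y (B y (r *\<^sub>R a)) = \<partial> f y (r *\<^sub>R B y a)"
      using linear_scale[OF dN, of r a] unfolding linear_scale[OF df] by (simp add: shape[OF y])
  qed
qed

lemma df_normal:
  assumes "y \<in> V"
  shows "mink (\<partial> f y a) (f y) = 0" "mink (f y) (\<partial> f y a) = 0"
    "mink (\<partial> f y a) (N y) = 0" "mink (N y) (\<partial> f y a) = 0"
proof -
  have "((\<lambda>y. (f y, N y)) has_derivative (\<lambda>a. (\<partial> f y a, \<partial> N y a))) (at y)"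
    by (intro has_derivative_Pair f_deriv N_deriv assms)
  then have "(\<partial> f y a, \<partial> N y a) \<in> tangent_T1 (f y, N y)"
    using tangent_T1_derivative[OF open_V assms, of "\<lambda>y. (f y, N y)"] unit by blast
  then show "mink (\<partial> f y a) (f y) = 0" "mink (f y) (\<partial> f y a) = 0"
    by (auto simp: tangent_T1_def mink_sym)
  show "mink (\<partial> f y a) (N y) = 0" "mink (N y) (\<partial> f y a) = 0"
    using normal[OF assms] mink_sym[of "N y"] by auto
qed

lemma first_form_nondegenerate:
  assumes y: "y \<in> V" and 0: "\<And>b. mink (\<partial> f y a) (\<partial> f y b) = 0"
  shows "a = 0"
proof -
  note un = unit_tangentD[OF unit[OF y], simplified]
  have "mink (\<partial> f y a) w = 0" for w
  proof -
    let ?w = "w + mink w (f y) *\<^sub>R f y - mink w (N y) *\<^sub>R N y"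
    have "?w \<in> range (\<partial> f y)" by (rule spanning[OF y]) (simp_all add: mink_simps un)
    then have "mink (\<partial> f y a) ?w = 0" using 0 by auto
    then show ?thesis by (simp add: mink_simps df_normal[OF y])
  qed
  then have "\<partial> f y a = \<partial> f y 0" using mink_nondegenerate linear_0[OF linear_df[OF y]] by metis
  then show ?thesis by (rule injD[OF inj_df[OF y]])
qed

text \<open>Derivative of the orthogonality of tangent vectors and N. The left side is a Hessian,
  whose symmetry makes B self-adjoint.\<close>

lemma second_form:
  assumes y: "y \<in> V"
  shows "mink (\<partial> (\<lambda>y. \<partial> f y b) y a) (N y) = mink (\<partial> f y b) (\<partial> f y (B y a))"
proof -
  have "((\<lambda>y. 0) has_derivative (\<lambda>a. mink (\<partial> f y b) (\<partial> N y a) + mink (\<partial> (\<lambda>y. \<partial> f y b) y a) (N y))) (at y)"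
    by (rule has_derivative_transform_within_open[OF
          bounded_bilinear.FDERIV[OF bounded_bilinear_mink df_deriv[OF y] N_deriv[OF y]] open_V y])
      (simp add: df_normal)
  from fun_cong[OF has_derivative_unique[OF this has_derivative_const], of a]
  show ?thesis by (simp add: shape[OF y])
qed

lemma B_self_adjoint:
  assumes y: "y \<in> V"
  shows "mink (\<partial> f y (B y a)) (\<partial> f y b) = mink (\<partial> f y a) (\<partial> f y (B y b))"
  using second_form[OF y, of a b] second_form[OF y, of b a]
    second_derivative_symmetric[OF smooth_f open_V y, of a b] by (simp add: mink_sym)

lemma matrix_B: "y \<in> V \<Longrightarrow> matrix (B y) *v a = B y a"
  by (simp add: matrix_works linear_B)

text \<open>The characteristic polynomial at 1 and at -1; in the second case a sign (-1)^n is
  extracted from both sides and cancelled. No diagonalisation is involved.\<close>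

lemma det_B:
  assumes y: "y \<in> V"
  shows "det (mat 1 - matrix (B y)) = (\<Prod>k\<in>UNIV. 1 - lam y k)"
    "det (mat 1 + matrix (B y)) = (\<Prod>k\<in>UNIV. 1 + lam y k)"
proof -
  have eig: "det (x *\<^sub>R mat 1 - matrix (B y)) = (\<Prod>k\<in>UNIV. x - lam y k)" for x
    using eigen[OF y] by (simp add: eigenvalues_of_def)
  show "det (mat 1 - matrix (B y)) = (\<Prod>k\<in>UNIV. 1 - lam y k)" using eig[of 1] by simp
  have "(-1) *\<^sub>R mat 1 - matrix (B y) = mat (-1) ** (mat 1 + matrix (B y))"
    by (simp add: vec_eq_iff matrix_matrix_mult_def mat_def if_distrib[where f = "\<lambda>t. t * _"] cong: if_cong)
  then have "(-1) ^ CARD('n) * det (mat 1 + matrix (B y)) = (\<Prod>k\<in>UNIV. (-1) - lam y k)"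
    using eig[of "-1"] det_matrix_scaleR[of "-1 :: real", where 'n = 'n] by (simp add: det_mul matrix_scaleR)
  also have "\<dots> = (\<Prod>k\<in>UNIV. (-1) * (1 + lam y k))" by (rule prod.cong) auto
  also have "\<dots> = (-1) ^ CARD('n) * (\<Prod>k\<in>UNIV. 1 + lam y k)" by (simp only: prod.distrib prod_constant)
  finally show "det (mat 1 + matrix (B y)) = (\<Prod>k\<in>UNIV. 1 + lam y k)" by simp
qed

lemma det_B_pos:
  assumes y: "y \<in> V"
  shows "det (mat 1 - matrix (B y)) > 0" "det (mat 1 + matrix (B y)) > 0"
  unfolding det_B[OF y] using small[OF y] by (auto intro!: prod_pos simp: less_diff_eq)
    (smt (verit))

text \<open>The individual eigenvalues may be labelled discontinuously in y; only this symmetric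
  expression can be differentiated.\<close>

lemma sum_artanh:
  assumes y: "y \<in> V"
  shows "(\<Sum>k\<in>UNIV. artanh (lam y k)) =
    ln (det (mat 1 + matrix (B y)) / det (mat 1 - matrix (B y))) / 2"
proof -
  have "(\<Sum>k\<in>UNIV. artanh (lam y k)) = (\<Sum>k\<in>UNIV. ln ((1 + lam y k) / (1 - lam y k))) / 2"
    by (simp add: artanh_def sum_divide_distrib)
  also have "(\<Sum>k\<in>UNIV. ln ((1 + lam y k) / (1 - lam y k))) = ln (\<Prod>k\<in>UNIV. (1 + lam y k) / (1 - lam y k))"
  proof (rule ln_prod[symmetric])
    show "(1 + lam y k) / (1 - lam y k) \<noteq> 0" for k using small[OF y, of k] by simp
  qed simp
  finally show ?thesis by (simp add: det_B[OF y] prod_dividef)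
qed

lemma inverse_matrices:
  assumes y: "y \<in> V"
  obtains P Q where "P ** (mat 1 + matrix (B y)) = mat 1" "Q ** (mat 1 - matrix (B y)) = mat 1"
proof -
  have "invertible (mat 1 + matrix (B y))" "invertible (mat 1 - matrix (B y))"
    using det_B_pos[OF y] by (simp_all add: invertible_det_nz)
  then show ?thesis using that unfolding invertible_def by metis
qed

text \<open>Factor 1 - B^2 as (1 + B)(1 - B) and cancel the two invertible factors in turn.\<close>

lemma one_minus_B2_inj:
  assumes y: "y \<in> V" and a: "a = B y (B y a)"
  shows "a = 0"
proof -
  obtain P Q where P: "P ** (mat 1 + matrix (B y)) = mat 1" and Q: "Q ** (mat 1 - matrix (B y)) = mat 1"
    by (rule inverse_matrices[OF y])
  let ?c = "(mat 1 - matrix (B y)) *v a"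
  have "(mat 1 + matrix (B y)) *v ?c = a - B y (B y a)"
    by (simp add: matrix_vector_mult_diff_rdistrib matrix_vector_mult_add_rdistrib matrix_B[OF y]
        linear_diff[OF linear_B[OF y]])
  then have "(mat 1 + matrix (B y)) *v ?c = 0" using a by simp
  then have "?c = 0"
    using matrix_vector_mul_assoc[of P "mat 1 + matrix (B y)" ?c] by (simp add: P)
  then show ?thesis
    using matrix_vector_mul_assoc[of Q "mat 1 - matrix (B y)" a] by (simp add: Q)
qed

lemma one_minus_B2_surj:
  assumes y: "y \<in> V"
  obtains b where "b - B y (B y b) = c"
proof -
  have lin: "linear (\<lambda>b. b - B y (B y b))"
    using linear_compose[OF linear_B[OF y] linear_B[OF y]]
    by (intro linear_compose_sub linear_ident) (simp add: o_def)
  have "inj (\<lambda>b. b - B y (B y b))"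
    unfolding linear_injective_0[OF lin] using one_minus_B2_inj[OF y] by auto
  then have "surj (\<lambda>b. b - B y (B y b))" using lin linear_injective_imp_surjective by blast
  then have "c \<in> range (\<lambda>b. b - B y (B y b))" by (rule ssubst) (rule UNIV_I)
  then show ?thesis using that by (elim imageE) simp
qed

definition lift :: "real ^ 'n \<Rightarrow> 'n minkowski \<times> 'n minkowski" where "lift y = (f y, N y)"

lemma smooth_lift: "smooth_on V lift"
  unfolding lift_def[abs_def] by (rule smooth_on_Pair[OF open_V smooth_f smooth_N])

lemma lift_unit: "y \<in> V \<Longrightarrow> lift y \<in> unit_tangent"
  by (simp add: lift_def unit)

lemma lift_deriv: "y \<in> V \<Longrightarrow> \<partial> lift y a = (\<partial> f y a, - \<partial> f y (B y a))"
  unfolding lift_def[abs_def]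
  by (simp add: has_derivative_eq_frechet[OF has_derivative_Pair[OF f_deriv N_deriv]] shape)

lemma lift_second_deriv:
  assumes y: "y \<in> V"
  shows "\<partial> (\<lambda>y. \<partial> lift y b) y a = (\<partial> (\<lambda>y. \<partial> f y b) y a, \<partial> (\<lambda>y. \<partial> N y b) y a)"
proof (rule fun_cong[OF has_derivative_eq_frechet])
  show "((\<lambda>y. \<partial> lift y b) has_derivative (\<lambda>a. (\<partial> (\<lambda>y. \<partial> f y b) y a, \<partial> (\<lambda>y. \<partial> N y b) y a))) (at y)"
    by (rule has_derivative_transform_within_open[OF has_derivative_Pair[OF df_deriv[OF y] dN_deriv[OF y]] open_V y])
      (simp add: lift_deriv shape)
qed

lemma lift_contact: "y \<in> V \<Longrightarrow> \<partial> lift y a \<in> contact (lift y)"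
  by (simp add: lift_deriv contact_def lift_def df_normal)

lemma lift_horizontal: "y \<in> V \<Longrightarrow> chi_part (lift y) (\<partial> lift y a) = 0"
  by (simp add: lift_deriv chi_part_def lift_def df_normal)

lemma lift_lagrangian: "y \<in> V \<Longrightarrow> pmink (\<partial> lift y a) (para_J (\<partial> lift y b)) = 0"
  using B_self_adjoint[of y a b] by (simp add: lift_deriv pmink_def para_J_def)

lemma linear_lift_deriv: "y \<in> V \<Longrightarrow> linear (\<partial> lift y)"
  by (rule has_derivative_linear[OF smooth_on_has_derivative[OF smooth_lift]])

text \<open>The first minus the third fundamental form.\<close>

lemma lift_metric:
  "y \<in> V \<Longrightarrow> pmink (\<partial> lift y a) (\<partial> lift y b) = mink (\<partial> f y (a - B y (B y a))) (\<partial> f y b)"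
  using B_self_adjoint[of y "B y a" b]
  by (simp add: lift_deriv pmink_def linear_diff[OF linear_df] mink_simps)

lemma lift_metric_nondegenerate:
  assumes y: "y \<in> V" and 0: "\<And>b. pmink (\<partial> lift y a) (\<partial> lift y b) = 0"
  shows "a = 0"
proof -
  have "a - B y (B y a) = 0"
    by (rule first_form_nondegenerate[OF y]) (use 0 lift_metric[OF y] in simp)
  then show ?thesis using one_minus_B2_inj[OF y] by simp
qed

lemma contact_decomposition:
  assumes y: "y \<in> V" and w: "w \<in> contact (lift y)"
  obtains a b where "w = \<partial> lift y a + para_J (\<partial> lift y b)"
proof -
  have "fst w \<in> range (\<partial> f y)" "snd w \<in> range (\<partial> f y)"
    using w by (auto intro!: spanning[OF y] simp: contact_def lift_def mink_sym)
  then obtain c d where "fst w = \<partial> f y c" "snd w = \<partial> f y d" by blast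
  then have w': "w = (\<partial> f y c, \<partial> f y d)" by (simp add: prod_eq_iff)
  \<comment> \<open>The two entries require c = a - B b and d = b - B a; eliminating a gives this
    equation for b, with a = c + B b.\<close>
  obtain b where b: "b - B y (B y b) = d + B y c" by (rule one_minus_B2_surj[OF y])
  have "w = \<partial> lift y (c + B y b) + para_J (\<partial> lift y b)"
  proof -
    have "d = b - B y (c + B y b)" using b by (simp add: linear_add[OF linear_B[OF y]] algebra_simps)
    then show ?thesis
      by (simp add: w' lift_deriv[OF y] para_J_def linear_add[OF linear_df[OF y]] linear_diff[OF linear_df[OF y]])
  qed
  then show ?thesis by (rule that)
qed

text \<open>The second fundamental form of the lift as a cubic form: the normal space is the image of the
  tangent space by \<open>para_J\<close>.\<close>

definition cubic :: "real ^ 'n \<Rightarrow> real ^ 'n \<Rightarrow> real ^ 'n \<Rightarrow> real ^ 'n \<Rightarrow> real" where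
  "cubic y a b c = pmink (\<partial> (\<lambda>y. \<partial> lift y b) y a) (para_J (\<partial> lift y c))"

text \<open>The first symmetry is that of second derivatives; the second comes from differentiating
  the Lagrangian condition and using that \<open>para_J\<close> is skew. Together they contain the
  Codazzi equation.\<close>

lemma cubic_symmetric:
  assumes y: "y \<in> V"
  shows "cubic y a b c = cubic y b a c" "cubic y a b c = cubic y a c b"
proof -
  show "cubic y a b c = cubic y b a c"
    by (simp add: cubic_def second_derivative_symmetric[OF smooth_lift open_V y, of a b])
  have d: "((\<lambda>y. \<partial> lift y b) has_derivative \<partial> (\<lambda>y. \<partial> lift y b) y) (at y)" for b
    by (rule smooth_on_has_derivative[OF smooth_on_frechet_derivative[OF smooth_lift] y])
  note bb = bilinear_conv_bounded_bilinear[THEN iffD1, OF bilinear_pmink]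
  note dJ = bounded_linear.has_derivative[OF linear_conv_bounded_linear[THEN iffD1, OF linear_para_J] d]
  have "((\<lambda>y. 0) has_derivative (\<lambda>a. pmink (\<partial> lift y b) (para_J (\<partial> (\<lambda>y. \<partial> lift y c) y a)) +
      pmink (\<partial> (\<lambda>y. \<partial> lift y b) y a) (para_J (\<partial> lift y c)))) (at y)"
    by (rule has_derivative_transform_within_open[OF bounded_bilinear.FDERIV[OF bb d dJ] open_V y])
      (simp add: lift_lagrangian)
  from fun_cong[OF has_derivative_unique[OF this has_derivative_const], of a]
  have "cubic y a b c = - pmink (\<partial> lift y b) (para_J (\<partial> (\<lambda>y. \<partial> lift y c) y a))"
    by (simp add: cubic_def)
  also have "\<dots> = cubic y a c b"
    unfolding cubic_def using pmink_para_J(2) pmink_sym by metis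
  finally show "cubic y a b c = cubic y a c b" .
qed

definition lift_gram :: "real ^ 'n \<Rightarrow> real ^ 'n ^ 'n" where
  "lift_gram y = (\<chi> i j. pmink (\<partial> lift y (axis i 1)) (\<partial> lift y (axis j 1)))"

definition cubic_mat :: "real ^ 'n \<Rightarrow> real ^ 'n \<Rightarrow> real ^ 'n ^ 'n" where
  "cubic_mat y a = (\<chi> i j. cubic y a (axis i 1) (axis j 1))"

end

lemma has_derivative_ln_ratio:
  fixes p q :: "'a::real_normed_vector \<Rightarrow> real"
  assumes "(p has_derivative (\<lambda>a. p x * u a)) (at x)" "(q has_derivative (\<lambda>a. q x * v a)) (at x)"
    and pos: "p x / q x > 0"
  shows "((\<lambda>y. ln (p y / q y)) has_derivative (\<lambda>a. u a - v a)) (at x)"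
proof -
  have "p x \<noteq> 0" and q: "q x \<noteq> 0" using pos by auto
  then show ?thesis
    by (intro has_derivative_eq_rhs[OF DERIV_compose_FDERIV[OF DERIV_ln[OF pos]
          has_derivative_divide'[OF assms(1,2) q]]]) (simp add: fun_eq_iff field_simps)
qed

context hypersurface
begin

definition first_mat :: "real ^ 'n \<Rightarrow> real ^ 'n ^ 'n" where
  "first_mat y = (\<chi> i j. mink (\<partial> f y (axis i 1)) (\<partial> f y (axis j 1)))"

text \<open>Written with the derivative of N, whose entries are visibly differentiable, whereas B is
  only given pointwise.\<close>

definition second_mat :: "real ^ 'n \<Rightarrow> real ^ 'n ^ 'n" where
  "second_mat y = (\<chi> i j. - mink (\<partial> f y (axis i 1)) (\<partial> N y (axis j 1)))"

lemma sum_matrix_B: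
  fixes \<phi> :: "real ^ 'n \<Rightarrow> real"
  assumes "linear \<phi>"
  shows "(\<Sum>l\<in>UNIV. \<phi> (axis l 1) * matrix (B y) $ l $ j) = \<phi> (B y (axis j 1))"
proof -
  have "B y (axis j 1) = (\<Sum>l\<in>UNIV. (B y (axis j 1) $ l) *\<^sub>R axis l 1)"
    by (simp add: vec_eq_iff axis_def if_distrib[where f = "\<lambda>t. _ * t"] cong: if_cong)
  from arg_cong[OF this, of \<phi>]
  have "\<phi> (B y (axis j 1)) = (\<Sum>l\<in>UNIV. (B y (axis j 1) $ l) *\<^sub>R \<phi> (axis l 1))"
    by (simp only: linear_sum[OF assms] linear_scale[OF assms])
  then show ?thesis by (simp add: matrix_def mult.commute)
qed

lemma linear_mink_df: "y \<in> V \<Longrightarrow> linear (\<lambda>a. mink w (\<partial> f y a))"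
  by (rule linearI) (simp_all add: linear_add[OF linear_df] linear_scale[OF linear_df] mink_simps)

lemma second_mat_eq: "y \<in> V \<Longrightarrow> second_mat y = first_mat y ** matrix (B y)"
  using sum_matrix_B[OF linear_mink_df]
  by (simp add: vec_eq_iff matrix_matrix_mult_def first_mat_def second_mat_def shape)

lemma first_mat_B_symmetric: "y \<in> V \<Longrightarrow> transpose (matrix (B y)) ** first_mat y = first_mat y ** matrix (B y)"
proof -
  assume y: "y \<in> V"
  have "(transpose (matrix (B y)) ** first_mat y) $ i $ j = (first_mat y ** matrix (B y)) $ j $ i" for i j
    by (simp add: matrix_matrix_mult_def transpose_def first_mat_def mink_sym mult.commute)
  moreover have "(first_mat y ** matrix (B y)) $ j $ i = (first_mat y ** matrix (B y)) $ i $ j" for i j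
    unfolding second_mat_eq[OF y, symmetric]
    using B_self_adjoint[OF y] by (simp add: second_mat_def shape[OF y]) (metis mink_sym)
  ultimately show ?thesis by (simp add: vec_eq_iff)
qed

lemma first_mat_left_inverse:
  assumes y: "y \<in> V"
  obtains R where "R ** first_mat y = mat 1"
proof -
  have "c = 0" if c: "first_mat y *v c = 0" for c
  proof (rule first_form_nondegenerate[OF y])
    have lin: "linear (\<lambda>b. mink (\<partial> f y c) (\<partial> f y b))" by (rule linear_mink_df[OF y])
    have ex: "b = (\<Sum>l\<in>UNIV. (b $ l) *\<^sub>R axis l 1)" for b :: "real ^ 'n"
      by (simp add: vec_eq_iff axis_def if_distrib[where f = "\<lambda>t. _ * t"] cong: if_cong)
    have exp: "\<phi> b = (\<Sum>l\<in>UNIV. b $ l * \<phi> (axis l 1))" if "linear \<phi>" for \<phi> :: "real ^ 'n \<Rightarrow> real" and b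
      by (subst (1) ex) (simp only: linear_sum[OF that] linear_scale[OF that] real_scaleR_def)
    have "mink (\<partial> f y (axis i 1)) (\<partial> f y c) = (first_mat y *v c) $ i" for i
      by (subst exp[OF linear_mink_df[OF y], of _ c]) (simp add: matrix_vector_mult_def first_mat_def mult.commute)
    then have "mink (\<partial> f y c) (\<partial> f y (axis i 1)) = 0" for i using c by (simp add: mink_sym)
    then show "mink (\<partial> f y c) (\<partial> f y b) = 0" for b by (subst exp[OF lin, of b]) simp
  qed
  then show ?thesis using that matrix_left_invertible_ker by blast
qed

lemma lift_gram_eq:
  assumes y: "y \<in> V"
  shows "lift_gram y = first_mat y ** ((mat 1 - matrix (B y)) ** (mat 1 + matrix (B y)))"
proof -
  let ?B = "matrix (B y)"
  have lin: "linear (\<lambda>b. mink w (\<partial> f y (B y b)))" for w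
    using linear_compose[OF linear_B[OF y] linear_mink_df[OF y]] by (simp add: o_def)
  have "(first_mat y ** ?B ** ?B) $ i $ j = mink (\<partial> f y (axis i 1)) (\<partial> f y (B y (B y (axis j 1))))" for i j
    using sum_matrix_B[OF lin] unfolding second_mat_eq[OF y, symmetric]
    by (simp add: matrix_matrix_mult_def second_mat_def shape[OF y])
  then have "lift_gram y = first_mat y - first_mat y ** ?B ** ?B"
    using B_self_adjoint[OF y]
    by (simp add: vec_eq_iff lift_gram_def lift_metric[OF y] first_mat_def linear_diff[OF linear_df[OF y]] mink_simps)
  then show ?thesis
    by (simp add: matrix_mult_add_diff matrix_mult_diff_right matrix_add_ldistrib matrix_mul_assoc)
qed

text \<open>The ratio of det (1 + B) to det (1 - B) equals that of det (I + II) to det (I - II),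
  with I and II the matrices \<open>first_mat\<close> and \<open>second_mat\<close>, since det I
  cancels. The latter ratio is differentiated by Jacobi's formula, and the 1/2 in artanh absorbs the
  factor 2 of \<open>trace_log_det_ratio\<close>.\<close>

lemma has_derivative_sum_artanh:
  assumes x: "x \<in> V"
  shows "((\<lambda>y. \<Sum>k\<in>UNIV. artanh (lam y k)) has_derivative
    (\<lambda>a. trace (matrix_inv (lift_gram x) ** cubic_mat x a))) (at x)"
proof -
  let ?B = "matrix (B x)"
  obtain P Q where P: "P ** (mat 1 + ?B) = mat 1" and Q: "Q ** (mat 1 - ?B) = mat 1"
    by (rule inverse_matrices[OF x])
  obtain R where R: "R ** first_mat x = mat 1" by (rule first_mat_left_inverse[OF x])
  define K where "K a = (\<chi> i j. mink (\<partial> (\<lambda>y. \<partial> f y (axis i 1)) x a) (\<partial> f x (axis j 1)))" for a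
  define H' where "H' a = (\<chi> i j. - (mink (\<partial> f x (axis i 1)) (\<partial> (\<lambda>y. \<partial> N y (axis j 1)) x a) +
      mink (\<partial> (\<lambda>y. \<partial> f y (axis i 1)) x a) (\<partial> N x (axis j 1))))" for a
  note md = bounded_bilinear.FDERIV[OF bounded_bilinear_mink]
  have dG: "((\<lambda>y. first_mat y $ i $ j) has_derivative (\<lambda>a. (K a + transpose (K a)) $ i $ j)) (at x)" for i j
    using md[OF df_deriv[OF x, of "axis i 1"] df_deriv[OF x, of "axis j 1"]]
    by (simp add: first_mat_def K_def transpose_def mink_sym add.commute)
  have dH: "((\<lambda>y. second_mat y $ i $ j) has_derivative (\<lambda>a. H' a $ i $ j)) (at x)" for i j
    using has_derivative_minus[OF md[OF df_deriv[OF x, of "axis i 1"] dN_deriv[OF x, of "axis j 1"]]]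
    by (simp add: second_mat_def H'_def)
  have cub: "cubic_mat x a = H' a - K a ** ?B - transpose ?B ** transpose (K a)" for a
  proof -
    have KB: "(K a ** ?B) $ i $ j = - mink (\<partial> (\<lambda>y. \<partial> f y (axis i 1)) x a) (\<partial> N x (axis j 1))" for i j
      using sum_matrix_B[OF linear_mink_df[OF x]] by (simp add: matrix_matrix_mult_def K_def shape[OF x])
    have "transpose ?B ** transpose (K a) = transpose (K a ** ?B)" by (simp add: matrix_transpose_mul)
    then have "(transpose ?B ** transpose (K a)) $ i $ j = (K a ** ?B) $ j $ i" for i j
      by (simp add: transpose_def)
    \<comment> \<open>The last two slots are exchanged so that the second derivative of N falls on
      the index j, as it does in \<open>H'\<close>.\<close>
    moreover have "cubic_mat x a $ i $ j = cubic x a (axis j 1) (axis i 1)" for i j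
      using cubic_symmetric(2)[OF x] by (simp add: cubic_mat_def)
    then have "cubic_mat x a $ i $ j = mink (\<partial> (\<lambda>y. \<partial> f y (axis j 1)) x a) (\<partial> N x (axis i 1)) -
        mink (\<partial> (\<lambda>y. \<partial> N y (axis j 1)) x a) (\<partial> f x (axis i 1))" for i j
      by (simp add: cubic_def lift_second_deriv[OF x] lift_deriv[OF x] pmink_def para_J_def shape[OF x])
    ultimately show ?thesis by (simp add: vec_eq_iff H'_def KB mink_sym)
  qed
  have pq: "det (first_mat y + second_mat y) = det (first_mat y) * det (mat 1 + matrix (B y))"
    "det (first_mat y - second_mat y) = det (first_mat y) * det (mat 1 - matrix (B y))"
    "det (first_mat y) \<noteq> 0" if y: "y \<in> V" for y
  proof -
    have "first_mat y + second_mat y = first_mat y ** (mat 1 + matrix (B y))"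
      "first_mat y - second_mat y = first_mat y ** (mat 1 - matrix (B y))"
      by (simp_all add: second_mat_eq[OF y] matrix_add_ldistrib matrix_mult_diff_right)
    then show "det (first_mat y + second_mat y) = det (first_mat y) * det (mat 1 + matrix (B y))"
      "det (first_mat y - second_mat y) = det (first_mat y) * det (mat 1 - matrix (B y))"
      by (simp_all add: det_mul)
    obtain R where "R ** first_mat y = mat 1" by (rule first_mat_left_inverse[OF y])
    then have "det R * det (first_mat y) = 1" by (metis det_I det_mul)
    then show "det (first_mat y) \<noteq> 0" by auto
  qed
  let ?p = "\<lambda>y. det (first_mat y + second_mat y)" and ?q = "\<lambda>y. det (first_mat y - second_mat y)"
  have inv: "(P ** R) ** (first_mat x + second_mat x) = mat 1" "(Q ** R) ** (first_mat x - second_mat x) = mat 1"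
  proof -
    have "(P ** R) ** (first_mat x + second_mat x) = P ** (R ** first_mat x) ** (mat 1 + ?B)"
      "(Q ** R) ** (first_mat x - second_mat x) = Q ** (R ** first_mat x) ** (mat 1 - ?B)"
      by (simp_all add: second_mat_eq[OF x] matrix_add_ldistrib matrix_mult_diff_right matrix_mul_assoc)
    then show "(P ** R) ** (first_mat x + second_mat x) = mat 1" "(Q ** R) ** (first_mat x - second_mat x) = mat 1"
      by (simp_all add: R P Q)
  qed
  have dp: "(?p has_derivative (\<lambda>a. ?p x * trace ((P ** R) ** (K a + transpose (K a) + H' a)))) (at x)"
    by (rule has_derivative_det) (use has_derivative_add[OF dG dH] inv(1) in simp_all)
  have dq: "(?q has_derivative (\<lambda>a. ?q x * trace ((Q ** R) ** (K a + transpose (K a) - H' a)))) (at x)"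
    by (rule has_derivative_det) (use has_derivative_diff[OF dG dH] inv(2) in simp_all)
  have pos: "?p x / ?q x > 0"
    using pq[OF x] det_B_pos[OF x] by simp_all
  have "((\<lambda>y. ln (?p y / ?q y) / 2) has_derivative
      (\<lambda>a. trace ((P ** Q ** R) ** cubic_mat x a))) (at x)"
    by (rule has_derivative_eq_rhs[OF has_derivative_divide[OF has_derivative_ln_ratio[OF dp dq pos]
            has_derivative_const]])
      (simp_all add: fun_eq_iff cub trace_log_det_ratio[OF P Q R first_mat_B_symmetric[OF x]])
  then have "((\<lambda>y. \<Sum>k\<in>UNIV. artanh (lam y k)) has_derivative
      (\<lambda>a. trace ((P ** Q ** R) ** cubic_mat x a))) (at x)"
    by (rule has_derivative_transform_within_open[OF _ open_V x])
      (use det_B_pos in \<open>simp add: pq sum_artanh\<close>)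
  moreover have "matrix_inv (lift_gram x) = P ** Q ** R"
  proof (rule matrix_inv_eqI)
    have "P ** Q ** R ** lift_gram x = P ** (Q ** (R ** first_mat x) ** (mat 1 - ?B)) ** (mat 1 + ?B)"
      by (simp add: lift_gram_eq[OF x] matrix_mul_assoc)
    then show "P ** Q ** R ** lift_gram x = mat 1" by (simp add: P Q R)
  qed
  ultimately show ?thesis by simp
qed

end

section \<open>Second fundamental form and mean curvature of the Gauss map in coordinates\<close>

lemma normal_part_eqI:
  assumes "\<And>a. g (F y) w (\<partial> F y a) = 0" "v - w \<in> range (\<partial> F y)" "linear (\<partial> F y)"
    and lin: "\<And>a b c. g (F y) (a - b) c = g (F y) a c - g (F y) b c"
    and nondeg: "\<And>a. (\<And>b. g (F y) (\<partial> F y a) (\<partial> F y b) = 0) \<Longrightarrow> \<partial> F y a = 0"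
  shows "normal_part g F y v = w"
  unfolding normal_part_def
proof (rule the_equality)
  fix w' assume w': "(\<forall>a. g (F y) w' (\<partial> F y a) = 0) \<and> v - w' \<in> range (\<partial> F y)"
  then obtain a b where "v - w = \<partial> F y a" "v - w' = \<partial> F y b" using assms(2) by blast
  then have d: "w' - w = \<partial> F y (a - b)" by (simp add: linear_diff[OF assms(3)] algebra_simps)
  have "\<partial> F y (a - b) = 0"
    by (rule nondeg) (use w' assms(1) in \<open>simp add: d[symmetric] lin\<close>)
  then show "w' = w" using d by simp
qed (use assms in auto)

locale gauss_lift = geod_param Om s + hypersurface V f N B lam
  for Om :: "'n::finite geod_coords set" and s and V :: "(real ^ 'n) set"
    and f N :: "real ^ 'n \<Rightarrow> 'n minkowski" and B lam +
  assumes lift_covered: "y \<in> V \<Longrightarrow> geod (lift y) \<in> covered"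
begin

sublocale gm: geod_lift Om s V lift
  by standard (auto intro: open_V smooth_lift lift_unit lift_covered)

abbreviation "met \<equiv> geod_chart_metric s"

lemma met_F:
  assumes "y \<in> V"
  shows "met (gm.F y) a b = pmink (hor_lift s (gm.F y) a) (hor_lift s (gm.F y) b)"
  by (rule geod_chart_metric_eq[OF gm.F_in[OF assms]])

lemma hor_lift_dF: "y \<in> V \<Longrightarrow> hor_lift s (gm.F y) (\<partial> gm.F y a) = geod_flow (gm.shift y) (\<partial> lift y a)"
  by (rule gm.hor_lift_F_horizontal[OF lift_horizontal])

lemma first_fund_F: "y \<in> V \<Longrightarrow> first_fund met gm.F y = lift_gram y"
  by (simp add: vec_eq_iff first_fund_def lift_gram_def met_F hor_lift_dF pmink_geod_flow)

text \<open>The \<open>para_J\<close> summand is orthogonal to tangent vectors by the Lagrangian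
  condition, which the flow preserves; nondegeneracy of the induced metric makes the normal part
  unique.\<close>

lemma normal_part_F:
  assumes y: "y \<in> V"
    and v: "hor_lift s (gm.F y) v = geod_flow (gm.shift y) (\<partial> lift y a + para_J (\<partial> lift y b))"
  shows "hor_lift s (gm.F y) (normal_part met gm.F y v) = geod_flow (gm.shift y) (para_J (\<partial> lift y b))"
proof -
  let ?E = "hor_lift s (gm.F y)" and ?fl = "geod_flow (gm.shift y)"
  note linE = linear_hor_lift[OF gm.F_in[OF y]]
  have "?fl (para_J (\<partial> lift y b)) \<in> contact (s (gm.F y))"
    unfolding gm.s_F[OF y] by (intro contact_geod_flow para_J_contact lift_contact y)
  then obtain w where w: "?E w = ?fl (para_J (\<partial> lift y b))"
    using range_hor_lift[OF gm.F_in[OF y]] by (metis imageE)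
  have "normal_part met gm.F y v = w"
  proof (rule normal_part_eqI)
    show "met (gm.F y) w (\<partial> gm.F y c) = 0" for c
      using lift_lagrangian[OF y, of c b]
      by (simp add: met_F[OF y] w hor_lift_dF[OF y] pmink_geod_flow pmink_sym)
    have "?E (v - w) = ?E (\<partial> gm.F y a)"
      by (simp add: linear_diff[OF linE] v w hor_lift_dF[OF y] linear_add[OF linear_geod_flow])
    then show "v - w \<in> range (\<partial> gm.F y)" using injD[OF inj_hor_lift[OF gm.F_in[OF y]]] by blast
    show "linear (\<partial> gm.F y)" by (rule has_derivative_linear[OF gm.F_deriv[OF y]])
    show "met (gm.F y) (c - d) e = met (gm.F y) c e - met (gm.F y) d e" for c d e
      by (simp add: met_F[OF y] linear_diff[OF linE] pmink_simps)
    show "\<partial> gm.F y c = 0" if "\<And>d. met (gm.F y) (\<partial> gm.F y c) (\<partial> gm.F y d) = 0" for c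
    proof -
      have "c = 0"
        by (rule lift_metric_nondegenerate[OF y])
          (use that in \<open>simp add: met_F[OF y] hor_lift_dF[OF y] pmink_geod_flow\<close>)
      then show ?thesis using linear_0[OF has_derivative_linear[OF gm.F_deriv[OF y]]] by simp
    qed
  qed
  then show ?thesis using w by simp
qed

text \<open>The vector w represents the cubic form for the induced metric; the minus sign appears
  because \<open>para_J\<close> is an anti-isometry.\<close>

lemma second_fund_F:
  assumes y: "y \<in> V"
  obtains w where "hor_lift s (gm.F y) (second_fund met gm.F (\<lambda>_. a) (\<lambda>_. b) y) =
      geod_flow (gm.shift y) (para_J (\<partial> lift y w))"
    "\<And>c. pmink (\<partial> lift y w) (\<partial> lift y c) = - cubic y a b c"
proof -
  let ?Z = "\<partial> (\<lambda>y. \<partial> lift y b) y a"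
  obtain v w where vw: "contact_proj (lift y) ?Z = \<partial> lift y v + para_J (\<partial> lift y w)"
    by (rule contact_decomposition[OF y contact_proj_in_contact[OF lift_unit[OF y]]])
  have "hor_lift s (gm.F y) (cov_deriv met gm.F (\<lambda>y'. \<partial> gm.F y' b) y a) =
      geod_flow (gm.shift y) (\<partial> lift y v + para_J (\<partial> lift y w))"
    unfolding cov_deriv_def vw[symmetric] by (rule gm.hor_lift_connection[OF lift_horizontal y])
  from normal_part_F[OF y this]
  have 1: "hor_lift s (gm.F y) (second_fund met gm.F (\<lambda>_. a) (\<lambda>_. b) y) =
      geod_flow (gm.shift y) (para_J (\<partial> lift y w))"
    by (simp add: second_fund_def)
  have "cubic y a b c = pmink (contact_proj (lift y) ?Z) (para_J (\<partial> lift y c))" for c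
    unfolding cubic_def by (rule pmink_contact_proj[symmetric]) (intro para_J_contact lift_contact y)
  then have "pmink (\<partial> lift y w) (\<partial> lift y c) = - cubic y a b c" for c
    by (simp add: vw pmink_simps lift_lagrangian[OF y] pmink_para_J)
  with 1 show ?thesis by (rule that)
qed

text \<open>The symmetry of the cubic form moves \<open>c\<close> to the slot of the derivative, where
  \<open>has_derivative_sum_artanh\<close> applies.\<close>

lemma mean_curvature_F:
  assumes y: "y \<in> V"
  obtains w where "hor_lift s (gm.F y) (mean_curvature met gm.F y) =
      geod_flow (gm.shift y) (para_J (\<partial> lift y w))"
    "\<And>c. pmink (\<partial> lift y w) (\<partial> lift y c) =
      - \<partial> (\<lambda>y. 1 / real CARD('n) * (\<Sum>k\<in>UNIV. artanh (lam y k))) y c"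
proof -
  let ?n = "1 / real CARD('n)" and ?X = "matrix_inv (lift_gram y)"
  have "\<forall>i j. \<exists>w. hor_lift s (gm.F y) (second_fund met gm.F (\<lambda>_. axis i 1) (\<lambda>_. axis j 1) y) =
      geod_flow (gm.shift y) (para_J (\<partial> lift y w)) \<and>
    (\<forall>c. pmink (\<partial> lift y w) (\<partial> lift y c) = - cubic y (axis i 1) (axis j 1) c)"
    using second_fund_F[OF y] by metis
  then obtain w where w: "\<And>i j. hor_lift s (gm.F y) (second_fund met gm.F (\<lambda>_. axis i 1) (\<lambda>_. axis j 1) y) =
      geod_flow (gm.shift y) (para_J (\<partial> lift y (w i j)))"
    "\<And>i j c. pmink (\<partial> lift y (w i j)) (\<partial> lift y c) = - cubic y (axis i 1) (axis j 1) c" by metis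
  define W where "W = ?n *\<^sub>R (\<Sum>i\<in>UNIV. \<Sum>j\<in>UNIV. ?X $ i $ j *\<^sub>R w i j)"
  note lin = linear_hor_lift[OF gm.F_in[OF y]] linear_geod_flow linear_para_J linear_lift_deriv[OF y]
  have 1: "hor_lift s (gm.F y) (mean_curvature met gm.F y) = geod_flow (gm.shift y) (para_J (\<partial> lift y W))"
    unfolding mean_curvature_def first_fund_F[OF y] W_def by (simp only: lin[THEN linear_scale] lin[THEN linear_sum] w)
  have "pmink (\<partial> lift y W) (\<partial> lift y c) =
      - \<partial> (\<lambda>y. 1 / real CARD('n) * (\<Sum>k\<in>UNIV. artanh (lam y k))) y c" for c
  proof -
    have cub: "cubic y (axis i 1) (axis j 1) c = cubic_mat y c $ j $ i" for i j
      unfolding cubic_mat_def vec_lambda_beta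
      using cubic_symmetric(1)[OF y, of c "axis j 1" "axis i 1"] cubic_symmetric(2)[OF y, of _ c]
        cubic_symmetric(1)[OF y, of "axis i 1" "axis j 1" c] by simp
    have lin': "linear (\<lambda>a. pmink (\<partial> lift y a) (\<partial> lift y c))"
      by (rule linearI) (simp_all add: linear_add[OF lin(4)] linear_scale[OF lin(4)] pmink_simps)
    have "pmink (\<partial> lift y W) (\<partial> lift y c) =
        ?n * (\<Sum>i\<in>UNIV. \<Sum>j\<in>UNIV. ?X $ i $ j * - cubic y (axis i 1) (axis j 1) c)"
      unfolding W_def by (simp only: lin'[THEN linear_scale] lin'[THEN linear_sum] w real_scaleR_def)
    also have "\<dots> = - (?n * (\<Sum>i\<in>UNIV. \<Sum>j\<in>UNIV. ?X $ i $ j * cubic_mat y c $ j $ i))"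
      by (simp add: cub sum_negf)
    also have "\<dots> = - (?n * trace (?X ** cubic_mat y c))"
      by (simp add: trace_def matrix_matrix_mult_def)
    also have "\<dots> = - \<partial> (\<lambda>y. ?n * (\<Sum>k\<in>UNIV. artanh (lam y k))) y c"
      by (simp only: has_derivative_eq_frechet[OF has_derivative_mult_right[OF has_derivative_sum_artanh[OF y]]])
    finally show ?thesis .
  qed
  with 1 show ?thesis by (rule that)
qed

end

section \<open>Evolution of the Gauss map\<close>

text \<open>Allows shrinking a patch to the open part whose Gauss image is covered by a given chart
  of the space of geodesics.\<close>

lemma hypersurface_subset:
  assumes "hypersurface U f N B lam" "open V" "V \<subseteq> U"
  shows "hypersurface V f N B lam"
proof -
  interpret hypersurface U f N B lam by fact
  show ?thesis
    using assms(2,3) smooth_on_subset[OF smooth_f assms(3)] smooth_on_subset[OF smooth_N assms(3)]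
      unit normal spanning inj_df shape eigen small
    unfolding hypersurface_def by blast
qed

lemma has_derivative_slice:
  assumes "(\<Phi> has_derivative D) (at (y, t))"
  shows "((\<lambda>y. \<Phi> (y, t)) has_derivative (\<lambda>a. D (a, 0))) (at y)"
    and "((\<lambda>t. \<Phi> (y, t)) has_derivative (\<lambda>r. D (0, r))) (at t)"
proof -
  have "((\<lambda>y. (y, t)) has_derivative (\<lambda>a. (a, 0))) (at y)" "((\<lambda>t. (y, t)) has_derivative (\<lambda>r. (0, r))) (at t)"
    by (auto intro!: derivative_eq_intros)
  from this[THEN has_derivative_compose] assms
  show "((\<lambda>y. \<Phi> (y, t)) has_derivative (\<lambda>a. D (a, 0))) (at y)"
    "((\<lambda>t. \<Phi> (y, t)) has_derivative (\<lambda>r. D (0, r))) (at t)" by blast+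
qed

lemma smooth_on_slice:
  fixes \<Phi> :: "'a::euclidean_space \<times> 'b::euclidean_space \<Rightarrow> 'c::real_normed_vector"
  assumes "open U" "open I" "smooth_on (U \<times> I) \<Phi>"
  shows "t \<in> I \<Longrightarrow> smooth_on U (\<lambda>y. \<Phi> (y, t))" "y \<in> U \<Longrightarrow> smooth_on I (\<lambda>t. \<Phi> (y, t))"
proof -
  show "smooth_on U (\<lambda>y. \<Phi> (y, t))" if "t \<in> I"
    by (rule smooth_on_compose[OF assms(1) open_Times[OF assms(1,2)] _
          smooth_on_Pair[OF assms(1) smooth_on_ident[OF assms(1)] smooth_on_const[OF assms(1)]] assms(3)])
      (use that in auto)
  show "smooth_on I (\<lambda>t. \<Phi> (y, t))" if "y \<in> U"
    by (rule smooth_on_compose[OF assms(2) open_Times[OF assms(1,2)] _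
          smooth_on_Pair[OF assms(2) smooth_on_const[OF assms(2)] smooth_on_ident[OF assms(2)]] assms(3)])
      (use that in auto)
qed

lemma (in geod_param) open_covered:
  assumes "open V" "continuous_on V \<gamma>" "\<And>y. y \<in> V \<Longrightarrow> \<gamma> y \<in> unit_tangent"
  shows "open {y \<in> V. geod (\<gamma> y) \<in> covered}"
proof (rule Topological_Spaces.openI)
  fix x assume x: "x \<in> {y \<in> V. geod (\<gamma> y) \<in> covered}"
  obtain T h where T: "open T" "\<gamma> x \<in> T"
    "\<And>w. w \<in> T \<Longrightarrow> w \<in> unit_tangent \<Longrightarrow> geod w \<in> covered \<and> h w = coord (geod w)"
    by (rule local_coord[of "\<gamma> x"]) (use assms(3) x in auto)
  have "open (\<gamma> -` T \<inter> V)" using continuous_on_open_vimage[OF assms(1)] assms(2) T(1) by blast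
  moreover have "\<gamma> -` T \<inter> V \<subseteq> {y \<in> V. geod (\<gamma> y) \<in> covered}" using T(3) assms(3) by blast
  moreover have "x \<in> \<gamma> -` T \<inter> V" using x T(2) by simp
  ultimately show "\<exists>T. open T \<and> x \<in> T \<and> T \<subseteq> {y \<in> V. geod (\<gamma> y) \<in> covered}" by blast
qed

text \<open>Time is a coordinate of jointly smooth maps, so that derivatives in time and along the
  hypersurface can be exchanged.\<close>

locale normal_evolution =
  fixes U :: "(real ^ 'n::finite) set" and I :: "real set" and \<Phi> \<Psi> :: "(real ^ 'n) \<times> real \<Rightarrow> 'n minkowski"
    and B :: "real \<Rightarrow> real ^ 'n \<Rightarrow> real ^ 'n \<Rightarrow> real ^ 'n" and lam :: "real \<Rightarrow> real ^ 'n \<Rightarrow> 'n \<Rightarrow> real"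
  assumes open_U: "open U" and open_I: "open I"
    and smooth_\<Phi>: "smooth_on (U \<times> I) \<Phi>" and smooth_\<Psi>: "smooth_on (U \<times> I) \<Psi>"
    and hyper: "t \<in> I \<Longrightarrow> hypersurface U (\<lambda>y. \<Phi> (y, t)) (\<lambda>y. \<Psi> (y, t)) (B t) (lam t)"
    and velocity: "y \<in> U \<Longrightarrow> t \<in> I \<Longrightarrow>
      \<partial> \<Phi> (y, t) (0, 1) = (1 / real CARD('n) * (\<Sum>k\<in>UNIV. artanh (lam t y k))) *\<^sub>R \<Psi> (y, t)"
begin

definition speed :: "real \<Rightarrow> real ^ 'n \<Rightarrow> real" where
  "speed t y = 1 / real CARD('n) * (\<Sum>k\<in>UNIV. artanh (lam t y k))"

lemma \<Phi>_deriv: "y \<in> U \<Longrightarrow> t \<in> I \<Longrightarrow> (\<Phi> has_derivative \<partial> \<Phi> (y, t)) (at (y, t))"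
  and \<Psi>_deriv: "y \<in> U \<Longrightarrow> t \<in> I \<Longrightarrow> (\<Psi> has_derivative \<partial> \<Psi> (y, t)) (at (y, t))"
  by (rule smooth_on_has_derivative[OF smooth_\<Phi>] smooth_on_has_derivative[OF smooth_\<Psi>], simp)+

lemma slice_deriv:
  assumes "y \<in> U" "t \<in> I"
  shows "\<partial> (\<lambda>y. \<Phi> (y, t)) y a = \<partial> \<Phi> (y, t) (a, 0)"
  by (simp add: has_derivative_eq_frechet[OF has_derivative_slice(1)[OF \<Phi>_deriv[OF assms]]])

lemma velocity_speed: "y \<in> U \<Longrightarrow> t \<in> I \<Longrightarrow> \<partial> \<Phi> (y, t) (0, 1) = speed t y *\<^sub>R \<Psi> (y, t)"
  unfolding speed_def by (rule velocity)

text \<open>The first two products come from the constraints on unit tangent vectors. For the third,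
  the orthogonality of tangent vectors and normal is differentiated in time, the mixed derivatives
  are exchanged, and the velocity is inserted; only the derivative of the speed survives the product
  with the normal.\<close>

lemma normal_derivative:
  assumes y: "y \<in> U" and t: "t \<in> I"
  shows "mink (\<partial> \<Psi> (y, t) (0, 1)) (\<Psi> (y, t)) = 0"
    "mink (\<partial> \<Psi> (y, t) (0, 1)) (\<Phi> (y, t)) = - speed t y"
    "mink (\<partial> \<Psi> (y, t) (0, 1)) (\<partial> \<Phi> (y, t) (a, 0)) = - \<partial> (speed t) y a"
proof -
  interpret hypersurface U "\<lambda>y. \<Phi> (y, t)" "\<lambda>y. \<Psi> (y, t)" "B t" "lam t" by (rule hyper[OF t])
  have unit': "(\<Phi> (y, r), \<Psi> (y, r)) \<in> unit_tangent" if "y \<in> U" "r \<in> I" for y r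
    using hypersurface.unit[OF hyper] that by blast
  have "((\<lambda>r. (\<Phi> (y, r), \<Psi> (y, r))) has_derivative (\<lambda>r. (\<partial> \<Phi> (y, t) (0, r), \<partial> \<Psi> (y, t) (0, r)))) (at t)"
    by (intro has_derivative_Pair has_derivative_slice(2) \<Phi>_deriv \<Psi>_deriv y t)
  then have "(\<partial> \<Phi> (y, t) (0, 1), \<partial> \<Psi> (y, t) (0, 1)) \<in> tangent_T1 (\<Phi> (y, t), \<Psi> (y, t))"
    using tangent_T1_derivative[OF open_I t, of "\<lambda>r. (\<Phi> (y, r), \<Psi> (y, r))"] unit'[OF y] by blast
  then show "mink (\<partial> \<Psi> (y, t) (0, 1)) (\<Psi> (y, t)) = 0"
    "mink (\<partial> \<Psi> (y, t) (0, 1)) (\<Phi> (y, t)) = - speed t y"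
    using unit_tangentD(4)[OF unit[OF y]]
    by (auto simp: tangent_T1_def velocity_speed[OF y t] mink_simps mink_sym)
  define D where "D = \<partial> (\<lambda>z. \<partial> \<Phi> z (a, 0)) (y, t)"
  define E where "E = \<partial> (\<lambda>z. \<partial> \<Phi> z (0, 1)) (y, t)"
  have D: "((\<lambda>z. \<partial> \<Phi> z (a, 0)) has_derivative D) (at (y, t))"
    and E: "((\<lambda>z. \<partial> \<Phi> z (0, 1)) has_derivative E) (at (y, t))"
    unfolding D_def E_def
    by (rule smooth_on_has_derivative[OF smooth_on_frechet_derivative[OF smooth_\<Phi>]]; use y t in simp)+
  have DE: "D (0, 1) = E (a, 0)"
    unfolding D_def E_def
    by (rule second_derivative_symmetric[OF smooth_\<Phi> open_Times[OF open_U open_I]]) (use y t in simp)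
  have "((\<lambda>r. 0) has_derivative (\<lambda>r. mink (\<partial> \<Phi> (y, t) (a, 0)) (\<partial> \<Psi> (y, t) (0, r)) +
      mink (D (0, r)) (\<Psi> (y, t)))) (at t)"
  proof (rule has_derivative_transform_within_open[OF bounded_bilinear.FDERIV[OF bounded_bilinear_mink
          has_derivative_slice(2)[OF D] has_derivative_slice(2)[OF \<Psi>_deriv[OF y t]]] open_I t])
    show "mink (\<partial> \<Phi> (y, r) (a, 0)) (\<Psi> (y, r)) = 0" if "r \<in> I" for r
      using hypersurface.normal[OF hyper[OF that] y, of a] slice_deriv[OF y that] by simp
  qed
  from fun_cong[OF has_derivative_unique[OF this has_derivative_const], of 1]
  have 1: "mink (\<partial> \<Psi> (y, t) (0, 1)) (\<partial> \<Phi> (y, t) (a, 0)) = - mink (E (a, 0)) (\<Psi> (y, t))"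
    by (simp add: DE mink_sym)
  have sp: "(speed t has_derivative \<partial> (speed t) y) (at y)"
    using has_derivative_mult_right[OF has_derivative_sum_artanh[OF y], of "1 / real CARD('n)"]
      has_derivative_eq_frechet unfolding speed_def[abs_def] by metis
  have "((\<lambda>y. \<partial> \<Phi> (y, t) (0, 1)) has_derivative
      (\<lambda>a. speed t y *\<^sub>R \<partial> (\<lambda>y. \<Psi> (y, t)) y a + \<partial> (speed t) y a *\<^sub>R \<Psi> (y, t))) (at y)"
    by (rule has_derivative_transform_within_open[OF has_derivative_scaleR[OF sp N_deriv[OF y]] open_U y])
      (simp add: velocity_speed[OF _ t])
  from fun_cong[OF has_derivative_unique[OF has_derivative_slice(1)[OF E] this], of a]
  have "E (a, 0) = speed t y *\<^sub>R \<partial> (\<lambda>y. \<Psi> (y, t)) y a + \<partial> (speed t) y a *\<^sub>R \<Psi> (y, t)" .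
  moreover have "mink (\<partial> (\<lambda>y. \<Psi> (y, t)) y a) (\<Psi> (y, t)) = 0"
    by (simp add: shape[OF y] df_normal[OF y])
  ultimately show "mink (\<partial> \<Psi> (y, t) (0, 1)) (\<partial> \<Phi> (y, t) (a, 0)) = - \<partial> (speed t) y a"
    unfolding 1 using unit_tangentD(4)[OF unit[OF y]] by (simp add: mink_simps)
qed

text \<open>The vector w represents minus the differential of the speed for the metric induced by
  the Gauss map. Both claims are compared through horizontal lifts, which determine coordinate
  vectors by injectivity.\<close>

lemma gauss_map_evolution:
  fixes Om :: "'n geod_coords set" and s
  defines "F \<equiv> \<lambda>t y. geod_coord Om s (geod (\<Phi> (y, t), \<Psi> (y, t)))"
  assumes chart: "geod_chart Om s" and x: "x \<in> U" and t: "t \<in> I"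
    and cov: "geod (\<Phi> (x, t), \<Psi> (x, t)) \<in> (\<lambda>u. geod (s u)) ` Om"
  obtains w where
    "hor_lift s (F t x) (\<partial> (F t) x w) = para_J (hor_lift s (F t x) (mean_curvature (geod_chart_metric s) (F t) x))"
    "((\<lambda>r. F r x) has_vector_derivative
       (mean_curvature (geod_chart_metric s) (F t) x + \<partial> (F t) x (B t x w))) (at t)"
proof -
  interpret geod_param Om s by standard (rule chart)
  have unit': "(\<Phi> (y, r), \<Psi> (y, r)) \<in> unit_tangent" if "y \<in> U" "r \<in> I" for y r
    using hypersurface.unit[OF hyper] that by blast
  define V where "V = {y \<in> U. geod (\<Phi> (y, t), \<Psi> (y, t)) \<in> covered}"
  define T where "T = {r \<in> I. geod (\<Phi> (x, r), \<Psi> (x, r)) \<in> covered}"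
  have smT: "smooth_on I (\<lambda>r. (\<Phi> (x, r), \<Psi> (x, r)))"
    by (intro smooth_on_Pair open_I smooth_on_slice(2)[OF open_U open_I] smooth_\<Phi> smooth_\<Psi> x)
  have "open V"
    unfolding V_def by (intro open_covered open_U unit' t smooth_on_imp_continuous_on smooth_on_Pair
        hypersurface.smooth_f[OF hyper[OF t]] hypersurface.smooth_N[OF hyper[OF t]])
  have "open T"
    unfolding T_def by (intro open_covered open_I unit' x smooth_on_imp_continuous_on smT)
  have xV: "x \<in> V" and tT: "t \<in> T" using x t cov by (auto simp: V_def T_def)
  have "hypersurface V (\<lambda>y. \<Phi> (y, t)) (\<lambda>y. \<Psi> (y, t)) (B t) (lam t)"
    by (rule hypersurface_subset[OF hyper[OF t] \<open>open V\<close>]) (auto simp: V_def)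
  then interpret S: hypersurface V "\<lambda>y. \<Phi> (y, t)" "\<lambda>y. \<Psi> (y, t)" "B t" "lam t" .
  interpret G: gauss_lift Om s V "\<lambda>y. \<Phi> (y, t)" "\<lambda>y. \<Psi> (y, t)" "B t" "lam t"
    by standard (simp add: S.lift_def V_def)
  interpret C: geod_lift Om s T "\<lambda>r. (\<Phi> (x, r), \<Psi> (x, r))"
    by standard (use \<open>open T\<close> smooth_on_subset[OF smT] unit'[OF x] in \<open>auto simp: T_def\<close>)
  have FG: "F t = G.gm.F" by (simp add: fun_eq_iff F_def G.gm.F_def S.lift_def)
  have FC: "(\<lambda>r. F r x) = C.F" by (simp add: fun_eq_iff F_def C.F_def)
  have FCx: "C.F t = G.gm.F x" by (simp add: FC[symmetric] FG[symmetric])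
  \<comment> \<open>Both lifts pass through the same unit tangent vector at (x, t), so the same flow
    time carries them to the chart's representative and their horizontal lifts can be
    compared.\<close>
  have shift: "C.shift t = G.gm.shift x" by (simp add: C.shift_def G.gm.shift_def FCx S.lift_def)
  let ?fl = "geod_flow (G.gm.shift x)" and ?E = "hor_lift s (G.gm.F x)"
  let ?H = "mean_curvature (geod_chart_metric s) G.gm.F x"
  obtain w where w: "?E ?H = ?fl (para_J (\<partial> S.lift x w))"
    "\<And>a. pmink (\<partial> S.lift x w) (\<partial> S.lift x a) = - \<partial> (speed t) x a"
    using G.mean_curvature_F[OF xV] unfolding speed_def[abs_def] by metis
  have 1: "?E (\<partial> G.gm.F x w) = para_J (?E ?H)"
    by (simp add: w(1) G.hor_lift_dF[OF xV] para_J_geod_flow)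
  let ?\<Psi>' = "\<partial> \<Psi> (x, t) (0, 1)" and ?f' = "\<partial> (\<lambda>y. \<Phi> (y, t)) x"
  have "((\<lambda>r. (\<Phi> (x, r), \<Psi> (x, r))) has_derivative (\<lambda>r. (\<partial> \<Phi> (x, t) (0, r), \<partial> \<Psi> (x, t) (0, r)))) (at t)"
    by (intro has_derivative_Pair has_derivative_slice(2) \<Phi>_deriv \<Psi>_deriv x t)
  then have "\<partial> (\<lambda>r. (\<Phi> (x, r), \<Psi> (x, r))) t 1 = (speed t x *\<^sub>R \<Psi> (x, t), ?\<Psi>')"
    using velocity_speed[OF x t] by (simp add: has_derivative_eq_frechet)
  \<comment> \<open>The base point moves at rate \<open>speed t x\<close> along the normal, which is
    the \<open>chi\<close> component; removing it leaves a purely vertical vector.\<close>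
  then have "chi_perp (\<Phi> (x, t), \<Psi> (x, t)) (\<partial> (\<lambda>r. (\<Phi> (x, r), \<Psi> (x, r))) t 1) =
      (0, ?\<Psi>' - speed t x *\<^sub>R \<Phi> (x, t))"
    using unit_tangentD(4)[OF unit'[OF x t]]
    by (simp add: chi_perp_eq[OF unit'[OF x t]] chi_part_def para_J_def mink_simps)
  \<comment> \<open>The difference of the two sides is orthogonal to both base vectors, hence
    tangent, and has zero product with all tangent vectors: \<open>w(2)\<close>, read through
    \<open>lift_metric\<close>, matches the third part of \<open>normal_derivative\<close>.\<close>
  moreover have "?\<Psi>' - speed t x *\<^sub>R \<Phi> (x, t) = ?f' (w - B t x (B t x w))"
  proof -
    let ?d = "?\<Psi>' - speed t x *\<^sub>R \<Phi> (x, t) - ?f' (w - B t x (B t x w))"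
    note nd = normal_derivative[OF x t] and un = unit_tangentD[OF unit'[OF x t], simplified]
    have "?d \<in> range ?f'"
      by (rule S.spanning[OF xV]) (simp_all add: mink_simps nd un S.df_normal[OF xV])
    then obtain e where e: "?d = ?f' e" by blast
    have "mink (?f' e) (?f' a) = 0" for a
    proof -
      have "mink (?f' (w - B t x (B t x w))) (?f' a) = - \<partial> (speed t) x a"
        using w(2)[of a] by (simp add: S.lift_metric[OF xV])
      moreover have "mink ?\<Psi>' (?f' a) = - \<partial> (speed t) x a"
        using nd(3)[of a] by (simp add: slice_deriv[OF x t])
      ultimately show ?thesis
        unfolding e[symmetric] by (simp add: mink_simps S.df_normal[OF xV])
    qed
    then have "e = 0" by (rule S.first_form_nondegenerate[OF xV])
    then show ?thesis using e linear_0[OF S.linear_df[OF xV]] by simp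
  qed
  \<comment> \<open>The horizontal entries -df(Bw) and df(Bw) cancel. A purely vertical motion thus
    forces the tangential correction next to the mean curvature vector.\<close>
  moreover have "para_J (\<partial> S.lift x w) + \<partial> S.lift x (B t x w) = (0, ?f' (w - B t x (B t x w)))"
    by (simp add: S.lift_deriv[OF xV] para_J_def linear_diff[OF S.linear_df[OF xV]])
  ultimately have "?E (\<partial> C.F t 1) = ?fl (para_J (\<partial> S.lift x w) + \<partial> S.lift x (B t x w))"
    using C.hor_lift_F[OF tT, of 1] by (simp add: FCx shift)
  also have "\<dots> = ?E (?H + \<partial> G.gm.F x (B t x w))"
    by (simp add: linear_add[OF linear_geod_flow] linear_add[OF linear_hor_lift[OF G.gm.F_in[OF xV]]] w(1)
        G.hor_lift_dF[OF xV])
  finally have "\<partial> C.F t 1 = ?H + \<partial> G.gm.F x (B t x w)"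
    by (rule injD[OF inj_hor_lift[OF G.gm.F_in[OF xV]]])
  moreover have "(C.F has_vector_derivative \<partial> C.F t 1) (at t)"
  proof -
    have lin: "(\<lambda>r. r *\<^sub>R \<partial> C.F t 1) = \<partial> C.F t"
    proof
      show "r *\<^sub>R \<partial> C.F t 1 = \<partial> C.F t r" for r
        using linear_scale[OF has_derivative_linear[OF C.F_deriv[OF tT]], of r 1]
        by (simp only: real_scaleR_def mult_1_right)
    qed
    show ?thesis unfolding has_vector_derivative_def lin by (rule C.F_deriv[OF tT])
  qed
  ultimately have 2: "((\<lambda>r. F r x) has_vector_derivative ?H + \<partial> G.gm.F x (B t x w)) (at t)"
    by (simp add: FC)
  show ?thesis
    by (rule that[of w]) (use 1 2 in \<open>simp_all add: FG\<close>)
qed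

end

section \<open>The unit normal\<close>

text \<open>The transpose of the matrix in \<open>unit_normal\<close>: the vectors are rows, since
  the multilinearity and identical-row rules used for \<open>det\<close> concern rows.\<close>

definition frame :: "'n::finite minkowski \<Rightarrow> 'n minkowski \<Rightarrow> ('n \<Rightarrow> 'n minkowski) \<Rightarrow> real ^ ('n option option) ^ ('n option option)" where
  "frame v x w = (\<chi> j. case j of Some (Some k) \<Rightarrow> w k | Some None \<Rightarrow> v | None \<Rightarrow> x)"

text \<open>The generalised cross product: the vector representing, for \<open>mink\<close>, the
  functional that sends v to \<open>det (frame v x w)\<close>. The sign at \<open>None\<close>
  raises the timelike index.\<close>

definition normal_cross :: "'n::finite minkowski \<Rightarrow> ('n \<Rightarrow> 'n minkowski) \<Rightarrow> 'n minkowski" where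
  "normal_cross x w = (\<chi> i. (if i = None then -1 else 1) * det (frame (axis i 1) x w))"

lemma mink_normal_cross: "mink (normal_cross x w) v = det (frame v x w)"
proof -
  define c where "c j = (case j of Some (Some k) \<Rightarrow> w k | _ \<Rightarrow> x)" for j
  have fr: "frame u x w = (\<chi> j. if j = Some None then u else c j)" for u
    by (auto simp: frame_def c_def vec_eq_iff split: option.split)
  have "v = (\<Sum>i\<in>UNIV. v $ i *s axis i 1)" by (simp add: basis_expansion)
  then have "det (frame v x w) = det (\<chi> j. if j = Some None then (\<Sum>i\<in>UNIV. v $ i *s axis i 1) else c j)"
    using fr by metis
  also have "\<dots> = (\<Sum>i\<in>UNIV. v $ i * det (frame (axis i 1) x w))"
    by (simp add: det_linear_row_sum det_row_mul fr)
  also have "\<dots> = mink (normal_cross x w) v"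
    by (simp add: sum_UNIV_option[of "\<lambda>i. v $ i * det (frame (axis i 1) x w)"] mink_def normal_cross_def mult.commute)
  finally show ?thesis by simp
qed

lemma mink_normal_cross_orthogonal: "mink (normal_cross x w) x = 0" "mink (normal_cross x w) (w k) = 0"
proof -
  have "row (Some None) (frame x x w) = row None (frame x x w)"
    "row (Some None) (frame (w k) x w) = row (Some (Some k)) (frame (w k) x w)"
    by (simp_all add: row_def frame_def)
  from this[THEN det_identical_rows[rotated]]
  show "mink (normal_cross x w) x = 0" "mink (normal_cross x w) (w k) = 0"
    by (simp_all add: mink_normal_cross)
qed

lemma frame_expansion:
  assumes "det (frame v x w) \<noteq> 0"
  obtains a b c where "u = a *\<^sub>R v + b *\<^sub>R x + (\<Sum>k\<in>UNIV. c k *\<^sub>R w k)"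
proof -
  let ?M = "transpose (frame v x w)"
  have "invertible ?M" using assms by (simp add: invertible_det_nz det_transpose)
  then obtain R where "?M ** R = mat 1" by (auto simp: invertible_def)
  then have "?M *v (R *v u) = u" by (simp add: matrix_vector_mul_assoc)
  then have "u = (\<Sum>j\<in>UNIV. (R *v u) $ j *s column j ?M)" by (metis matrix_mult_sum)
  also have "\<dots> = (R *v u) $ Some None *\<^sub>R v + (R *v u) $ None *\<^sub>R x + (\<Sum>k\<in>UNIV. (R *v u) $ Some (Some k) *\<^sub>R w k)"
    by (simp add: sum_UNIV_option column_transpose row_def frame_def scalar_mult_eq_scaleR add_ac)
  finally show ?thesis by (rule that)
qed

lemma frame_span:
  assumes "det (frame v x w) \<noteq> 0" "mink x x = -1" "mink x v = 0" "mink v v = 1"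
    "\<And>k. mink (w k) x = 0" "\<And>k. mink (w k) v = 0" "mink u x = 0" "mink u v = 0"
  obtains c where "u = (\<Sum>k\<in>UNIV. c k *\<^sub>R w k)"
proof -
  obtain a b c where u: "u = a *\<^sub>R v + b *\<^sub>R x + (\<Sum>k\<in>UNIV. c k *\<^sub>R w k)"
    by (rule frame_expansion[OF assms(1)])
  have s: "mink (\<Sum>k\<in>UNIV. c k *\<^sub>R w k) y = (\<Sum>k\<in>UNIV. c k * mink (w k) y)" for y
    using linear_sum[of "\<lambda>u. mink u y" "\<lambda>k. c k *\<^sub>R w k" UNIV] by (simp add: linearI mink_simps)
  have "mink u v = a" "mink u x = - b"
    unfolding u by (simp_all add: mink_simps s assms mink_sym[of v x])
  then show ?thesis using u assms(7,8) by (intro that[of c]) simp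
qed

text \<open>The cross product minus det times v is orthogonal to every vector of the frame, hence
  zero. So its square is det^2, and \<omega> fixes the sign left open by the square root.\<close>

lemma unit_normal_formula:
  assumes \<omega>: "\<omega> \<in> {-1, 1}" and pos: "\<omega> * det (frame v x w) > 0"
    and v: "mink x v = 0" "mink v v = 1" "\<And>k. mink (w k) v = 0"
  shows "mink (normal_cross x w) (normal_cross x w) > 0"
    "v = (\<omega> * mink (normal_cross x w) (normal_cross x w) powr (-1/2)) *\<^sub>R normal_cross x w"
proof -
  let ?n = "normal_cross x w" and ?d = "det (frame v x w)"
  have d: "?d \<noteq> 0" using pos by auto
  have "mink (?n - ?d *\<^sub>R v) u = 0" for u
  proof -
    obtain a b c where u: "u = a *\<^sub>R v + b *\<^sub>R x + (\<Sum>k\<in>UNIV. c k *\<^sub>R w k)"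
      by (rule frame_expansion[OF d])
    have "mink y (\<Sum>k\<in>UNIV. c k *\<^sub>R w k) = (\<Sum>k\<in>UNIV. c k * mink y (w k))" for y
      using linear_sum[of "mink y" "\<lambda>k. c k *\<^sub>R w k" UNIV] by (simp add: linearI mink_simps)
    then show ?thesis
      unfolding u by (simp add: mink_simps mink_normal_cross_orthogonal mink_normal_cross[of x w v] v
          mink_sym[of v x] mink_sym[of v "w k" for k])
  qed
  then have n: "?n = ?d *\<^sub>R v" using mink_nondegenerate by (metis eq_iff_diff_eq_0)
  then have nn: "mink ?n ?n = ?d\<^sup>2" by (simp add: mink_simps v power2_eq_square)
  then show "mink ?n ?n > 0" using d by simp
  have "(?d\<^sup>2) powr (-1/2) = 1 / \<bar>?d\<bar>"
    using d by (simp add: powr_minus_divide powr_half_sqrt)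
  moreover have "\<omega> * ?d = \<bar>?d\<bar>" using \<omega> pos by auto
  ultimately have "\<omega> * (?d\<^sup>2) powr (-1/2) * ?d = 1" using d by simp
  then show "v = (\<omega> * mink ?n ?n powr (-1/2)) *\<^sub>R ?n" unfolding nn by (subst n) simp
qed

lemma smooth_on_normal_cross:
  fixes f :: "'a::euclidean_space \<Rightarrow> 'n::finite minkowski"
  assumes "open S" "smooth_on S f" "\<And>k. smooth_on S (\<lambda>z. g k z)"
  shows "smooth_on S (\<lambda>z. normal_cross (f z) (\<lambda>k. g k z))"
proof (rule smooth_on_vec[OF assms(1)])
  fix i
  have nth: "smooth_on S (\<lambda>z. h z $ j)" if "smooth_on S h" for h :: "'a \<Rightarrow> 'n minkowski" and j
    by (rule smooth_on_bounded_linear_compose[OF assms(1) bounded_linear_vec_nth that])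
  have "smooth_on S (\<lambda>z. frame (axis i 1) (f z) (\<lambda>k. g k z) $ j $ l)" for j l
  proof (cases j)
    case None
    then show ?thesis using nth[OF assms(2)] by (simp add: frame_def)
  next
    case (Some j')
    then show ?thesis
      using nth[OF assms(3)] smooth_on_const[OF assms(1)] by (cases j') (simp_all add: frame_def)
  qed
  then have "smooth_on S (\<lambda>z. det (frame (axis i 1) (f z) (\<lambda>k. g k z)))"
    by (rule smooth_on_det[OF assms(1)])
  then show "smooth_on S (\<lambda>z. normal_cross (f z) (\<lambda>k. g k z) $ i)"
    unfolding normal_cross_def vec_lambda_beta
    by (rule smooth_on_bounded_linear_compose[OF assms(1) bounded_linear_mult_right])
qed

text \<open>Orientation pins the normal down pointwise, and the resulting formula is smooth in the
  position and the tangent frame.\<close>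

lemma smooth_on_unit_normal:
  fixes f :: "'a::euclidean_space \<Rightarrow> 'n::finite minkowski"
  assumes "open S" "smooth_on S f" "\<And>k. smooth_on S (\<lambda>z. g k z)" and \<omega>: "\<omega> \<in> {-1, 1}"
    and v: "\<And>z. z \<in> S \<Longrightarrow> \<omega> * det (frame (v z) (f z) (\<lambda>k. g k z)) > 0"
      "\<And>z. z \<in> S \<Longrightarrow> mink (f z) (v z) = 0" "\<And>z. z \<in> S \<Longrightarrow> mink (v z) (v z) = 1"
      "\<And>z k. z \<in> S \<Longrightarrow> mink (g k z) (v z) = 0"
  shows "smooth_on S v"
proof -
  define n where "n z = normal_cross (f z) (\<lambda>k. g k z)" for z
  note formula = unit_normal_formula[OF \<omega> v(1,2,3,4), folded n_def]
  have n: "smooth_on S n" unfolding n_def by (rule smooth_on_normal_cross[OF assms(1-3)])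
  have "smooth_on S (\<lambda>z. mink (n z) (n z) powr (-1/2))"
    by (rule smooth_on_compose[OF assms(1) open_greaterThan _
          smooth_on_bounded_bilinear[OF assms(1) bounded_bilinear_mink n n] smooth_on_powr])
      (use formula(1) in auto)
  then have "smooth_on S (\<lambda>z. (\<omega> * mink (n z) (n z) powr (-1/2)) *\<^sub>R n z)"
    by (intro smooth_on_bounded_bilinear[OF assms(1) bounded_bilinear_scaleR] n
        smooth_on_bounded_linear_compose[OF assms(1) bounded_linear_mult_right])
  then show ?thesis by (rule smooth_on_cong[OF assms(1), rotated]) (use formula(2) in auto)
qed

section \<open>Passage from the manifold to a coordinate patch\<close>

lemma chart_inv:
  assumes "oriented_smooth_manifold X A" "c \<in> A"
  shows "open (snd c ` fst c)" "p \<in> fst c \<Longrightarrow> chart_inv c (snd c p) = p"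
    "y \<in> snd c ` fst c \<Longrightarrow> chart_inv c y \<in> fst c"
    "y \<in> snd c ` fst c \<Longrightarrow> snd c (chart_inv c y) = y" "fst c \<subseteq> topspace X"
proof -
  have c: "openin X (fst c)" "open (snd c ` fst c)"
    "homeomorphic_map (subtopology X (fst c)) (top_of_set (snd c ` fst c)) (snd c)"
    using assms by (auto simp: oriented_smooth_manifold_def)
  show "open (snd c ` fst c)" "fst c \<subseteq> topspace X" using c(1,2) openin_subset by auto
  have inj: "inj_on (snd c) (fst c)"
    using homeomorphic_imp_injective_map[OF c(3)] openin_subset[OF c(1)]
    by (simp add: topspace_subtopology inf.absorb2)
  show "p \<in> fst c \<Longrightarrow> chart_inv c (snd c p) = p"
    unfolding chart_inv_def by (rule the_inv_into_f_f[OF inj])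
  show "y \<in> snd c ` fst c \<Longrightarrow> chart_inv c y \<in> fst c"
    unfolding chart_inv_def by (rule the_inv_into_into[OF inj]) auto
  show "y \<in> snd c ` fst c \<Longrightarrow> snd c (chart_inv c y) = y"
    unfolding chart_inv_def by (rule f_the_inv_into_f[OF inj])
qed

theorem corollaryA2:
  fixes X :: "'m topology" and A :: "('m, 'n::finite) chart set"
    and \<sigma> \<nu> :: "real \<Rightarrow> 'm \<Rightarrow> 'n minkowski"
    and lam :: "real \<Rightarrow> 'm \<Rightarrow> 'n \<Rightarrow> real"
    and \<epsilon> \<omega> :: real
  assumes "oriented_smooth_manifold X A"
    and "\<epsilon> > 0"
    and "\<omega> \<in> {-1, 1}"
    and "smooth_family A {-\<epsilon><..<\<epsilon>} \<sigma>"
    and "\<And>t. t \<in> {-\<epsilon><..<\<epsilon>} \<Longrightarrow> hyp_immersion A (\<sigma> t)"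
    and "\<And>t. t \<in> {-\<epsilon><..<\<epsilon>} \<Longrightarrow> unit_normal \<omega> A (\<sigma> t) (\<nu> t)"
    and "\<And>t c p. t \<in> {-\<epsilon><..<\<epsilon>} \<Longrightarrow> c \<in> A \<Longrightarrow> p \<in> fst c \<Longrightarrow>
           eigenvalues_of (shape_operator c (\<sigma> t) (\<nu> t) p) (lam t p)"
    and "\<And>t p k. t \<in> {-\<epsilon><..<\<epsilon>} \<Longrightarrow> p \<in> topspace X \<Longrightarrow> lam t p k \<in> {-1<..<1}"
    and "\<And>t p. t \<in> {-\<epsilon><..<\<epsilon>} \<Longrightarrow> p \<in> topspace X \<Longrightarrow>
           ((\<lambda>r. \<sigma> r p) has_vector_derivative
              ((1 / real CARD('n)) * (\<Sum>k\<in>UNIV. artanh (lam t p k))) *\<^sub>R \<nu> t p) (at t)"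
  shows "\<forall>t\<in>{-\<epsilon><..<\<epsilon>}. \<forall>c\<in>A. \<forall>p\<in>fst c. \<forall>Om s.
           geod_chart Om s \<and> gauss_map (\<sigma> t) (\<nu> t) p \<in> (\<lambda>u. geod (s u)) ` Om \<longrightarrow>
           (let G = (\<lambda>t. gauss_map (\<sigma> t) (\<nu> t));
                dG = geod_map_diff c Om s (G t) p;
                H = geod_mean_curvature c Om s (G t) p
            in \<exists>w. dG w = geod_J H \<and>
                 has_geod_velocity Om s (\<lambda>r. G r p)
                   (\<lambda>z. H z + dG (shape_operator c (\<sigma> t) (\<nu> t) p w) z) t)"
proof (intro ballI allI impI, elim conjE)
  fix t c p Om s
  assume t: "t \<in> {-\<epsilon><..<\<epsilon>}" and c: "c \<in> A" and p: "p \<in> fst c" and chart: "geod_chart Om s"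
    and cov: "gauss_map (\<sigma> t) (\<nu> t) p \<in> (\<lambda>u. geod (s u)) ` Om"
  let ?I = "{-\<epsilon><..<\<epsilon>}"
  define U where "U = snd c ` fst c"
  define ci where "ci = chart_inv c"
  note ci = chart_inv[OF assms(1) c, folded U_def ci_def]
  define \<Phi> where "\<Phi> = (\<lambda>(y, r). \<sigma> r (ci y))"
  define \<Psi> where "\<Psi> = (\<lambda>(y, r). \<nu> r (ci y))"
  define B where "B r y = shape_operator c (\<sigma> r) (\<nu> r) (ci y)" for r y
  define lam' where "lam' r y = lam r (ci y)" for r y
  have UI: "open U" "open ?I" "open (U \<times> ?I)" using ci(1) by (auto intro: open_Times)
  have smooth_\<Phi>: "smooth_on (U \<times> ?I) \<Phi>"
    using assms(4) c by (simp add: smooth_family_def U_def \<Phi>_def ci_def)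
  have \<Phi>_deriv: "(\<Phi> has_derivative \<partial> \<Phi> z) (at z)" if "z \<in> U \<times> ?I" for z
    by (rule smooth_on_has_derivative[OF smooth_\<Phi> that])
  have diff: "chart_diff c h (ci y) = \<partial> (\<lambda>y. h (ci y)) y" if "y \<in> U" for h :: "'m \<Rightarrow> 'n minkowski" and y
    using ci(4)[OF that] by (simp add: chart_diff_def ci_def o_def)
  have diff\<sigma>: "chart_diff c (\<sigma> r) (ci y) a = \<partial> \<Phi> (y, r) (a, 0)" if "y \<in> U" "r \<in> ?I" for r y a
    using has_derivative_eq_frechet[OF has_derivative_slice(1)[OF \<Phi>_deriv, of y r]] that
    by (simp add: diff \<Phi>_def)
  have in_hyp: "\<sigma> r (ci y) \<in> hyp_space" "inj (chart_diff c (\<sigma> r) (ci y))" if "y \<in> U" "r \<in> ?I" for r y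
    using assms(5)[OF that(2)] c ci(3)[OF that(1)] by (auto simp: hyp_immersion_def)
  have \<nu>: "mink (\<Phi> z) (\<Psi> z) = 0" "mink (\<Psi> z) (\<Psi> z) = 1" "mink (\<partial> \<Phi> z (a, 0)) (\<Psi> z) = 0"
    "\<omega> * det (frame (\<Psi> z) (\<Phi> z) (\<lambda>k. \<partial> \<Phi> z (axis k 1, 0))) > 0" if zz: "z \<in> U \<times> ?I" for z a
  proof -
    obtain y r where z: "z = (y, r)" "y \<in> U" "r \<in> ?I" using zz by blast
    have un: "mink (\<sigma> r (ci y)) (\<nu> r (ci y)) = 0" "mink (\<nu> r (ci y)) (\<nu> r (ci y)) = 1"
      "mink (chart_diff c (\<sigma> r) (ci y) a) (\<nu> r (ci y)) = 0"
      "\<omega> * det (\<chi> i j. case j of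
                Some (Some k) \<Rightarrow> chart_diff c (\<sigma> r) (ci y) (axis k 1) $ i
              | Some None \<Rightarrow> \<nu> r (ci y) $ i
              | None \<Rightarrow> \<sigma> r (ci y) $ i) > 0"
      using assms(6)[OF z(3)] c ci(3)[OF z(2)] unfolding unit_normal_def by blast+
    have "(\<chi> i j. case j of
                Some (Some k) \<Rightarrow> chart_diff c (\<sigma> r) (ci y) (axis k 1) $ i
              | Some None \<Rightarrow> \<nu> r (ci y) $ i
              | None \<Rightarrow> \<sigma> r (ci y) $ i) = transpose (frame (\<Psi> z) (\<Phi> z) (\<lambda>k. \<partial> \<Phi> z (axis k 1, 0)))"
      by (auto simp: vec_eq_iff transpose_def frame_def diff\<sigma>[OF z(2,3)] z(1) \<Phi>_def \<Psi>_def split: option.split)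
    then show "\<omega> * det (frame (\<Psi> z) (\<Phi> z) (\<lambda>k. \<partial> \<Phi> z (axis k 1, 0))) > 0"
      using un(4) by (simp add: det_transpose)
    show "mink (\<Phi> z) (\<Psi> z) = 0" "mink (\<Psi> z) (\<Psi> z) = 1" "mink (\<partial> \<Phi> z (a, 0)) (\<Psi> z) = 0"
      using un(1-3) by (simp_all add: z(1) \<Phi>_def \<Psi>_def diff\<sigma>[OF z(2,3), unfolded \<Phi>_def])
  qed
  \<comment> \<open>Joint smoothness of the normal in position and time is deduced here from that of
    \<Phi> and its partial derivatives.\<close>
  have smooth_\<Psi>: "smooth_on (U \<times> ?I) \<Psi>"
    by (rule smooth_on_unit_normal[OF UI(3) smooth_\<Phi> smooth_on_frechet_derivative[OF smooth_\<Phi>] assms(3)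
          \<nu>(4,1,2,3)])
  have hyper: "hypersurface U (\<lambda>y. \<Phi> (y, r)) (\<lambda>y. \<Psi> (y, r)) (B r) (lam' r)" if r: "r \<in> ?I" for r
  proof
    note sm = smooth_on_slice(1)[OF UI(1,2)]
    show smooth_f: "smooth_on U (\<lambda>y. \<Phi> (y, r))" and smooth_N: "smooth_on U (\<lambda>y. \<Psi> (y, r))"
      by (rule sm[OF smooth_\<Phi> r] sm[OF smooth_\<Psi> r])+
    fix y assume y: "y \<in> U"
    then have z: "(y, r) \<in> U \<times> ?I" using r by simp
    show unit: "(\<Phi> (y, r), \<Psi> (y, r)) \<in> unit_tangent" if "y \<in> U" for y
      using \<nu>[of "(y, r)"] in_hyp(1)[OF that r] that r by (simp add: unit_tangent_def \<Phi>_def)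
    have df: "\<partial> (\<lambda>y. \<Phi> (y, r)) y a = \<partial> \<Phi> (y, r) (a, 0)" for a
      by (simp add: has_derivative_eq_frechet[OF has_derivative_slice(1)[OF \<Phi>_deriv[OF z]]])
    have df': "chart_diff c (\<sigma> r) (ci y) a = \<partial> (\<lambda>y. \<Phi> (y, r)) y a" for a
      by (simp add: df diff\<sigma>[OF y r])
    have dN: "chart_diff c (\<nu> r) (ci y) a = \<partial> (\<lambda>y. \<Psi> (y, r)) y a" for a
      by (simp add: diff[OF y] \<Psi>_def)
    show normal: "mink (\<partial> (\<lambda>y. \<Phi> (y, r)) y a) (\<Psi> (y, r)) = 0" for a
      unfolding df by (rule \<nu>(3)[OF z])
    have "chart_diff c (\<sigma> r) (ci y) = \<partial> (\<lambda>y. \<Phi> (y, r)) y" by (rule ext) (rule df')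
    then show inj: "inj (\<partial> (\<lambda>y. \<Phi> (y, r)) y)" using in_hyp(2)[OF y r] by simp
    have lin: "linear (\<partial> (\<lambda>y. \<Phi> (y, r)) y)"
      by (rule has_derivative_linear[OF smooth_on_has_derivative[OF smooth_f y]])
    note un = unit_tangentD[OF unit[OF y], simplified]
    have "((\<lambda>y. (\<Phi> (y, r), \<Psi> (y, r))) has_derivative
        (\<lambda>a. (\<partial> (\<lambda>y. \<Phi> (y, r)) y a, \<partial> (\<lambda>y. \<Psi> (y, r)) y a))) (at y)"
      by (intro has_derivative_Pair smooth_on_has_derivative[OF smooth_f y] smooth_on_has_derivative[OF smooth_N y])
    then have tan: "(\<partial> (\<lambda>y. \<Phi> (y, r)) y a, \<partial> (\<lambda>y. \<Psi> (y, r)) y a) \<in> tangent_T1 (\<Phi> (y, r), \<Psi> (y, r))" for a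
      using tangent_T1_derivative[OF UI(1) y, of "\<lambda>y. (\<Phi> (y, r), \<Psi> (y, r))"] unit by blast
    show spanning: "w \<in> range (\<partial> (\<lambda>y. \<Phi> (y, r)) y)"
      if w: "mink w (\<Phi> (y, r)) = 0" "mink w (\<Psi> (y, r)) = 0" for w
    proof -
      have "mink (\<partial> \<Phi> (y, r) (a, 0)) (\<Phi> (y, r)) = 0" for a
        using tan[of a] by (auto simp: tangent_T1_def df mink_sym)
      moreover have "det (frame (\<Psi> (y, r)) (\<Phi> (y, r)) (\<lambda>k. \<partial> \<Phi> (y, r) (axis k 1, 0))) \<noteq> 0"
        using \<nu>(4)[OF z] by auto
      ultimately obtain e where "w = (\<Sum>k\<in>UNIV. e k *\<^sub>R \<partial> \<Phi> (y, r) (axis k 1, 0))"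
        using w un \<nu>(3)[OF z] by (elim frame_span[of "\<Psi> (y, r)" "\<Phi> (y, r)" _ w]) auto
      then have "w = \<partial> (\<lambda>y. \<Phi> (y, r)) y (\<Sum>k\<in>UNIV. e k *\<^sub>R axis k 1)"
        by (simp only: linear_sum[OF lin] linear_scale[OF lin] flip: df)
      then show ?thesis by blast
    qed
    \<comment> \<open>The derivative of \<Psi> is orthogonal to \<Phi>, so the correction in
      \<open>hyp_cov_deriv\<close> vanishes; orthogonal to \<Psi> as well, it is tangent, so the
      description defining \<open>shape_operator\<close> has a solution, unique by
      injectivity.\<close>
    show "\<partial> (\<lambda>y. \<Psi> (y, r)) y a = - \<partial> (\<lambda>y. \<Phi> (y, r)) y (B r y a)" for a
    proof -
      let ?dN = "\<partial> (\<lambda>y. \<Psi> (y, r)) y a"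
      have "mink ?dN (\<Phi> (y, r)) = 0" "mink ?dN (\<Psi> (y, r)) = 0"
        using tan[of a] normal[of a] by (auto simp: tangent_T1_def mink_sym)
      moreover from this obtain b where b: "\<partial> (\<lambda>y. \<Phi> (y, r)) y b = - ?dN"
        using spanning[of "- ?dN"] by auto
      moreover have "\<sigma> r (ci y) = \<Phi> (y, r)" by (simp add: \<Phi>_def)
      ultimately have "B r y a = (THE b'. \<partial> (\<lambda>y. \<Phi> (y, r)) y b' = \<partial> (\<lambda>y. \<Phi> (y, r)) y b)"
        by (simp add: B_def shape_operator_def hyp_cov_deriv_def df' dN)
      also have "\<dots> = b" using injD[OF inj] by blast
      finally show ?thesis using b by simp
    qed
    show "eigenvalues_of (B r y) (lam' r y)"
      unfolding B_def lam'_def by (rule assms(7)[OF r c ci(3)[OF y]])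
    show "lam' r y k \<in> {-1<..<1}" for k
      unfolding lam'_def using assms(8)[OF r] ci(3)[OF y] ci(5) by blast
  qed (rule UI(1))
  interpret normal_evolution U ?I \<Phi> \<Psi> B lam'
  proof (rule normal_evolution.intro)
    fix y r assume y: "y \<in> U" and r: "r \<in> ?I"
    have "((\<lambda>r. \<Phi> (y, r)) has_derivative (\<lambda>q. \<partial> \<Phi> (y, r) (0, q))) (at r)"
      using y r by (intro has_derivative_slice(2) \<Phi>_deriv) simp
    moreover have "((\<lambda>r. \<Phi> (y, r)) has_derivative (\<lambda>q. q *\<^sub>R ((1 / real CARD('n) *
        (\<Sum>k\<in>UNIV. artanh (lam' r y k))) *\<^sub>R \<Psi> (y, r)))) (at r)"
      using assms(9)[OF r, of "ci y"] ci(3)[OF y] ci(5)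
      by (auto simp: has_vector_derivative_def \<Phi>_def \<Psi>_def lam'_def)
    ultimately show "\<partial> \<Phi> (y, r) (0, 1) = (1 / real CARD('n) * (\<Sum>k\<in>UNIV. artanh (lam' r y k))) *\<^sub>R \<Psi> (y, r)"
      using has_derivative_unique fun_cong[of _ _ "1 :: real"] by (metis (no_types, lifting) scaleR_one)
  qed (fact UI(1,2) smooth_\<Phi> smooth_\<Psi> hyper)+
  define x where "x = snd c p"
  have x: "x \<in> U" "ci x = p" using p ci(2) by (auto simp: x_def U_def)
  define F where "F = (\<lambda>t y. geod_coord Om s (geod (\<Phi> (y, t), \<Psi> (y, t))))"
  have G: "gauss_map (\<sigma> r) (\<nu> r) (ci y) = geod (\<Phi> (y, r), \<Psi> (y, r))" for r y
    by (simp add: gauss_map_def \<Phi>_def \<Psi>_def)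
  have coord: "geod_map_coord c Om s (gauss_map (\<sigma> t) (\<nu> t)) = F t"
    by (simp add: fun_eq_iff geod_map_coord_def F_def G flip: ci_def)
  have Fx: "geod_coord Om s (gauss_map (\<sigma> r) (\<nu> r) p) = F r x" for r
    using G[of r x] by (simp add: F_def x(2))
  let ?H = "mean_curvature (geod_chart_metric s) (F t) x"
  have cov': "geod (\<Phi> (x, t), \<Psi> (x, t)) \<in> (\<lambda>u. geod (s u)) ` Om"
    using cov G[of t x] x(2) by simp
  obtain w where w:
    "hor_lift s (F t x) (\<partial> (F t) x w) = para_J (hor_lift s (F t x) ?H)"
    "((\<lambda>r. F r x) has_vector_derivative (?H + \<partial> (F t) x (B t x w))) (at t)"
    unfolding F_def by (rule gauss_map_evolution[OF chart x(1) t cov'])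
  have "F t x \<in> Om"
  proof -
    interpret geod_param Om s by standard (rule chart)
    show ?thesis using coord_in[OF cov] by (simp add: Fx)
  qed
  then have lin: "linear (\<partial> s (F t x))"
    using chart has_derivative_linear[OF smooth_on_has_derivative] unfolding geod_chart_def by blast
  have dG: "geod_map_diff c Om s (gauss_map (\<sigma> t) (\<nu> t)) p a = geod_dp (s (F t x)) (\<partial> s (F t x) (\<partial> (F t) x a))" for a
    by (simp add: geod_map_diff_def geod_chart_vec_def Fx coord flip: x_def)
  have H: "geod_mean_curvature c Om s (gauss_map (\<sigma> t) (\<nu> t)) p = geod_dp (s (F t x)) (\<partial> s (F t x) ?H)"
    by (simp add: geod_mean_curvature_def geod_chart_vec_def Fx coord flip: x_def)
  have "geod_dp (s (F t x)) (\<partial> s (F t x) (\<partial> (F t) x w)) = geod_J (geod_dp (s (F t x)) (\<partial> s (F t x) ?H))"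
    by (rule geod_J_geod_dp[symmetric]) (use w(1) in \<open>simp add: hor_lift_def\<close>)
  moreover have "shape_operator c (\<sigma> t) (\<nu> t) p = B t x" by (simp add: B_def x(2))
  moreover have "(\<lambda>z. geod_dp (s (F t x)) (\<partial> s (F t x) ?H) z +
      geod_dp (s (F t x)) (\<partial> s (F t x) (\<partial> (F t) x (B t x w))) z) =
    geod_chart_vec s (F t x) (?H + \<partial> (F t) x (B t x w))"
    by (simp add: fun_eq_iff geod_chart_vec_def linear_add[OF lin] geod_dp_add)
  ultimately show "let G = (\<lambda>t. gauss_map (\<sigma> t) (\<nu> t));
                dG = geod_map_diff c Om s (G t) p;
                H = geod_mean_curvature c Om s (G t) p
            in \<exists>w. dG w = geod_J H \<and>
                 has_geod_velocity Om s (\<lambda>r. G r p)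
                   (\<lambda>z. H z + dG (shape_operator c (\<sigma> t) (\<nu> t) p w) z) t"
    using w(2) unfolding Let_def has_geod_velocity_def
    by (intro exI[of _ w] conjI exI[of _ "?H + \<partial> (F t) x (B t x w)"]) (simp_all add: dG H Fx)
qed

end
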